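(* There exists a positive constant $C$, independent of $h$, $\tau$ and $n$, such that for every mesh $\mathcal{K}_h$ of the family, every integer $N\ge1$ with $\tau=T/N$, and every solution $(u_h^n)_{n=0}^N$ of the fully implicit Crank-Nicolson discontinuous Galerkin scheme, i.e. $u_h^0=R_hu^0$ and $u_h^1,\dots,u_h^N\in V_h^k$ with, for every $n=1,\dots,N$, $$(D_\tau u_{h}^{n},v_{h})+(\nu + \mathrm{i}\alpha)\,a_h(\hat{u}_h^n, v_h)+(\kappa + \mathrm{i}\beta)\,(| \hat{u}^n_h |^2 \hat{u}_h^n,v_h)-\gamma\, (\hat{u}_h^n,v_h)=0\qquad \text{for all } v_h\in V_h^k ,$$ one has $$\|u_h^n\|_{\mathrm{DG}}\le C,\qquad 0\le n\le N.$$
   Context: Problem: $\Omega\subset\mathbb{R}^2$ is a bounded convex polygonal domain, $T>0$, and $\nu>0$, $\kappa>0$, $\alpha,\beta,\gamma$ are given real constants. $u^0$ is a sufficiently smooth complex-valued function on $\bar\Omega$ with zero boundary trace, and $u$ denotes the exact solution of the Ginzburg-Landau equation $u_t-(\nu+\mathrm{i}\alpha)\Delta u+(\kappa+\mathrm{i}\beta)|u|^2u-\gamma u=0$ in $\Omega\times(0,T]$ with $u=0$ on $\partial\Omega\times(0,T]$ and $u(\cdot,0)=u^0$. The exact solution is assumed to exist and be sufficiently smooth, e.g. $u\in C^3([0,T];H^{k+1}(\Omega)\cap H_0^1(\Omega))$. Inner product: $(u,v)=\int_\Omega u v^*\,\mathrm{d}\boldsymbol{x}$, where $v^*$ is the complex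 conjugate; $\|u\|=\sqrt{(u,u)}$ is the $L^2(\Omega)$ norm. Mesh and space: $\{\mathcal{K}_h\}$ is a sequence of conforming quasi-uniform triangulations of $\Omega$ with mesh size $h$ (largest element diameter); $\mathcal{E}_h$ is the set of all edges, with interior edges $\mathcal{E}_h^i$ and boundary edges $\mathcal{E}_h^b$; $h_E$ is the length of $E$. Each edge $E$ has a fixed unit normal $\boldsymbol{n}_E$ (outward to $\Omega$ if $E\subset\partial\Omega$). For $E\in\mathcal{E}_h^i$ shared by $K_1,K_2$, where $\boldsymbol{n}_E$ points out of $K_1$, $\{v\}=\frac12(v|_{K_1}+v|_{K_2})$ and $[v]=v|_{K_1}-v|_{K_2}$; for $E\in\mathcal{E}_h^b$, $\{v\}=[v]=v|_K$. For a fixed integer $k\ge1$, $V_h^k=\{v_h\in L^2(\Omega;\mathbb{C}): v_h|_K\in\mathbb{P}_k(K)\ \forall K\in\mathcal{K}_h\}$, with $\mathbb{P}_k(K)$ the complex polynomials of total degree at most $k$. DG norm: $\|v_h\|_{\mathrm{DG}}=\big(\sum_{K}\int_K|\nabla v_h|^2\,\mathrm{d}\boldsymbol{x}+\sum_{E\in\mathcal{E}_h}\frac1{h_E}\int_E|[v_h]|^2\,\mathrm{d}s\big)^{1/2}$. Bilinear form (with $\nabla_h$ the piecewise gradient): $$a_h(v_h,w_h)=\int_\Omega\nabla_hv_h\cdot\nabla_hw_h^*\,\mathrm{d}\boldsymbol{x}-\sum_{E\in\mathcal{E}_h}\int_E\{\nabla_hv_h\}\cdot\boldsymbol{n}_E[w_h^*]\,\mathrm{d}s-\sum_{E\in\mathcal{E}_h}\int_E[v_h]\{\nabla_hw_h^*\}\cdot\boldsymbol{n}_E\,\mathrm{d}s+\sum_{E\in\mathcal{E}_h}\frac{\lambda}{h_E}\int_E[v_h][w_h^*]\,\mathrm{d}s,$$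 where the penalty parameter $\lambda$ is fixed sufficiently large (independently of $h$), so that there are constants $C_1,C_2>0$ independent of $h$ with $C_1\|v_h\|_{\mathrm{DG}}^2\le a_h(v_h,v_h)\le C_2\|v_h\|_{\mathrm{DG}}^2$ for all $v_h\in V_h^k$. Ritz projection: for $w\in H^{k+1}(\Omega)$, $R_hw\in V_h^k$ is defined by $a_h(R_hw,v_h)=-(\Delta w,v_h)$ for all $v_h\in V_h^k$. Time grid: $t_n=n\tau$, $D_\tau\phi^n=(\phi^n-\phi^{n-1})/\tau$, $\hat\phi^n=(\phi^n+\phi^{n-1})/2$. The constant $C$ may depend on $\Omega$, $T$, the equation's coefficients, $k$, $\lambda$, the mesh-regularity constants and the exact solution $u$. *)

theory Defs
  imports "HOL-Analysis.Analysis"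
begin

section \<open>Lebesgue and Sobolev spaces on a planar domain\<close>

definition sq_integrable :: "(real^2) set \<Rightarrow> (real^2 \<Rightarrow> complex) \<Rightarrow> bool" where
  "sq_integrable \<Omega> f \<longleftrightarrow>
     set_borel_measurable lebesgue \<Omega> f \<and> set_integrable lebesgue \<Omega> (\<lambda>x. (cmod (f x))\<^sup>2)"

definition l2_inner :: "(real^2) set \<Rightarrow> (real^2 \<Rightarrow> complex) \<Rightarrow> (real^2 \<Rightarrow> complex) \<Rightarrow> complex" where
  "l2_inner \<Omega> f g = (LINT x:\<Omega>|lebesgue. f x * cnj (g x))"

definition l2_norm :: "(real^2) set \<Rightarrow> (real^2 \<Rightarrow> complex) \<Rightarrow> real" where
  "l2_norm \<Omega> f = sqrt (LINT x:\<Omega>|lebesgue. (cmod (f x))\<^sup>2)"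

definition partial :: "2 \<Rightarrow> (real^2 \<Rightarrow> complex) \<Rightarrow> real^2 \<Rightarrow> complex" where
  "partial i f x = frechet_derivative f (at x) (axis i 1)"

text \<open>A function all of whose iterated partial derivatives (in any order) exist and are Frechet
  differentiable everywhere is exactly a \<open>C\<^sup>\<infinity>\<close> function.\<close>

definition smooth :: "(real^2 \<Rightarrow> complex) \<Rightarrow> bool" where
  "smooth f \<longleftrightarrow> (\<forall>is x. foldr partial is f differentiable (at x))"

definition test_function :: "(real^2) set \<Rightarrow> (real^2 \<Rightarrow> complex) \<Rightarrow> bool" where
  "test_function \<Omega> \<phi> \<longleftrightarrow>
     smooth \<phi> \<and> compact (closure {x. \<phi> x \<noteq> 0}) \<and> closure {x. \<phi> x \<noteq> 0} \<subseteq> \<Omega>"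

text \<open>The multi-index is a pair \<open>(i, j)\<close>: \<open>i\<close> derivatives in the first and \<open>j\<close> in the second
  variable. Only square-integrable weak derivatives are considered, which is all that is needed
  for the spaces \<open>H\<^sup>m\<close>.\<close>

definition has_weak_deriv ::
    "(real^2) set \<Rightarrow> nat \<times> nat \<Rightarrow> (real^2 \<Rightarrow> complex) \<Rightarrow> (real^2 \<Rightarrow> complex) \<Rightarrow> bool" where
  "has_weak_deriv \<Omega> = (\<lambda>(i, j) w g. sq_integrable \<Omega> g \<and>
     (\<forall>\<phi>. test_function \<Omega> \<phi> \<longrightarrow>
        (LINT x:\<Omega>|lebesgue. w x * ((partial 1 ^^ i) ((partial 2 ^^ j) \<phi>)) x)
          = (- 1) ^ (i + j) * (LINT x:\<Omega>|lebesgue. g x * \<phi> x)))"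

text \<open>A representative of the weak derivative; it is determined almost everywhere in \<open>\<Omega>\<close>.\<close>

definition weak_deriv ::
    "(real^2) set \<Rightarrow> nat \<times> nat \<Rightarrow> (real^2 \<Rightarrow> complex) \<Rightarrow> real^2 \<Rightarrow> complex" where
  "weak_deriv \<Omega> a w = (SOME g. has_weak_deriv \<Omega> a w g)"

definition laplacian :: "(real^2) set \<Rightarrow> (real^2 \<Rightarrow> complex) \<Rightarrow> real^2 \<Rightarrow> complex" where
  "laplacian \<Omega> w x = weak_deriv \<Omega> (2, 0) w x + weak_deriv \<Omega> (0, 2) w x"

definition sobolev :: "nat \<Rightarrow> (real^2) set \<Rightarrow> (real^2 \<Rightarrow> complex) set" where
  "sobolev m \<Omega> = {w. sq_integrable \<Omega> w \<and>
     (\<forall>i j. i + j \<le> m \<longrightarrow> (\<exists>g. has_weak_deriv \<Omega> (i, j) w g))}"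

definition sobolev_norm :: "nat \<Rightarrow> (real^2) set \<Rightarrow> (real^2 \<Rightarrow> complex) \<Rightarrow> real" where
  "sobolev_norm m \<Omega> w =
     sqrt (\<Sum>(i, j)\<in>{(i, j). i + j \<le> m}. (l2_norm \<Omega> (weak_deriv \<Omega> (i, j) w))\<^sup>2)"

text \<open>\<open>H\<^sub>0\<^sup>1(\<Omega>)\<close> as the closure of the test functions in \<open>H\<^sup>1(\<Omega>)\<close>.\<close>

definition sobolev0 :: "(real^2) set \<Rightarrow> (real^2 \<Rightarrow> complex) set" where
  "sobolev0 \<Omega> = {w \<in> sobolev 1 \<Omega>. \<exists>\<phi>. (\<forall>n::nat. test_function \<Omega> (\<phi> n)) \<and>
     (\<lambda>n. sobolev_norm 1 \<Omega> (\<lambda>x. w x - \<phi> n x)) \<longlonglongrightarrow> 0}"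

text \<open>Time-dependent functions with values in \<open>H\<^sup>m(\<Omega>) \<inter> H\<^sub>0\<^sup>1(\<Omega>)\<close>, normed by the \<open>H\<^sup>m\<close> norm.
  At the end points of \<open>[0,T]\<close> time derivatives are one-sided.\<close>

definition has_time_deriv :: "nat \<Rightarrow> (real^2) set \<Rightarrow> real \<Rightarrow>
    (real \<Rightarrow> real^2 \<Rightarrow> complex) \<Rightarrow> (real \<Rightarrow> real^2 \<Rightarrow> complex) \<Rightarrow> bool" where
  "has_time_deriv m \<Omega> T u u' \<longleftrightarrow> (\<forall>t\<in>{0..T}. u' t \<in> sobolev m \<Omega> \<inter> sobolev0 \<Omega> \<and>
     ((\<lambda>s. sobolev_norm m \<Omega> (\<lambda>x. (u s x - u t x) / of_real (s - t) - u' t x)) \<longlongrightarrow> 0)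
       (at t within {0..T}))"

primrec C_time :: "nat \<Rightarrow> nat \<Rightarrow> (real^2) set \<Rightarrow> real \<Rightarrow> (real \<Rightarrow> real^2 \<Rightarrow> complex) \<Rightarrow> bool" where
  "C_time 0 m \<Omega> T u \<longleftrightarrow> (\<forall>t\<in>{0..T}. u t \<in> sobolev m \<Omega> \<inter> sobolev0 \<Omega> \<and>
     ((\<lambda>s. sobolev_norm m \<Omega> (\<lambda>x. u s x - u t x)) \<longlongrightarrow> 0) (at t within {0..T}))"
| "C_time (Suc r) m \<Omega> T u \<longleftrightarrow> (\<forall>t\<in>{0..T}. u t \<in> sobolev m \<Omega> \<inter> sobolev0 \<Omega>) \<and>
     (\<exists>u'. has_time_deriv m \<Omega> T u u' \<and> C_time r m \<Omega> T u')"

section \<open>The Ginzburg-Landau equation\<close>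

definition convex_polygonal_domain :: "(real^2) set \<Rightarrow> bool" where
  "convex_polygonal_domain \<Omega> \<longleftrightarrow> open \<Omega> \<and> \<Omega> \<noteq> {} \<and> bounded \<Omega> \<and> convex \<Omega> \<and> polytope (closure \<Omega>)"

text \<open>The boundary condition is the membership \<open>u t \<in> H\<^sub>0\<^sup>1(\<Omega>)\<close> contained in \<open>C_time\<close>.\<close>

definition smooth_GL_solution ::
    "nat \<Rightarrow> (real^2) set \<Rightarrow> real \<Rightarrow> real \<Rightarrow> real \<Rightarrow> real \<Rightarrow> real \<Rightarrow> real \<Rightarrow>
      (real^2 \<Rightarrow> complex) \<Rightarrow> (real \<Rightarrow> real^2 \<Rightarrow> complex) \<Rightarrow> bool" where
  "smooth_GL_solution k \<Omega> T \<nu> \<alpha> \<kappa> \<beta> \<gamma> u0 u \<longleftrightarrow>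
     C_time 3 (k + 1) \<Omega> T u \<and>
     (AE x in lebesgue. x \<in> \<Omega> \<longrightarrow> u 0 x = u0 x) \<and>
     (\<exists>u'. has_time_deriv (k + 1) \<Omega> T u u' \<and>
       (\<forall>t\<in>{0<..T}. AE x in lebesgue. x \<in> \<Omega> \<longrightarrow>
          u' t x - Complex \<nu> \<alpha> * laplacian \<Omega> (u t) x
            + Complex \<kappa> \<beta> * of_real ((cmod (u t x))\<^sup>2) * u t x - of_real \<gamma> * u t x = 0))"

section \<open>Meshes\<close>

definition conforming_mesh :: "(real^2) set \<Rightarrow> (real^2) set set \<Rightarrow> bool" where
  "conforming_mesh \<Omega> \<K> \<longleftrightarrow> triangulation \<K> \<and> (\<forall>K\<in>\<K>. 2 simplex K) \<and> \<Union>\<K> = closure \<Omega>"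

definition mesh_size :: "(real^2) set set \<Rightarrow> real" where
  "mesh_size \<K> = Max (diameter ` \<K>)"

text \<open>Every element of every mesh contains a disc whose radius is a fixed fraction of the mesh
  size; this comprises both shape regularity and comparability of the element sizes.\<close>

definition quasi_uniform :: "(nat \<Rightarrow> (real^2) set set) \<Rightarrow> bool" where
  "quasi_uniform \<K> \<longleftrightarrow> (\<exists>\<sigma>>0. \<forall>j. \<forall>K\<in>\<K> j. \<exists>z. cball z (\<sigma> * mesh_size (\<K> j)) \<subseteq> K)"

definition edges :: "(real^2) set set \<Rightarrow> (real^2) set set" where
  "edges \<K> = {E. \<exists>K\<in>\<K>. E edge_of K}"

definition boundary_edge :: "(real^2) set \<Rightarrow> (real^2) set \<Rightarrow> bool" where
  "boundary_edge \<Omega> E \<longleftrightarrow> E \<subseteq> frontier \<Omega>"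

definition unit_normal :: "real^2 \<Rightarrow> (real^2) set \<Rightarrow> bool" where
  "unit_normal n E \<longleftrightarrow> norm n = 1 \<and> (\<forall>x\<in>E. \<forall>y\<in>E. n \<bullet> (y - x) = 0)"

text \<open>For a convex set \<open>S\<close> having \<open>E\<close> in its boundary: \<open>n\<close> points out of \<open>S\<close> across \<open>E\<close>.\<close>

definition points_out :: "real^2 \<Rightarrow> (real^2) set \<Rightarrow> (real^2) set \<Rightarrow> bool" where
  "points_out n E S \<longleftrightarrow> (\<forall>x\<in>E. \<forall>y\<in>interior S. n \<bullet> (y - x) < 0)"

definition normal_field ::
    "(real^2) set \<Rightarrow> (real^2) set set \<Rightarrow> ((real^2) set \<Rightarrow> real^2) \<Rightarrow> bool" where
  "normal_field \<Omega> \<K> n \<longleftrightarrow> (\<forall>E\<in>edges \<K>. unit_normal (n E) E \<and>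
     (boundary_edge \<Omega> E \<longrightarrow> points_out (n E) E \<Omega>))"

text \<open>\<open>elem1\<close> is the element \<open>K\<^sub>1\<close> out of which \<open>n E\<close> points (the only adjacent element if \<open>E\<close> is a
  boundary edge), and \<open>elem2\<close> is the element \<open>K\<^sub>2\<close> on the other side of an interior edge.\<close>

definition elem1 ::
    "(real^2) set set \<Rightarrow> ((real^2) set \<Rightarrow> real^2) \<Rightarrow> (real^2) set \<Rightarrow> (real^2) set" where
  "elem1 \<K> n E = (THE K. K \<in> \<K> \<and> E edge_of K \<and> points_out (n E) E K)"

definition elem2 ::
    "(real^2) set set \<Rightarrow> ((real^2) set \<Rightarrow> real^2) \<Rightarrow> (real^2) set \<Rightarrow> (real^2) set" where
  "elem2 \<K> n E = (THE K. K \<in> \<K> \<and> E edge_of K \<and> points_out (- n E) E K)"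

text \<open>Arc-length integral over a segment; it does not depend on which of the two orderings of the
  end points is chosen.\<close>

definition edge_integral ::
    "(real^2) set \<Rightarrow> (real^2 \<Rightarrow> 'a::{banach, second_countable_topology}) \<Rightarrow> 'a" where
  "edge_integral E f = (let (a, b) = (SOME (a, b). E = closed_segment a b)
     in dist a b *\<^sub>R (LINT s:{0..1}|lborel. f (linepath a b s)))"

section \<open>Discontinuous finite elements\<close>

definition Poly :: "nat \<Rightarrow> (real^2 \<Rightarrow> complex) set" where
  "Poly k = {p. \<exists>c :: nat \<Rightarrow> nat \<Rightarrow> complex. \<forall>x.
     p x = (\<Sum>(i, j)\<in>{(i, j). i + j \<le> k}. c i j * of_real (x $ 1 ^ i * x $ 2 ^ j))}"

text \<open>Elements of \<open>V\<^sub>h\<^sup>k\<close> are represented by functions that are polynomial on the interior of every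
  element. Their values on the edges (a null set) and outside the domain are irrelevant: values on
  an edge only enter through the one-sided traces below.\<close>

definition DG_space :: "nat \<Rightarrow> (real^2) set \<Rightarrow> (real^2) set set \<Rightarrow> (real^2 \<Rightarrow> complex) set" where
  "DG_space k \<Omega> \<K> = {v. sq_integrable \<Omega> v \<and>
     (\<forall>K\<in>\<K>. \<exists>p\<in>Poly k. \<forall>x\<in>interior K. v x = p x)}"

text \<open>The value at \<open>x \<in> \<partial>K\<close> of the restriction of \<open>f\<close> to \<open>K\<close>.\<close>

definition trace_from :: "(real^2) set \<Rightarrow> (real^2 \<Rightarrow> complex) \<Rightarrow> real^2 \<Rightarrow> complex" where
  "trace_from K f x = Lim (at x within interior K) f"

definition average :: "(real^2) set \<Rightarrow> (real^2) set set \<Rightarrow> ((real^2) set \<Rightarrow> real^2) \<Rightarrow>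
    (real^2) set \<Rightarrow> (real^2 \<Rightarrow> complex) \<Rightarrow> real^2 \<Rightarrow> complex" where
  "average \<Omega> \<K> n E f x =
     (if boundary_edge \<Omega> E then trace_from (elem1 \<K> n E) f x
      else (trace_from (elem1 \<K> n E) f x + trace_from (elem2 \<K> n E) f x) / 2)"

definition jump :: "(real^2) set \<Rightarrow> (real^2) set set \<Rightarrow> ((real^2) set \<Rightarrow> real^2) \<Rightarrow>
    (real^2) set \<Rightarrow> (real^2 \<Rightarrow> complex) \<Rightarrow> real^2 \<Rightarrow> complex" where
  "jump \<Omega> \<K> n E f x =
     (if boundary_edge \<Omega> E then trace_from (elem1 \<K> n E) f x
      else trace_from (elem1 \<K> n E) f x - trace_from (elem2 \<K> n E) f x)"

text \<open>\<open>{\<nabla>\<^sub>h v} \<bullet> n\<^sub>E\<close>. The classical partial derivatives of \<open>v\<close> on the element interiors form the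
  piecewise gradient.\<close>

definition flux :: "(real^2) set \<Rightarrow> (real^2) set set \<Rightarrow> ((real^2) set \<Rightarrow> real^2) \<Rightarrow>
    (real^2) set \<Rightarrow> (real^2 \<Rightarrow> complex) \<Rightarrow> real^2 \<Rightarrow> complex" where
  "flux \<Omega> \<K> n E v x = (\<Sum>i\<in>UNIV. average \<Omega> \<K> n E (partial i v) x * of_real (n E $ i))"

definition DG_norm :: "(real^2) set \<Rightarrow> (real^2) set set \<Rightarrow> ((real^2) set \<Rightarrow> real^2) \<Rightarrow>
    (real^2 \<Rightarrow> complex) \<Rightarrow> real" where
  "DG_norm \<Omega> \<K> n v = sqrt (
     (\<Sum>K\<in>\<K>. LINT x:K|lebesgue. (\<Sum>i\<in>UNIV. (cmod (partial i v x))\<^sup>2))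
     + (\<Sum>E\<in>edges \<K>. 1 / diameter E * edge_integral E (\<lambda>x. (cmod (jump \<Omega> \<K> n E v x))\<^sup>2)))"

definition a_h :: "(real^2) set \<Rightarrow> (real^2) set set \<Rightarrow> ((real^2) set \<Rightarrow> real^2) \<Rightarrow> real \<Rightarrow>
    (real^2 \<Rightarrow> complex) \<Rightarrow> (real^2 \<Rightarrow> complex) \<Rightarrow> complex" where
  "a_h \<Omega> \<K> n lam v w =
     (LINT x:\<Omega>|lebesgue. (\<Sum>i\<in>UNIV. partial i v x * cnj (partial i w x)))
     - (\<Sum>E\<in>edges \<K>. edge_integral E (\<lambda>x. flux \<Omega> \<K> n E v x * cnj (jump \<Omega> \<K> n E w x)))
     - (\<Sum>E\<in>edges \<K>. edge_integral E (\<lambda>x. jump \<Omega> \<K> n E v x * cnj (flux \<Omega> \<K> n E w x)))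
     + (\<Sum>E\<in>edges \<K>. of_real (lam / diameter E) *
          edge_integral E (\<lambda>x. jump \<Omega> \<K> n E v x * cnj (jump \<Omega> \<K> n E w x)))"

text \<open>The hypothesis on the penalty parameter \<open>lam\<close>, uniform over the family of meshes. The reality
  of \<open>a_h v v\<close>, which is implicit in comparing it with real numbers, is automatic since the form is
  Hermitian.\<close>

definition penalty_sufficient :: "nat \<Rightarrow> (real^2) set \<Rightarrow> (nat \<Rightarrow> (real^2) set set) \<Rightarrow>
    (nat \<Rightarrow> (real^2) set \<Rightarrow> real^2) \<Rightarrow> real \<Rightarrow> bool" where
  "penalty_sufficient k \<Omega> \<K> n lam \<longleftrightarrow> (\<exists>C1>0. \<exists>C2>0. \<forall>j. \<forall>v\<in>DG_space k \<Omega> (\<K> j).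
     C1 * (DG_norm \<Omega> (\<K> j) (n j) v)\<^sup>2 \<le> Re (a_h \<Omega> (\<K> j) (n j) lam v v) \<and>
     Re (a_h \<Omega> (\<K> j) (n j) lam v v) \<le> C2 * (DG_norm \<Omega> (\<K> j) (n j) v)\<^sup>2)"

text \<open>\<open>r = R\<^sub>h w\<close>; a relation rather than a function because \<open>r\<close> is only determined up to its
  irrelevant values on the edges and outside the domain.\<close>

definition is_ritz_projection :: "nat \<Rightarrow> (real^2) set \<Rightarrow> (real^2) set set \<Rightarrow>
    ((real^2) set \<Rightarrow> real^2) \<Rightarrow> real \<Rightarrow> (real^2 \<Rightarrow> complex) \<Rightarrow> (real^2 \<Rightarrow> complex) \<Rightarrow> bool" where
  "is_ritz_projection k \<Omega> \<K> n lam w r \<longleftrightarrow> r \<in> DG_space k \<Omega> \<K> \<and>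
     (\<forall>v\<in>DG_space k \<Omega> \<K>. a_h \<Omega> \<K> n lam r v = - l2_inner \<Omega> (laplacian \<Omega> w) v)"

section \<open>The Crank-Nicolson scheme\<close>

definition D_tau :: "real \<Rightarrow> (nat \<Rightarrow> real^2 \<Rightarrow> complex) \<Rightarrow> nat \<Rightarrow> real^2 \<Rightarrow> complex" where
  "D_tau \<tau> \<phi> m x = (\<phi> m x - \<phi> (m - 1) x) / of_real \<tau>"

definition midpoint_avg :: "(nat \<Rightarrow> real^2 \<Rightarrow> complex) \<Rightarrow> nat \<Rightarrow> real^2 \<Rightarrow> complex" where
  "midpoint_avg \<phi> m x = (\<phi> m x + \<phi> (m - 1) x) / 2"

definition CN_DG_solution :: "nat \<Rightarrow> (real^2) set \<Rightarrow> (real^2) set set \<Rightarrow> ((real^2) set \<Rightarrow> real^2) \<Rightarrow>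
    real \<Rightarrow> real \<Rightarrow> real \<Rightarrow> real \<Rightarrow> real \<Rightarrow> real \<Rightarrow> (real^2 \<Rightarrow> complex) \<Rightarrow>
    real \<Rightarrow> nat \<Rightarrow> (nat \<Rightarrow> real^2 \<Rightarrow> complex) \<Rightarrow> bool" where
  "CN_DG_solution k \<Omega> \<K> n lam \<nu> \<alpha> \<kappa> \<beta> \<gamma> u0 \<tau> N U \<longleftrightarrow>
     is_ritz_projection k \<Omega> \<K> n lam u0 (U 0) \<and>
     (\<forall>m\<in>{1..N}. U m \<in> DG_space k \<Omega> \<K> \<and>
       (\<forall>v\<in>DG_space k \<Omega> \<K>.
          l2_inner \<Omega> (D_tau \<tau> U m) v
          + Complex \<nu> \<alpha> * a_h \<Omega> \<K> n lam (midpoint_avg U m) v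
          + Complex \<kappa> \<beta> *
              l2_inner \<Omega> (\<lambda>x. of_real ((cmod (midpoint_avg U m x))\<^sup>2) * midpoint_avg U m x) v
          - of_real \<gamma> * l2_inner \<Omega> (midpoint_avg U m) v = 0))"

end

theory Submission
  imports Defs "HOL-Analysis.Analysis"
begin

text \<open>Let \<open>h\<close> be the midpoint value of a step of size \<open>\<tau>\<close> starting at \<open>u\<close>. Testing the scheme with \<open>h\<close> bounds
  the \<open>L\<^sup>2\<close> norms and \<open>\<Sum> \<tau> \<parallel>h\<parallel>\<^sup>4\<close> in \<open>L\<^sup>4\<close>, because \<open>\<kappa> > 0\<close>. Testing with \<open>h - u\<close> after multiplication by
  \<open>\<nu> - i\<alpha>\<close> bounds the growth of the energy \<open>a\<^sub>h(u, u)\<close> by \<open>C \<tau> (\<parallel>h\<parallel>\<^sup>6 + 1)\<close> in \<open>L\<^sup>6\<close>, hence by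
  \<open>C \<tau> (\<parallel>h\<parallel>\<^sup>4 a\<^sub>h(h, h) + 1)\<close> by a discrete Gagliardo-Nirenberg inequality. Testing with \<open>h - u\<close> in the original
  equation gives \<open>a\<^sub>h(h, h) \<le> C (1 + a\<^sub>h(u, u))\<close>, so that a Gronwall argument works for all step sizes.

  The Gagliardo-Nirenberg inequalities result from the embedding of \<open>BV\<close> into \<open>L\<^sup>2\<close> in the plane, applied to
  powers of \<open>v\<close>: the value at a point is bounded by the variations, jumps included, along the two axis-parallel
  lines through it. The jump terms are controlled by an inverse trace inequality on the elements.\<close>

section \<open>Polynomials in two variables\<close>

text \<open>The obstacle is that the midpoint \<open>h\<close> contains the unknown new value. The
  energy increment is bounded in terms of \<open>a\<^sub>h(h, h)\<close>, and absorbing the new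
  energy from it would require \<tau> times the quartic norm of \<open>h\<close> to be small. The
  test of the original equation with \<open>h - u\<close> avoids this: its time term
  \<open>(2 / \<tau>) |h - u|\<^sup>2\<close> has a good sign and is dropped, so
  \<open>a\<^sub>h(h, h)\<close> is bounded by the old energy with a constant free of \<tau>. Each
  step then multiplies \<open>1 + a\<^sub>h(u, u)\<close> by an exponential, and the exponents have
  a bounded sum by the first test. The factor \<nu> - i\<alpha> is the conjugate of the diffusion
  coefficient: their product is real and positive, and \<open>4 Re a\<^sub>h(h, h - u)\<close> is
  exactly the energy increment. Without this rotation \<alpha> would bring in the imaginary part of
  \<open>a\<^sub>h(h, h - u)\<close>, which does not telescope. The initial energy is that of the
  Ritz projection, bounded by testing its defining equation with itself.\<close>

lemma finite_degree_set: "finite {(i, j). i + j \<le> (k::nat)}"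
  by (rule finite_subset[of _ "{..k} \<times> {..k}"]) auto

definition monomial :: "nat \<times> nat \<Rightarrow> real^2 \<Rightarrow> complex" where
  "monomial e x = of_real (x $ 1 ^ fst e * x $ 2 ^ snd e)"

lemma Poly_iff: "p \<in> Poly k \<longleftrightarrow> (\<exists>c. p = (\<lambda>x. \<Sum>e\<in>{(i, j). i + j \<le> k}. c e * monomial e x))"
proof
  assume "p \<in> Poly k"
  then obtain c where "p = (\<lambda>x. \<Sum>(i, j)\<in>{(i, j). i + j \<le> k}. c i j * of_real (x $ 1 ^ i * x $ 2 ^ j))"
    unfolding Poly_def by blast
  then show "\<exists>c. p = (\<lambda>x. \<Sum>e\<in>{(i, j). i + j \<le> k}. c e * monomial e x)"
    by (intro exI[of _ "\<lambda>e. c (fst e) (snd e)"]) (simp add: monomial_def case_prod_unfold)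
next
  assume "\<exists>c. p = (\<lambda>x. \<Sum>e\<in>{(i, j). i + j \<le> k}. c e * monomial e x)"
  then obtain c where "p = (\<lambda>x. \<Sum>e\<in>{(i, j). i + j \<le> k}. c e * monomial e x)" ..
  then show "p \<in> Poly k"
    unfolding Poly_def by (intro CollectI exI[of _ "\<lambda>i j. c (i, j)"]) (simp add: monomial_def case_prod_unfold)
qed

lemma Poly_monomial: "fst e + snd e \<le> k \<Longrightarrow> (\<lambda>x. c * monomial e x) \<in> Poly k"
  unfolding Poly_iff
proof (intro exI ext)
  fix x assume e: "fst e + snd e \<le> k"
  have "(\<Sum>d\<in>{(i, j). i + j \<le> k}. (if d = e then c else 0) * monomial d x) = (\<Sum>d\<in>{e}. c * monomial d x)"
    using e by (intro sum.mono_neutral_cong_right finite_degree_set) (auto split: if_splits)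
  then show "c * monomial e x = (\<Sum>d\<in>{(i, j). i + j \<le> k}. (if d = e then c else 0) * monomial d x)"
    by simp
qed

lemma Poly_const: "(\<lambda>x. c) \<in> Poly k"
  using Poly_monomial[of "(0, 0)" k c] by (simp add: monomial_def)

lemma Poly_add: "p \<in> Poly k \<Longrightarrow> q \<in> Poly k \<Longrightarrow> (\<lambda>x. p x + q x) \<in> Poly k"
  unfolding Poly_iff
proof (elim exE)
  fix c d
  assume "p = (\<lambda>x. \<Sum>e\<in>{(i, j). i + j \<le> k}. c e * monomial e x)" "q = (\<lambda>x. \<Sum>e\<in>{(i, j). i + j \<le> k}. d e * monomial e x)"
  then show "\<exists>c. (\<lambda>x. p x + q x) = (\<lambda>x. \<Sum>e\<in>{(i, j). i + j \<le> k}. c e * monomial e x)"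
    by (intro exI[of _ "\<lambda>e. c e + d e"]) (simp add: sum.distrib distrib_right)
qed

lemma Poly_sum: "(\<And>i. i \<in> A \<Longrightarrow> f i \<in> Poly k) \<Longrightarrow> (\<lambda>x. \<Sum>i\<in>A. f i x) \<in> Poly k"
  by (induction A rule: infinite_finite_induct) (auto intro: Poly_const Poly_add)

lemma Poly_mult:
  assumes "p \<in> Poly k" "q \<in> Poly m" shows "(\<lambda>x. p x * q x) \<in> Poly (k + m)"
proof -
  obtain c d where c: "p = (\<lambda>x. \<Sum>e\<in>{(i, j). i + j \<le> k}. c e * monomial e x)"
    and d: "q = (\<lambda>x. \<Sum>e\<in>{(i, j). i + j \<le> m}. d e * monomial e x)"
    using assms unfolding Poly_iff by blast
  have "(\<lambda>x. p x * q x) = (\<lambda>x. \<Sum>e\<in>{(i, j). i + j \<le> k}. \<Sum>e'\<in>{(i, j). i + j \<le> m}.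
      (c e * d e') * monomial (fst e + fst e', snd e + snd e') x)"
    by (auto simp: c d monomial_def sum_product power_add mult_ac intro!: sum.cong)
  also have "\<dots> \<in> Poly (k + m)"
    by (intro Poly_sum Poly_monomial) auto
  finally show ?thesis .
qed

lemma Poly_cmult: "p \<in> Poly k \<Longrightarrow> (\<lambda>x. c * p x) \<in> Poly k"
  using Poly_mult[OF Poly_const[of c 0], of p k] by simp

lemma Poly_power: "p \<in> Poly k \<Longrightarrow> (\<lambda>x. p x ^ m) \<in> Poly (m * k)"
  by (induction m) (auto intro: Poly_const Poly_mult)

lemma continuous_on_Poly: "p \<in> Poly k \<Longrightarrow> continuous_on S p"
  unfolding Poly_iff monomial_def by (elim exE) (simp only:, intro continuous_intros)

text \<open>The truncated exponents \<open>i - 1\<close> and \<open>j - 1\<close> are harmless: at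
  zero the factor \<open>of_nat i\<close> or \<open>of_nat j\<close> vanishes. Keeping each summand
  of the form constant times monomial lets \<open>Poly_has_derivative\<close> place partial
  derivatives back into \<open>Poly k\<close>.\<close>

lemma has_derivative_monomial:
  "((\<lambda>x. c * monomial (i, j) x) has_derivative (\<lambda>h. of_real (h $ 1) * (c * of_nat i * monomial (i - 1, j) x)
     + of_real (h $ 2) * (c * of_nat j * monomial (i, j - 1) x))) (at x)"
proof -
  have n: "((\<lambda>x. x $ l) has_derivative (\<lambda>h. h $ l)) (at x)" for l :: 2 and x :: "real^2"
    by (rule bounded_linear.has_derivative[OF bounded_linear_vec_nth has_derivative_ident])
  show ?thesis
    unfolding monomial_def by (auto intro!: derivative_eq_intros n simp: algebra_simps)
qed

lemma Poly_has_derivative: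
  assumes "p \<in> Poly k"
  shows "p differentiable (at x)" "partial i p \<in> Poly k"
proof -
  obtain c where c: "p = (\<lambda>x. \<Sum>e\<in>{(i, j). i + j \<le> k}. c e * monomial (fst e, snd e) x)"
    using assms unfolding Poly_iff by auto
  define D where "D x h = (\<Sum>e\<in>{(i, j). i + j \<le> k}. of_real (h $ 1) * (c e * of_nat (fst e) * monomial (fst e - 1, snd e) x)
     + of_real (h $ 2) * (c e * of_nat (snd e) * monomial (fst e, snd e - 1) x))" for x h :: "real^2"
  have D: "(p has_derivative D x) (at x)" for x
    unfolding c D_def by (intro has_derivative_sum has_derivative_monomial)
  then show "p differentiable (at x)"
    unfolding differentiable_def by blast
  have "partial i p x = D x (axis i 1)" for x
    using frechet_derivative_at[OF D] by (simp add: partial_def)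
  then have *: "partial i p = (\<lambda>x. D x (axis i 1))" ..
  show "partial i p \<in> Poly k"
    unfolding * D_def mult.assoc[symmetric] by (intro Poly_sum Poly_add Poly_monomial) auto
qed

lemma Poly_frechet: "p \<in> Poly k \<Longrightarrow> (p has_derivative frechet_derivative p (at x)) (at x)"
  using Poly_has_derivative(1) frechet_derivative_works by blast

lemma Poly_has_vector_derivative:
  assumes "p \<in> Poly k"
  shows "((\<lambda>s. p (x + s *\<^sub>R axis i 1)) has_vector_derivative partial i p (x + s *\<^sub>R axis i 1)) (at s within S)"
proof -
  have "(p has_derivative frechet_derivative p (at (x + s *\<^sub>R axis i 1))) (at (x + s *\<^sub>R axis i 1))"
    by (rule Poly_frechet[OF assms])
  then have "((\<lambda>s. p (x + s *\<^sub>R axis i 1)) has_derivative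
      (\<lambda>h. frechet_derivative p (at (x + s *\<^sub>R axis i 1)) (h *\<^sub>R axis i 1))) (at s within S)"
    by (rule has_derivative_compose[of "\<lambda>s. x + s *\<^sub>R axis i 1" "\<lambda>h. h *\<^sub>R axis i 1" s S p, rotated])
       (auto intro!: derivative_eq_intros)
  then show ?thesis
    unfolding has_vector_derivative_def partial_def
    by (simp add: linear_scale[OF linear_frechet_derivative[OF Poly_has_derivative(1)[OF assms]]])
qed

lemma Poly_power_partial:
  assumes "p \<in> Poly k"
  shows "partial i (\<lambda>x. p x ^ m) x = of_nat m * p x ^ (m - 1) * partial i p x"
proof -
  have "((\<lambda>x. p x ^ m) has_derivative (\<lambda>h. of_nat m * (frechet_derivative p (at x) h * p x ^ (m - 1)))) (at x)"
    using has_derivative_power[OF Poly_frechet[OF assms]] by (simp add: mult_ac)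
  from frechet_derivative_at[OF this] show ?thesis
    unfolding partial_def by (metis mult.commute mult.left_commute)
qed

text \<open>\<open>Poly\<close> bounds the total degree, so the degree does not grow on lines in
  arbitrary directions. This reduces the inverse estimate to polynomials in one variable.\<close>

lemma Poly_along_line:
  assumes "p \<in> Poly k"
  shows "\<exists>P. degree P \<le> k \<and> (\<forall>t. p (x + t *\<^sub>R d) = poly P (of_real t))"
proof -
  obtain c where c: "p = (\<lambda>x. \<Sum>e\<in>{(i, j). i + j \<le> k}. c e * monomial e x)"
    using assms unfolding Poly_iff by blast
  define P where "P = (\<Sum>e\<in>{(i, j). i + j \<le> k}. smult (c e)
     ([:of_real (x $ 1), of_real (d $ 1):] ^ fst e * [:of_real (x $ 2), of_real (d $ 2):] ^ snd e))"
  have "degree P \<le> k"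
    unfolding P_def
  proof (intro degree_sum_le finite_degree_set order_trans[OF degree_smult_le])
    fix e assume e: "e \<in> {(i, j). i + j \<le> k}"
    have l: "degree [:u, v:] \<le> 1" for u v :: complex by simp
    have "degree ([:of_real (x $ 1), of_real (d $ 1):] ^ fst e * [:of_real (x $ 2), of_real (d $ 2):] ^ snd e :: complex poly)
       \<le> 1 * fst e + 1 * snd e"
      by (intro order_trans[OF degree_mult_le] add_mono order_trans[OF degree_power_le] mult_right_mono l) simp_all
    also have "\<dots> \<le> k" using e by auto
    finally show "degree ([:of_real (x $ 1), of_real (d $ 1):] ^ fst e * [:of_real (x $ 2), of_real (d $ 2):] ^ snd e :: complex poly) \<le> k" .
  qed
  moreover have "p (x + t *\<^sub>R d) = poly P (of_real t)" for t
    by (simp add: c monomial_def P_def poly_sum mult_ac)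
  ultimately show ?thesis by blast
qed

text \<open>Lagrange extrapolation to 0. The point is the order of quantifiers: the weights depend
  on the nodes only, so they can be fixed before the polynomial, the element and the scale are
  known.\<close>

lemma poly_extrapolation:
  fixes t :: "nat \<Rightarrow> complex"
  assumes "inj_on t {..m}"
  shows "\<exists>l. \<forall>P. degree P \<le> m \<longrightarrow> poly P 0 = (\<Sum>i\<le>m. l i * poly P (t i))"
  using assms
proof (induction m)
  case 0
  show ?case
    by (intro exI[of _ "\<lambda>_. 1"]) (auto elim!: degree_eq_zeroE)
next
  case (Suc m)
  then obtain l where l: "\<And>P. degree P \<le> m \<Longrightarrow> poly P 0 = (\<Sum>i\<le>m. l i * poly P (t i))"
    by (auto simp: inj_on_def)
  define s where "s = t (Suc m)"
  \<comment> \<open>Obtained from P(0) = P(s) - s R(0), where R(x) = (P(x) - P(s)) / (x - s) has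
    degree at most \<open>m\<close>: insert the old weights for R and collect the coefficients of
    P(s) and of the values of P at the old nodes.\<close>
  define l' where "l' i = (if i = Suc m then 1 + s * (\<Sum>i\<le>m. l i / (t i - s)) else - s * l i / (t i - s))" for i
  show ?case
  proof (intro exI[of _ l'] allI impI)
    fix P :: "complex poly" assume P: "degree P \<le> Suc m"
    define R where "R = synthetic_div P s"
    have R: "poly P x = poly P s + (x - s) * poly R x" for x
      using arg_cong[OF synthetic_div_correct'[of s P], of "\<lambda>p. poly p x"] unfolding R_def
      by (simp add: algebra_simps)
    have "degree R \<le> m"
      using P by (simp add: R_def degree_synthetic_div)
    then have R0: "poly R 0 = (\<Sum>i\<le>m. l i * poly R (t i))" by (rule l)
    have ne: "t i \<noteq> s" if "i \<le> m" for i
      using that inj_onD[OF Suc.prems, of i "Suc m"] by (auto simp: s_def)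
    have "(\<Sum>i\<le>m. l i * poly R (t i)) = (\<Sum>i\<le>m. l i * ((poly P (t i) - poly P s) / (t i - s)))"
      by (intro sum.cong) (auto simp: R[of "t _"] ne)
    then have "poly P 0 = poly P s - s * (\<Sum>i\<le>m. l i * ((poly P (t i) - poly P s) / (t i - s)))"
      using R[of 0] R0 by simp
    also have "\<dots> = (\<Sum>i\<le>Suc m. l' i * poly P (t i))"
      by (simp add: l'_def s_def[symmetric] sum_distrib_left sum_distrib_right sum_subtractf sum_negf
          algebra_simps diff_divide_distrib sum.distrib sum_divide_distrib)
    finally show "poly P 0 = (\<Sum>i\<le>Suc m. l' i * poly P (t i))" .
  qed
qed

section \<open>Slices and an inverse estimate\<close>

text \<open>Carrying the direction \<open>i\<close> as an argument lets a single proof serve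
  horizontal and vertical lines.\<close>

definition slice :: "2 \<Rightarrow> real \<Rightarrow> real \<Rightarrow> real^2" where
  "slice i y s = (\<chi> l. if l = i then s else y)"

lemma slice_nth: "slice i y s $ l = (if l = i then s else y)"
  by (simp add: slice_def)

lemma slice_eq: "slice i y s = slice i y 0 + s *\<^sub>R axis i 1"
  by (simp add: vec_eq_iff slice_nth axis_def)

lemma continuous_on_slice: "continuous_on S (\<lambda>z. slice i (fst z) (snd z))"
  unfolding slice_def
proof (rule continuous_on_vec_lambda)
  show "continuous_on S (\<lambda>z. if l = i then snd z else fst z)" for l
    by (cases "l = i") (auto intro: continuous_intros)
qed

lemma continuous_on_slice': "continuous_on S (slice i y)"
  using continuous_on_compose2[OF continuous_on_slice[of UNIV i], of S "\<lambda>s. (y, s)"]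
  by (simp add: continuous_on_Pair)

lemma Basis_real2: "(Basis :: (real^2) set) = {axis 1 1, axis 2 1}"
  by (auto simp: Basis_vec_def UNIV_2)

lemma two_other: "\<exists>o'::2. o' \<noteq> i \<and> (\<forall>l. l = i \<or> l = o')"
  using exhaust_2 by (metis zero_neq_one)

lemma prod_two: "o' \<noteq> i \<Longrightarrow> (\<Prod>b\<in>Basis. v \<bullet> b) = v $ i * v $ o'" for v :: "real^2" and i o' :: 2
proof -
  assume "o' \<noteq> i"
  have "axis 1 1 \<noteq> (axis 2 1 :: real^2)" by (simp add: axis_eq_axis)
  then have "(\<Prod>b\<in>Basis. v \<bullet> b) = v $ 1 * v $ 2"
    by (simp add: Basis_real2 inner_axis)
  moreover have "i = 1 \<and> o' = 2 \<or> i = 2 \<and> o' = 1"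
    using \<open>o' \<noteq> i\<close> exhaust_2[of i] exhaust_2[of o'] by auto
  ultimately show ?thesis by auto
qed

text \<open>Lebesgue measure is determined by its values on boxes, and the preimage of a box is a
  product of two intervals. This gives Tonelli's theorem with either coordinate as the inner
  variable.\<close>

lemma lborel_slice: "lborel = distr (lborel \<Otimes>\<^sub>M lborel) borel (\<lambda>z. slice i (fst z) (snd z))"
proof (rule lborel_eqI)
  obtain o' where o': "o' \<noteq> i" "\<And>l. l = i \<or> l = o'" using two_other by metis
  have m: "(\<lambda>z. slice i (fst z) (snd z)) \<in> lborel \<Otimes>\<^sub>M lborel \<rightarrow>\<^sub>M borel"
    using borel_measurable_continuous_onI[OF continuous_on_slice[of UNIV i]]
    by (simp add: lborel_prod)
  fix l u :: "real^2" assume lu: "\<And>b. b \<in> Basis \<Longrightarrow> l \<bullet> b \<le> u \<bullet> b"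
  have le: "l $ k \<le> u $ k" for k using lu[of "axis k 1"] by (simp add: inner_axis)
  have "(\<lambda>z. slice i (fst z) (snd z)) -` box l u \<inter> space (lborel \<Otimes>\<^sub>M lborel) = {l $ o'<..<u $ o'} \<times> {l $ i<..<u $ i}"
    using o' by (auto simp: mem_box_cart slice_nth space_pair_measure split: if_splits) metis+
  then have "emeasure (distr (lborel \<Otimes>\<^sub>M lborel) borel (\<lambda>z. slice i (fst z) (snd z))) (box l u)
     = emeasure lborel {l $ o'<..<u $ o'} * emeasure lborel {l $ i<..<u $ i}"
    by (simp add: emeasure_distr[OF m] lborel.emeasure_pair_measure_Times)
  also have "\<dots> = ennreal (\<Prod>b\<in>Basis. (u - l) \<bullet> b)"
    by (simp add: prod_two[OF o'(1)] le ennreal_mult[symmetric] mult.commute)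
  finally show "emeasure (distr (lborel \<Otimes>\<^sub>M lborel) borel (\<lambda>z. slice i (fst z) (snd z))) (box l u)
    = ennreal (\<Prod>b\<in>Basis. (u - l) \<bullet> b)" .
qed simp

lemma nn_integral_slice:
  assumes "f \<in> borel_measurable borel"
  shows "(\<integral>\<^sup>+x. f x \<partial>lborel) = (\<integral>\<^sup>+y. \<integral>\<^sup>+s. f (slice i y s) \<partial>lborel \<partial>lborel)"
    "(\<lambda>y. \<integral>\<^sup>+s. f (slice i y s) \<partial>lborel) \<in> borel_measurable borel"
proof -
  have m: "(\<lambda>z. slice i (fst z) (snd z)) \<in> lborel \<Otimes>\<^sub>M lborel \<rightarrow>\<^sub>M borel"
    using borel_measurable_continuous_onI[OF continuous_on_slice[of UNIV i]]
    by (simp add: lborel_prod)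
  have fm: "(\<lambda>z. f (slice i (fst z) (snd z))) \<in> borel_measurable (lborel \<Otimes>\<^sub>M lborel)"
    using measurable_compose[OF m assms] .
  have "(\<integral>\<^sup>+x. f x \<partial>lborel) = (\<integral>\<^sup>+z. f (slice i (fst z) (snd z)) \<partial>(lborel \<Otimes>\<^sub>M lborel))"
    by (subst lborel_slice[of i]) (simp add: nn_integral_distr[OF m] assms)
  also have "\<dots> = (\<integral>\<^sup>+y. \<integral>\<^sup>+s. f (slice i y s) \<partial>lborel \<partial>lborel)"
    using lborel.nn_integral_fst[OF fm] by simp
  finally show "(\<integral>\<^sup>+x. f x \<partial>lborel) = (\<integral>\<^sup>+y. \<integral>\<^sup>+s. f (slice i y s) \<partial>lborel \<partial>lborel)" .
  show "(\<lambda>y. \<integral>\<^sup>+s. f (slice i y s) \<partial>lborel) \<in> borel_measurable borel"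
    using lborel.borel_measurable_nn_integral_fst[OF fm] by simp
qed

lemma integral_affine_real2:
  fixes f :: "real^2 \<Rightarrow> real"
  assumes [measurable]: "f \<in> borel_measurable borel" and "t \<noteq> 0"
  shows "(LINT x|lborel. f x) = t\<^sup>2 * (LINT y|lborel. f (a + t *\<^sub>R y))"
proof -
  have "(LINT x|lborel. f x) = (LINT x|density (distr lborel borel (\<lambda>x. a + t *\<^sub>R x)) (\<lambda>_. ennreal (\<bar>t\<bar> ^ DIM(real^2))). f x)"
    using lborel_affine[OF \<open>t \<noteq> 0\<close>, of a] by simp
  also have "\<dots> = (LINT x|distr lborel borel (\<lambda>x. a + t *\<^sub>R x). t\<^sup>2 * f x)"
    by (subst integral_density) auto
  also have "\<dots> = (LINT y|lborel. t\<^sup>2 * f (a + t *\<^sub>R y))"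
    by (subst integral_distr) auto
  finally show ?thesis by simp
qed

text \<open>The norms and forms are stated with \<open>lebesgue\<close>, whereas slicing, affine
  substitution and edge integrals work with \<open>lborel\<close>. For continuous integrands on
  compact sets the two agree, so the change of measure is made once here.\<close>

lemma compact_integrable:
  fixes f :: "'a::euclidean_space \<Rightarrow> 'b::{banach, second_countable_topology}"
  assumes "compact S" "continuous_on S f"
  shows "set_integrable lborel S f" "set_integrable lebesgue S f"
    "(LINT x:S|lebesgue. f x) = (LINT x:S|lborel. f x)"
proof -
  show *: "set_integrable lborel S f"
    unfolding set_integrable_def by (rule borel_integrable_compact[OF assms])
  then show "set_integrable lebesgue S f"
    unfolding set_integrable_def by (rule integrable_completion[THEN iffD2, rotated]) (use * in \<open>auto simp: set_integrable_def\<close>)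
  show "(LINT x:S|lebesgue. f x) = (LINT x:S|lborel. f x)"
    unfolding set_lebesgue_integral_def
    by (rule integral_completion) (use * in \<open>auto simp: set_integrable_def\<close>)
qed

text \<open>Affine substitution with Jacobian \<open>t\<^sup>2\<close> in the plane; since
  \<open>f\<close> is nonnegative, the image of \<open>B\<close> may be enlarged to
  \<open>S\<close>.\<close>

lemma set_integral_affine_le:
  fixes f :: "real^2 \<Rightarrow> real"
  assumes "compact B" "compact S" "continuous_on UNIV f" "\<And>x. f x \<ge> 0" "t > 0"
    and sub: "\<And>y. y \<in> B \<Longrightarrow> a + t *\<^sub>R y \<in> S"
  shows "(LINT y:B|lborel. f (a + t *\<^sub>R y)) \<le> (LINT x:S|lborel. f x) / t\<^sup>2"
proof -
  let ?g = "\<lambda>x. indicator S x *\<^sub>R f x"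
  have gi: "integrable lborel ?g"
    by (rule borel_integrable_compact[OF assms(2) continuous_on_subset[OF assms(3)]]) simp
  then have gm: "?g \<in> borel_measurable borel" by auto
  define S' where "S' = (\<lambda>x. (1 / t) *\<^sub>R (x - a)) ` S"
  have S'_iff: "a + t *\<^sub>R y \<in> S \<longleftrightarrow> y \<in> S'" for y
  proof
    assume "a + t *\<^sub>R y \<in> S"
    then show "y \<in> S'" unfolding S'_def using \<open>t > 0\<close> by (intro image_eqI[of _ _ "a + t *\<^sub>R y"]) auto
  qed (use \<open>t > 0\<close> in \<open>auto simp: S'_def\<close>)
  have S': "indicator S (a + t *\<^sub>R y) = (indicator S' y :: real)" for y
    by (simp add: indicator_def S'_iff)
  have comp: "continuous_on A (\<lambda>y. f (a + t *\<^sub>R y))" for A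
    by (rule continuous_on_compose2[OF assms(3)]) (auto intro!: continuous_intros)
  have "compact S'" unfolding S'_def
    by (intro compact_continuous_image assms continuous_intros)
  then have "compact S'" and i': "integrable lborel (\<lambda>y. indicator S' y *\<^sub>R f (a + t *\<^sub>R y))"
    by (auto intro!: borel_integrable_compact comp simp del: indicator_scaleR_eq_if real_scaleR_def)
  then have "(LINT y|lborel. indicator B y *\<^sub>R f (a + t *\<^sub>R y)) \<le> (LINT y|lborel. ?g (a + t *\<^sub>R y))"
    unfolding S'
    by (intro integral_mono borel_integrable_compact assms comp)
       (use sub S'_iff assms(4) \<open>compact S'\<close> in \<open>auto simp: indicator_def split: if_splits\<close>)
  also have "\<dots> = (LINT x|lborel. ?g x) / t\<^sup>2"
    using integral_affine_real2[OF gm, of t a] \<open>t > 0\<close> by simp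
  finally show ?thesis unfolding set_lebesgue_integral_def .
qed

lemma set_integral_sum:
  fixes f :: "'a \<Rightarrow> 'b \<Rightarrow> 'c::{banach, second_countable_topology}"
  assumes "\<And>i. i \<in> I \<Longrightarrow> set_integrable M A (f i)"
  shows "(LINT x:A|M. (\<Sum>i\<in>I. f i x)) = (\<Sum>i\<in>I. LINT x:A|M. f i x)"
  using assms unfolding set_lebesgue_integral_def set_integrable_def scaleR_sum_right
  by (auto intro: Bochner_Integration.integral_sum)

text \<open>\<open>q x\<close> is extrapolated from \<open>m + 1\<close> points of the segment from \<open>x\<close> to \<open>\<theta>\<close> that are close to \<open>\<theta>\<close>,
  with weights independent of \<open>x\<close> and \<open>\<theta>\<close>, and the result is averaged over \<open>\<theta>\<close> in a smaller disc.\<close>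
lemma Poly_inverse_estimate:
  assumes "\<sigma> > 0"
  shows "\<exists>C>0. \<forall>q\<in>Poly m. \<forall>z h. \<forall>x\<in>cball z h. 0 < h \<longrightarrow>
    h\<^sup>2 * (cmod (q x))\<^sup>2 \<le> C * (LINT y:cball z (\<sigma> * h)|lebesgue. (cmod (q y))\<^sup>2)"
proof -
  \<comment> \<open>Chosen so that \<open>\<delta> * i * (2 + \<sigma>) \<le> \<sigma>\<close> for
    all \<open>i \<le> m\<close>. Then every node \<open>t i\<close> is positive, and
    \<open>\<delta> * i \<le> \<sigma> / 2\<close> keeps the sampling points within
    \<open>\<sigma> * h\<close> of \<open>z\<close> when \<open>\<theta>\<close> is within
    \<open>\<sigma> * h / 2\<close>.\<close>
  define \<delta> where "\<delta> = \<sigma> / ((real m + 1) * (2 + \<sigma>))"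
  define t where "t i = 1 - \<delta> * real i" for i
  have \<delta>: "\<delta> > 0" using assms by (simp add: \<delta>_def)
  have \<delta>m: "\<delta> * real i * (2 + \<sigma>) \<le> \<sigma>" if "i \<le> m" for i
  proof -
    have "2 + \<sigma> \<noteq> 0" using assms by simp
    then have "\<delta> * real i * (2 + \<sigma>) = \<sigma> * (real i / (real m + 1))"
      unfolding \<delta>_def by simp
    also have "\<dots> \<le> \<sigma> * 1" using assms that by (intro mult_left_mono) auto
    finally show ?thesis by simp
  qed
  have tpos: "t i > 0" if "i \<le> m" for i
  proof -
    have "\<delta> * real i * (2 + \<sigma>) < 2 + \<sigma>" using \<delta>m[OF that] by linarith
    then show ?thesis using assms by (simp add: t_def)
  qed
  have "inj_on (\<lambda>i. complex_of_real (t i)) {..m}"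
    using \<delta> by (auto simp: inj_on_def t_def)
  from poly_extrapolation[OF this]
  obtain l where l: "\<And>P. degree P \<le> m \<Longrightarrow> poly P 0 = (\<Sum>i\<le>m. l i * poly P (complex_of_real (t i)))"
    by blast
  \<comment> \<open>\<open>m + 1\<close> comes from Cauchy-Schwarz for the extrapolation sum,
    \<open>1 / (t i)\<^sup>2\<close> from the substitution in the integral over \<theta>; with the
    next constant, \<open>w * h\<^sup>2\<close> is the area of the disc over which \<theta> is
    averaged.\<close>
  define A where "A = (\<Sum>i\<le>m. (real m + 1) * (cmod (l i))\<^sup>2 / (t i)\<^sup>2)"
  define w where "w = unit_ball_vol 2 * (\<sigma> / 2)\<^sup>2"
  have w: "w > 0" using assms by (simp add: w_def)
  show ?thesis
  proof (intro exI[of _ "A / w + 1"] conjI ballI allI impI)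
    have "A \<ge> 0" unfolding A_def by (intro sum_nonneg) auto
    then show "A / w + 1 > 0" using w by (simp add: add_nonneg_pos)
    fix q and z x :: "real^2" and h :: real
    assume q: "q \<in> Poly m" and x: "x \<in> cball z h" and h: "h > 0"
    define I where "I = (LINT y:cball z (\<sigma> * h)|lborel. (cmod (q y))\<^sup>2)"
    have I0: "I \<ge> 0" unfolding I_def set_lebesgue_integral_def by (rule integral_nonneg_AE) auto
    define B where "B = cball z (\<sigma> / 2 * h)"
    have cq: "continuous_on S q" for S by (rule continuous_on_Poly[OF q])
    let ?Q = "\<lambda>i \<theta>. (cmod (q ((1 - t i) *\<^sub>R x + t i *\<^sub>R \<theta>)))\<^sup>2" and ?c = "\<lambda>i. (real m + 1) * (cmod (l i))\<^sup>2"
    have cqi: "continuous_on S (\<lambda>\<theta>. q ((1 - t i) *\<^sub>R x + t i *\<^sub>R \<theta>))" for S i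
      by (rule continuous_on_compose2[OF cq[of UNIV]]) (auto intro!: continuous_intros)
    have pt: "(cmod (q x))\<^sup>2 \<le> (\<Sum>i\<le>m. ?c i * ?Q i \<theta>)" for \<theta>
    proof -
      have xeq: "x + t i *\<^sub>R (\<theta> - x) = (1 - t i) *\<^sub>R x + t i *\<^sub>R \<theta>" for i
        by (simp add: algebra_simps)
      obtain P where P: "degree P \<le> m" "\<And>t. q (x + t *\<^sub>R (\<theta> - x)) = poly P (of_real t)"
        using Poly_along_line[OF q] by metis
      have "q x = (\<Sum>i\<le>m. l i * q (x + t i *\<^sub>R (\<theta> - x)))"
        using l[OF P(1)] P(2)[of 0] by (simp add: P(2))
      then have "cmod (q x) \<le> (\<Sum>i\<le>m. cmod (l i) * cmod (q (x + t i *\<^sub>R (\<theta> - x))))"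
        using norm_sum[of "\<lambda>i. l i * q (x + t i *\<^sub>R (\<theta> - x))" "{..m}"] by (simp add: norm_mult)
      then have "(cmod (q x))\<^sup>2 \<le> (\<Sum>i\<le>m. cmod (l i) * cmod (q (x + t i *\<^sub>R (\<theta> - x))))\<^sup>2"
        by (rule power_mono) simp
      also have "\<dots> \<le> (\<Sum>i\<le>m. (cmod (l i) * cmod (q (x + t i *\<^sub>R (\<theta> - x))))\<^sup>2) * card {..m}"
        by (rule sum_squared_le_sum_of_squares)
      also have "\<dots> = (\<Sum>i\<le>m. ?c i * ?Q i \<theta>)"
        unfolding sum_distrib_right xeq by (intro sum.cong refl) (simp add: power_mult_distrib mult_ac add_ac)
      finally show ?thesis .
    qed
    have sc: "(LINT \<theta>:B|lborel. ?Q i \<theta>) \<le> I / (t i)\<^sup>2" if i: "i \<le> m" for i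
    proof -
      have sub: "(1 - t i) *\<^sub>R x + t i *\<^sub>R \<theta> \<in> cball z (\<sigma> * h)" if "\<theta> \<in> B" for \<theta>
      proof -
        have a1: "norm (\<theta> - z) \<le> \<sigma> / 2 * h" "norm (x - z) \<le> h"
          using that x by (auto simp: B_def dist_norm norm_minus_commute)
        have "(1 - t i) *\<^sub>R x + t i *\<^sub>R \<theta> - z = t i *\<^sub>R (\<theta> - z) + (1 - t i) *\<^sub>R (x - z)"
          by (simp add: algebra_simps)
        then have "norm ((1 - t i) *\<^sub>R x + t i *\<^sub>R \<theta> - z) \<le> t i * norm (\<theta> - z) + (\<delta> * real i) * norm (x - z)"
          using norm_triangle_ineq[of "t i *\<^sub>R (\<theta> - z)" "(1 - t i) *\<^sub>R (x - z)"] tpos[OF i] \<delta> by (simp add: t_def)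
        also have "\<dots> \<le> 1 * (\<sigma> / 2 * h) + (\<delta> * real i) * h"
          using a1 \<delta> tpos[OF i] assms h by (intro add_mono mult_mono) (auto simp: t_def)
        also have "\<dots> \<le> 1 * (\<sigma> / 2 * h) + \<sigma> / 2 * h"
        proof -
          have "\<delta> * real i * 2 \<le> \<delta> * real i * (2 + \<sigma>)" using \<delta> assms by (intro mult_left_mono) auto
          then have "\<delta> * real i \<le> \<sigma> / 2" using \<delta>m[OF i] by linarith
          then show ?thesis using h by (intro add_left_mono mult_right_mono) auto
        qed
        finally show ?thesis by (simp add: dist_norm norm_minus_commute)
      qed
      have "(LINT \<theta>:B|lborel. ?Q i \<theta>) \<le> I / (t i)\<^sup>2"
        unfolding I_def
        by (rule set_integral_affine_le[where f = "\<lambda>y. (cmod (q y))\<^sup>2"])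
           (use tpos[OF i] sub in \<open>auto simp: B_def intro!: continuous_intros cq\<close>)
      then show ?thesis .
    qed
    have "(w * h\<^sup>2) * (cmod (q x))\<^sup>2 = (LINT \<theta>:B|lborel. (cmod (q x))\<^sup>2)"
    proof -
      have "measure lborel B = w * h\<^sup>2"
        using content_cball[of "\<sigma> / 2 * h" z] assms h unfolding B_def w_def
        by (simp add: power_mult_distrib power_divide)
      then show ?thesis
        by (subst set_integral_const) (use emeasure_lborel_cball_finite[of z "\<sigma> * h / 2"] in \<open>auto simp: B_def less_top\<close>)
    qed
    also have "\<dots> \<le> (LINT \<theta>:B|lborel. (\<Sum>i\<le>m. ?c i * ?Q i \<theta>))"
      unfolding B_def
      by (intro set_integral_mono compact_integrable(1) pt compact_cball continuous_intros cqi)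
    also have "\<dots> = (\<Sum>i\<le>m. ?c i * (LINT \<theta>:B|lborel. ?Q i \<theta>))"
      unfolding B_def
      by (subst set_integral_sum) (auto intro!: compact_integrable(1) continuous_intros cqi simp: mult.assoc)
    also have "\<dots> \<le> (\<Sum>i\<le>m. ?c i * (I / (t i)\<^sup>2))"
      by (intro sum_mono mult_left_mono sc) auto
    also have "\<dots> = A * I" by (simp add: A_def sum_distrib_right)
    finally have "h\<^sup>2 * (cmod (q x))\<^sup>2 \<le> A / w * I" using w by (simp add: field_simps)
    also have "\<dots> \<le> (A / w + 1) * I" using I0 by (simp add: algebra_simps)
    finally show "h\<^sup>2 * (cmod (q x))\<^sup>2 \<le> (A / w + 1) * (LINT y:cball z (\<sigma> * h)|lebesgue. (cmod (q y))\<^sup>2)"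
      unfolding I_def by (subst compact_integrable(3)) (auto intro!: continuous_intros cq)
  qed
qed

section \<open>Geometry of the mesh\<close>

text \<open>In the plane the vectors orthogonal to \<open>d\<close> form a line, which the unit
  vector \<open>m\<close> spans; so the cross product of \<open>a\<close> and \<open>m\<close>
  vanishes. It identifies supporting and separating normals with the prescribed edge normal up to a
  factor.\<close>

lemma normal_parallel:
  fixes m a d :: "real^2"
  assumes "norm m = 1" "d \<noteq> 0" "m \<bullet> d = 0" "a \<bullet> d = 0"
  shows "a = (a \<bullet> m) *\<^sub>R m"
proof -
  have m: "m $ 1 * m $ 1 + m $ 2 * m $ 2 = 1"
    using assms(1) by (simp add: norm_eq_1 inner_vec_def sum_2)
  have e: "m $ 1 * d $ 1 + m $ 2 * d $ 2 = 0" "a $ 1 * d $ 1 + a $ 2 * d $ 2 = 0"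
    using assms(3,4) by (simp_all add: inner_vec_def sum_2)
  have d: "d $ 1 \<noteq> 0 \<or> d $ 2 \<noteq> 0"
    using assms(2) by (auto simp: vec_eq_iff forall_2)
  have "(a $ 1 * m $ 2 - a $ 2 * m $ 1) * d $ 1 = 0" "(a $ 1 * m $ 2 - a $ 2 * m $ 1) * d $ 2 = 0"
    using e by algebra+
  then have p: "a $ 1 * m $ 2 = a $ 2 * m $ 1" using d by auto
  have "a $ 1 = (a $ 1 * m $ 1 + a $ 2 * m $ 2) * m $ 1" "a $ 2 = (a $ 1 * m $ 1 + a $ 2 * m $ 2) * m $ 2"
    using m p by algebra+
  then show ?thesis
    by (simp add: vec_eq_iff forall_2 inner_vec_def sum_2)
qed

lemma triangle_facts:
  fixes K :: "(real^2) set"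
  assumes "2 simplex K"
  shows "convex K" "compact K" "closed K" "polyhedron K" "polytope K" "aff_dim K = 2"
    "interior K \<noteq> {}" "closure (interior K) = K" "negligible (frontier K)" "rel_interior K = interior K"
proof -
  show c: "convex K" "compact K" "closed K" "polyhedron K" "polytope K"
    using assms by (auto intro: convex_simplex compact_simplex closed_simplex simplex_imp_polyhedron simplex_imp_polytope)
  show a: "aff_dim K = 2" using aff_dim_simplex[OF assms] .
  then have h: "affine hull K = UNIV" using aff_dim_eq_full[of K] by simp
  show r: "rel_interior K = interior K" by (rule rel_interior_interior[OF h])
  have "K \<noteq> {}" using a by auto
  then show i: "interior K \<noteq> {}" using r c rel_interior_eq_empty by blast
  show "closure (interior K) = K" using convex_closure_interior[OF c(1) i] c(3) by simp
  show "negligible (frontier K)" by (rule negligible_convex_frontier[OF c(1)])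
qed

lemma face_of_eq_same_dim:
  assumes "F face_of S" "convex S" "aff_dim F = aff_dim S"
  shows "F = S"
  using face_of_aff_dim_lt[OF assms(2,1)] assms(3) by auto

text \<open>Dimension count: a proper face has dimension below 2, and a face of dimension 0 through
  \<open>p\<close> would be the vertex \<open>p\<close>, which is excluded.\<close>

lemma triangle_proper_face_is_edge:
  fixes K :: "(real^2) set"
  assumes "2 simplex K" "F face_of K" "F \<noteq> K" "p \<in> F" "\<not> {p} face_of K"
  shows "F edge_of K"
proof -
  have "aff_dim F < 2" using face_of_aff_dim_lt assms triangle_facts by metis
  moreover have "aff_dim F \<noteq> 0"
  proof
    assume "aff_dim F = 0"
    then obtain q where "F = {q}" using aff_dim_eq_0 by blast
    then show False using assms by auto
  qed
  moreover have "F \<noteq> {}" using assms(4) by blast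
  then have "aff_dim F \<ge> 0" using aff_dim_negative_iff[of F] by linarith
  ultimately have "aff_dim F = 1" by linarith
  then show ?thesis using assms(2) by (simp add: edge_of_def)
qed

text \<open>The intersection of the two edges is again a face through the non-vertex
  \<open>p\<close>, hence an edge; a face of an edge of the same dimension is the whole
  edge.\<close>

lemma edge_unique:
  fixes K :: "(real^2) set"
  assumes "2 simplex K" "E edge_of K" "F edge_of K" "p \<in> E" "p \<in> F" "\<not> {p} face_of K"
  shows "E = F"
proof -
  have E: "E face_of K" "F face_of K" and d: "aff_dim E = 1" "aff_dim F = 1"
    using assms by (auto simp: edge_of_def)
  have EF: "E \<inter> F face_of K" using E by (rule face_of_Int)
  have "E \<inter> F \<noteq> K" using d triangle_facts(6)[OF assms(1)] aff_dim_subset[of "E \<inter> F" E] by auto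
  then have e: "E \<inter> F edge_of K"
    using triangle_proper_face_is_edge[OF assms(1) EF] assms by blast
  then have "aff_dim (E \<inter> F) = 1" by (simp add: edge_of_def)
  moreover have "E \<inter> F face_of E" "E \<inter> F face_of F"
    using EF E face_of_subset face_of_imp_subset by (metis inf_le1, metis inf_le2)
  ultimately have "E \<inter> F = E" "E \<inter> F = F"
    using face_of_eq_same_dim d E face_of_imp_convex by metis+
  then show ?thesis by simp
qed

lemma edge_segment:
  fixes K :: "(real^2) set"
  assumes "2 simplex K" "E edge_of K"
  shows "\<exists>a b. a \<noteq> b \<and> E = closed_segment a b \<and> {a} face_of K \<and> {b} face_of K"
proof -
  have E: "E face_of K" "aff_dim E = 1" using assms by (auto simp: edge_of_def)
  have "compact E" "convex E"
    using E triangle_facts[OF assms(1)] face_of_imp_compact face_of_imp_convex by blast+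
  moreover have "collinear E" using E by (simp add: collinear_aff_dim)
  moreover have "E \<noteq> {}" using E by auto
  ultimately obtain a b where ab: "E = closed_segment a b"
    using compact_convex_collinear_segment by metis
  have "a \<noteq> b" using E ab by auto
  moreover have "{a} face_of K" "{b} face_of K"
    using E(1) face_of_trans unfolding ab
    by (metis face_of_singleton extreme_point_of_segment)+
  ultimately show ?thesis using ab by blast
qed

text \<open>The hyperplane that exposes the edge has a normal orthogonal to the edge, hence a
  multiple of \<open>m\<close>; the sign of the factor tells on which side the triangle
  lies.\<close>

lemma points_out_cases:
  fixes K :: "(real^2) set"
  assumes "2 simplex K" "E edge_of K" "unit_normal m E"
  shows "points_out m E K \<or> points_out (- m) E K"
proof -
  have E: "E face_of K" "aff_dim E = 1" using assms by (auto simp: edge_of_def)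
  then have "E exposed_face_of K"
    using exposed_face_of_polyhedron triangle_facts[OF assms(1)] by blast
  moreover have "E \<noteq> {}" "E \<noteq> K" using E triangle_facts[OF assms(1)] by auto
  ultimately obtain a b where ab: "a \<noteq> 0" "K \<subseteq> {x. a \<bullet> x \<le> b}" "E = K \<inter> {x. a \<bullet> x = b}"
    unfolding exposed_face_of by auto
  obtain x0 x1 where x: "x0 \<noteq> x1" "E = closed_segment x0 x1" using edge_segment[OF assms(1,2)] by blast
  have m: "norm m = 1" "m \<bullet> (x1 - x0) = 0"
    using assms(3) x unfolding unit_normal_def by auto
  have "a \<bullet> (x1 - x0) = 0"
    using ab x by (auto simp: inner_diff_right)
  then have am: "a = (a \<bullet> m) *\<^sub>R m" using m x by (intro normal_parallel[of m "x1 - x0"]) auto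
  have lt: "a \<bullet> y < b" if "y \<in> interior K" for y
    using that interior_mono[OF ab(2)] interior_halfspace_le[OF ab(1), of b] by auto
  have lt': "(a \<bullet> m) * (m \<bullet> (y - x)) < 0" if "x \<in> E" "y \<in> interior K" for x y
  proof -
    have "a \<bullet> (y - x) < 0" using lt[OF that(2)] ab(3) that(1) by (simp add: inner_diff_right)
    then show ?thesis using am by (metis inner_scaleR_left)
  qed
  show ?thesis
  proof (cases "a \<bullet> m > 0")
    case True
    then show ?thesis using lt' unfolding points_out_def by (metis mult_less_0_iff not_less_iff_gr_or_eq)
  next
    case False
    then have "points_out (- m) E K"
      unfolding points_out_def using lt' by (metis inner_minus_left mult_less_0_iff neg_less_0_iff_less)
    then show ?thesis ..
  qed
qed

lemma points_out_le:
  assumes "2 simplex K" "points_out m E K" "x \<in> E" "y \<in> K"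
  shows "m \<bullet> (y - x) \<le> 0"
proof -
  have "interior K \<subseteq> {y. m \<bullet> y \<le> m \<bullet> x}"
    using assms(2,3) unfolding points_out_def by (auto simp: inner_diff_right less_imp_le)
  then have "closure (interior K) \<subseteq> {y. m \<bullet> y \<le> m \<bullet> x}"
    by (rule closure_minimal) (rule closed_halfspace_le)
  then show ?thesis using triangle_facts(8)[OF assms(1)] assms(4) by (auto simp: inner_diff_right)
qed

text \<open>If the interiors were disjoint, a separating line would contain the common edge, so its
  normal would be a multiple of \<open>m\<close>; but \<open>m\<close> has the same sign on both
  interiors. This yields the uniqueness presupposed by the definite descriptions
  \<open>elem1\<close> and \<open>elem2\<close>.\<close>

lemma points_out_same_side:
  fixes K K' :: "(real^2) set"
  assumes K: "2 simplex K" "E edge_of K" "points_out m E K"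
    and K': "2 simplex K'" "E edge_of K'" "points_out m E K'"
    and m: "unit_normal m E"
  shows "interior K \<inter> interior K' \<noteq> {}"
proof
  assume "interior K \<inter> interior K' = {}"
  then obtain a b where ab: "a \<noteq> 0" "\<forall>x\<in>interior K. a \<bullet> x \<le> b" "\<forall>x\<in>interior K'. b \<le> a \<bullet> x"
    using separating_hyperplane_sets[of "interior K" "interior K'"] triangle_facts[OF K(1)] triangle_facts[OF K'(1)]
      convex_interior by metis
  have "closure (interior K) \<subseteq> {x. a \<bullet> x \<le> b}" "closure (interior K') \<subseteq> {x. b \<le> a \<bullet> x}"
    using ab by (intro closure_minimal closed_halfspace_le closed_halfspace_ge; blast)+
  then have KK: "K \<subseteq> {x. a \<bullet> x \<le> b}" "K' \<subseteq> {x. b \<le> a \<bullet> x}"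
    using triangle_facts(8) K(1) K'(1) by auto
  have EK: "E \<subseteq> K" "E \<subseteq> K'" using K(2) K'(2) edge_of_imp_subset by blast+
  obtain x0 x1 where x: "x0 \<noteq> x1" "E = closed_segment x0 x1" using edge_segment[OF K(1,2)] by blast
  have x01: "x0 \<in> E" "x1 \<in> E" using x by auto
  have ax: "a \<bullet> x0 = b" "a \<bullet> x1 = b" using KK EK x01 by (auto intro!: antisym)
  have n1: "norm m = 1" "m \<bullet> (x1 - x0) = 0" using m x01 unfolding unit_normal_def by auto
  have am: "a = (a \<bullet> m) *\<^sub>R m"
    by (rule normal_parallel[of m "x1 - x0"]) (use n1 x ax in \<open>auto simp: inner_diff_right\<close>)
  obtain y y' where y: "y \<in> interior K" "y' \<in> interior K'"
    using triangle_facts(7) K(1) K'(1) by blast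
  have "m \<bullet> (y - x0) < 0" "m \<bullet> (y' - x0) < 0"
    using K(3) K'(3) y x01 unfolding points_out_def by auto
  moreover have "(a \<bullet> m) * (m \<bullet> (y - x0)) \<le> 0" "(a \<bullet> m) * (m \<bullet> (y' - x0)) \<ge> 0"
  proof -
    have "a \<bullet> (y - x0) \<le> 0" "a \<bullet> (y' - x0) \<ge> 0"
      using ab y ax by (auto simp: inner_diff_right)
    then show "(a \<bullet> m) * (m \<bullet> (y - x0)) \<le> 0" "(a \<bullet> m) * (m \<bullet> (y' - x0)) \<ge> 0"
      using am by (metis inner_scaleR_left)+
  qed
  ultimately have "a \<bullet> m = 0" by (metis linorder_not_less mult_le_0_iff mult_less_cancel_right_disj mult_zero_left nless_le zero_le_mult_iff)
  then show False using am ab(1) by simp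
qed

section \<open>Incidence of elements and edges in a conforming mesh\<close>

locale dg_mesh =
  fixes \<Omega> :: "(real^2) set" and \<K> :: "(real^2) set set" and n :: "(real^2) set \<Rightarrow> real^2"
  assumes domain: "convex_polygonal_domain \<Omega>"
    and mesh: "conforming_mesh \<Omega> \<K>"
    and normals: "normal_field \<Omega> \<K> n"
begin

lemma simplex: "K \<in> \<K> \<Longrightarrow> 2 simplex K"
  and finite_mesh: "finite \<K>"
  and Int_face: "K \<in> \<K> \<Longrightarrow> K' \<in> \<K> \<Longrightarrow> K \<inter> K' face_of K"
  and Union_mesh: "\<Union>\<K> = closure \<Omega>"
  using mesh unfolding conforming_mesh_def triangulation_def by auto

lemma domain_facts: "open \<Omega>" "\<Omega> \<noteq> {}" "bounded \<Omega>" "convex \<Omega>" "interior (closure \<Omega>) = \<Omega>"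
  using domain unfolding convex_polygonal_domain_def
  by (auto simp: convex_interior_closure interior_open)

lemma interior_subset_domain: "K \<in> \<K> \<Longrightarrow> interior K \<subseteq> \<Omega>"
  using Union_mesh interior_mono[of K "closure \<Omega>"] domain_facts(5) by blast

text \<open>The face \<open>K \<inter> K'\<close> meets the relative interior of \<open>K\<close>,
  so it is all of \<open>K\<close>; then \<open>K\<close> is a face of \<open>K'\<close> of full
  dimension.\<close>

lemma mesh_eqI:
  assumes "K \<in> \<K>" "K' \<in> \<K>" "x \<in> interior K" "x \<in> K'"
  shows "K = K'"
proof -
  have F: "K \<inter> K' face_of K" "K' \<inter> K face_of K'" using Int_face assms by auto
  have "x \<in> rel_interior K" "x \<in> K \<inter> K'"
    using assms triangle_facts(10)[OF simplex] interior_subset by auto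
  then have KK: "K \<inter> K' = K"
    using face_of_disjoint_rel_interior[OF F(1)] by blast
  then have "K face_of K'" using F(2) by (simp add: Int_commute)
  then show ?thesis
    using face_of_eq_same_dim triangle_facts[OF simplex] assms by metis
qed

abbreviation "\<E> \<equiv> edges \<K>"
abbreviation "outer E \<equiv> boundary_edge \<Omega> E"
abbreviation "V\<^sub>h k \<equiv> DG_space k \<Omega> \<K>"

lemma edge_normal: "E \<in> \<E> \<Longrightarrow> unit_normal (n E) E"
  using normals unfolding normal_field_def by blast

text \<open>The predicate under the definite descriptions \<open>elem1\<close> (with
  \<open>m = n E\<close>) and \<open>elem2\<close> (with \<open>m = - n E\<close>); the sign is a
  parameter so that both elements are treated alike.\<close>

definition side :: "real^2 \<Rightarrow> (real^2) set \<Rightarrow> (real^2) set \<Rightarrow> bool" where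
  "side m E K \<longleftrightarrow> K \<in> \<K> \<and> E edge_of K \<and> points_out m E K"

lemma side_unique:
  assumes "E \<in> \<E>" "m = n E \<or> m = - n E" "side m E K" "side m E K'"
  shows "K = K'"
proof -
  have "unit_normal m E" using edge_normal[OF assms(1)] assms(2) by (auto simp: unit_normal_def)
  then obtain x where "x \<in> interior K" "x \<in> interior K'"
    using points_out_same_side[of K E m K'] assms(3,4) simplex unfolding side_def by blast
  then show ?thesis using mesh_eqI assms(3,4) interior_subset unfolding side_def by blast
qed

lemma elem1_eq: "E \<in> \<E> \<Longrightarrow> side (n E) E K \<Longrightarrow> elem1 \<K> n E = K"
  unfolding elem1_def by (rule the_equality) (simp_all add: side_def[symmetric] side_unique[of E "n E"])

lemma elem2_eq: "E \<in> \<E> \<Longrightarrow> side (- n E) E K \<Longrightarrow> elem2 \<K> n E = K"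
  unfolding elem2_def by (rule the_equality) (simp_all add: side_def[symmetric] side_unique[of E "- n E"])

definition vertices :: "(real^2) set" where
  "vertices = {v. \<exists>K\<in>\<K>. {v} face_of K}"

lemma finite_vertices: "finite vertices"
proof -
  have "finite {F. F face_of K}" if "K \<in> \<K>" for K
    using finite_polytope_faces triangle_facts(5)[OF simplex[OF that]] by blast
  then have "finite (\<Union>K\<in>\<K>. {F. F face_of K})" using finite_mesh by blast
  moreover have "(\<lambda>v. {v}) ` vertices \<subseteq> (\<Union>K\<in>\<K>. {F. F face_of K})"
    unfolding vertices_def by auto
  ultimately show ?thesis
    by (meson finite_imageD finite_subset inj_onI singleton_inject)
qed

lemma finite_edges: "finite (\<E>)"
proof -
  have "finite {F. F face_of K}" if "K \<in> \<K>" for K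
    using finite_polytope_faces triangle_facts(5)[OF simplex[OF that]] by blast
  then have "finite (\<Union>K\<in>\<K>. {F. F face_of K})" using finite_mesh by blast
  then show ?thesis
    by (rule finite_subset[rotated]) (auto simp: edges_def edge_of_def)
qed

text \<open>The common face contains a point that is no vertex, which leaves only an edge. By
  \<open>side_unique\<close> the two elements cannot lie on the same side of it, so one is
  \<open>elem1\<close> and the other \<open>elem2\<close>.\<close>

lemma shared_edge:
  assumes "K \<in> \<K>" "K' \<in> \<K>" "K \<noteq> K'" "p \<in> K" "p \<in> K'" "p \<notin> vertices"
  defines "E \<equiv> K \<inter> K'"
  shows "E edge_of K" "E edge_of K'" "E \<in> \<E>"
    "side (n E) E K \<and> side (- n E) E K' \<or> side (n E) E K' \<and> side (- n E) E K"
proof -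
  have ne: "E \<noteq> K" "E \<noteq> K'"
  proof -
    obtain x x' where x: "x \<in> interior K" "x' \<in> interior K'"
      using triangle_facts(7)[OF simplex] assms by blast
    then have "x \<notin> K'" "x' \<notin> K" using mesh_eqI assms(1-3) by metis+
    then show "E \<noteq> K" "E \<noteq> K'" unfolding E_def using x interior_subset by blast+
  qed
  have nv: "\<not> {p} face_of K" "\<not> {p} face_of K'"
    using assms unfolding vertices_def by auto
  have f: "E face_of K" "E face_of K'"
    using Int_face[OF assms(1,2)] Int_face[OF assms(2,1)] by (simp_all add: E_def Int_commute)
  show e: "E edge_of K" "E edge_of K'"
    using triangle_proper_face_is_edge[of _ E p] simplex f ne nv assms by (auto simp: E_def)
  then show E: "E \<in> \<E>" using assms(1) unfolding edges_def by blast
  have "points_out (n E) E K \<or> points_out (- n E) E K" "points_out (n E) E K' \<or> points_out (- n E) E K'"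
    using points_out_cases edge_normal[OF E] e simplex assms(1,2) by auto
  then show "side (n E) E K \<and> side (- n E) E K' \<or> side (n E) E K' \<and> side (- n E) E K"
    using side_unique[OF E, of _ K K'] e assms(1-3) unfolding side_def by blast
qed

lemma boundary_edge_side:
  assumes "K \<in> \<K>" "E edge_of K" "outer E"
  shows "side (n E) E K"
proof -
  have "E \<in> \<E>" using assms unfolding edges_def by blast
  then have "points_out (n E) E \<Omega>" using normals assms(3) unfolding normal_field_def by blast
  then have "points_out (n E) E K"
    using interior_subset_domain[OF assms(1)] domain_facts(1) unfolding points_out_def
    by (metis interior_open subsetD)
  then show ?thesis using assms unfolding side_def by blast
qed

text \<open>Points approaching a non-vertex point \<open>p\<close> of the edge from the far side lie
  in finitely many closed elements, so one element contains infinitely many of them and also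
  \<open>p\<close>. It shares with \<open>K\<close> an edge through \<open>p\<close>, and this can
  only be \<open>E\<close>. Without this existence the definite descriptions \<open>elem1\<close>
  and \<open>elem2\<close> would carry no information.\<close>

lemma interior_edge_sides:
  assumes E: "E \<in> \<E>" and nb: "\<not> outer E"
  shows "\<exists>K1 K2. side (n E) E K1 \<and> side (- n E) E K2"
proof -
  obtain K where K: "K \<in> \<K>" "E edge_of K" using E unfolding edges_def by blast
  obtain a b where ab: "a \<noteq> b" "E = closed_segment a b" using edge_segment[OF simplex[OF K(1)] K(2)] by blast
  have E\<Omega>: "E \<subseteq> closure \<Omega>" using K Union_mesh edge_of_imp_subset by blast
  obtain p0 where p0: "p0 \<in> E" "p0 \<in> \<Omega>"
    using nb E\<Omega> domain_facts unfolding boundary_edge_def frontier_def by (auto simp: interior_open)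
  \<comment> \<open>Prepares a point of the edge that is no vertex: there are finitely many
    vertices, but near \<open>p0\<close> the edge has infinitely many points in the open
    domain.\<close>
  have "infinite (E \<inter> \<Omega>)"
  proof -
    have "p0 islimpt E"
      using K(2) p0(1) connected_imp_perfect_aff_dim[of E p0] by (simp add: ab edge_of_def)
    then have "infinite (\<Omega> \<inter> E)"
      using p0(2) domain_facts(1) by (simp add: islimpt_eq_acc_point)
    then show ?thesis by (simp add: Int_commute)
  qed
  then have "\<not> E \<inter> \<Omega> \<subseteq> vertices" using finite_vertices finite_subset by blast
  then obtain p where p: "p \<in> E" "p \<in> \<Omega>" "p \<notin> vertices" by blast
  have one: "\<exists>K'. side (- m) E K'" if m: "side m E K" and m': "m = n E \<or> m = - n E" for m
  proof -
    have um: "unit_normal m E" using edge_normal[OF E] m' by (auto simp: unit_normal_def)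
    then have m1: "m \<bullet> m = 1" unfolding unit_normal_def by (simp add: dot_square_norm)
    define x where "x i = p + inverse (real (Suc i)) *\<^sub>R m" for i
    have lim: "x \<longlonglongrightarrow> p"
      unfolding x_def using tendsto_add[OF tendsto_const[of p] tendsto_scaleR[OF LIMSEQ_inverse_real_of_nat tendsto_const[of m]]]
      by simp
    have "\<forall>\<^sub>F i in sequentially. x i \<in> \<Omega>"
      using lim p(2) domain_facts(1) topological_tendstoD by blast
    then have "\<forall>\<^sub>F i in sequentially. \<exists>K'\<in>\<K>. x i \<in> K'"
      by eventually_elim (use Union_mesh closure_subset in blast)
    then have "\<exists>K'\<in>\<K>. \<exists>\<^sub>F i in sequentially. x i \<in> K'"
      by (intro frequently_bex_finite finite_mesh eventually_frequently sequentially_bot)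
    then obtain K' where K': "K' \<in> \<K>" "\<exists>\<^sub>F i in sequentially. x i \<in> K'" by blast
    have "p \<in> K'"
    proof (rule ccontr)
      assume "p \<notin> K'"
      then have "\<forall>\<^sub>F i in sequentially. x i \<in> - K'"
        using lim topological_tendstoD[of x p sequentially "- K'"] triangle_facts(3)[OF simplex[OF K'(1)]]
        by (simp add: open_Compl)
      then show False using K'(2) by (simp add: frequently_def)
    qed
    obtain i where i: "x i \<in> K'" using K'(2) frequently_ex by blast
    have pos: "m \<bullet> (x i - p) > 0" unfolding x_def by (simp add: m1)
    have "\<not> m \<bullet> (x i - p) \<le> 0" using pos by simp
    then have "\<not> points_out m E K'" and "x i \<notin> K"
      using points_out_le[OF simplex[OF K'(1)] _ p(1) i] points_out_le[OF simplex[OF K(1)] _ p(1), of m "x i"] m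
      unfolding side_def by auto
    then have "K' \<noteq> K" using i by blast
    have pK: "p \<in> K" using p K edge_of_imp_subset by blast
    have "K \<inter> K' edge_of K" "K \<inter> K' edge_of K'"
      using shared_edge[of K K' p] K K' \<open>K' \<noteq> K\<close> pK \<open>p \<in> K'\<close> p by auto
    moreover have "\<not> {p} face_of K" using p(3) K unfolding vertices_def by blast
    ultimately have "E edge_of K'"
      using edge_unique[OF simplex[OF K(1)] K(2), of "K \<inter> K'" p] p pK \<open>p \<in> K'\<close> by auto
    then have "side (- m) E K'"
      using points_out_cases[OF simplex[OF K'(1)] _ um] K' \<open>\<not> points_out m E K'\<close> unfolding side_def by blast
    then show ?thesis by blast
  qed
  have "side (n E) E K \<or> side (- n E) E K"
    using points_out_cases[OF simplex[OF K(1)] K(2) edge_normal[OF E]] K unfolding side_def by blast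
  then show ?thesis using one[of "n E"] one[of "- n E"] by auto
qed

lemma elem1_side: "E \<in> \<E> \<Longrightarrow> side (n E) E (elem1 \<K> n E)"
proof -
  assume E: "E \<in> \<E>"
  have "\<exists>K. side (n E) E K"
    using interior_edge_sides[OF E] boundary_edge_side[of _ E] E unfolding edges_def by blast
  then show ?thesis using elem1_eq[OF E] by auto
qed

lemma elem2_side: "E \<in> \<E> \<Longrightarrow> \<not> outer E \<Longrightarrow> side (- n E) E (elem2 \<K> n E)"
  using interior_edge_sides elem2_eq by metis

end

section \<open>Variation along a line\<close>

abbreviation enorm :: "complex \<Rightarrow> ennreal" where
  "enorm z \<equiv> ennreal (cmod z)"

lemma FTC_norm_bound:
  assumes "p \<in> Poly m" "a \<le> b"
  shows "enorm (p (slice i y b) - p (slice i y a))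
    \<le> (\<integral>\<^sup>+s. indicator {a..b} s * enorm (partial i p (slice i y s)) \<partial>lborel)"
proof -
  let ?h = "\<lambda>s. partial i p (slice i y s)"
  have ch: "continuous_on S ?h" for S
    by (rule continuous_on_compose2[OF continuous_on_Poly[OF Poly_has_derivative(2)[OF assms(1)], of UNIV] continuous_on_slice']) simp
  have "(LBINT s. indicator {a..b} s *\<^sub>R ?h s) = p (slice i y b) - p (slice i y a)"
  proof (rule integral_FTC_Icc[OF assms(2) _ ch])
    fix s
    show "((\<lambda>s. p (slice i y s)) has_vector_derivative ?h s) (at s within {a..b})"
      using Poly_has_vector_derivative[OF assms(1), of "slice i y 0" i s] by (simp add: slice_eq[symmetric])
  qed
  moreover have "integrable lborel (\<lambda>s. indicator {a..b} s *\<^sub>R ?h s)"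
    by (rule borel_integrable_compact) (auto intro: ch)
  ultimately have "enorm (p (slice i y b) - p (slice i y a))
    \<le> (\<integral>\<^sup>+s. ennreal (norm (indicator {a..b} s *\<^sub>R ?h s)) \<partial>lborel)"
    using integral_norm_bound_ennreal by metis
  also have "\<dots> = (\<integral>\<^sup>+s. indicator {a..b} s * enorm (?h s) \<partial>lborel)"
    by (intro nn_integral_cong) (simp add: indicator_def)
  finally show ?thesis .
qed

lemma finite_set_gap_below:
  fixes S :: "real set"
  assumes "finite S"
  shows "\<exists>a<b. {a<..<b} \<inter> S = {}"
proof (cases "{s \<in> S. s < b} = {}")
  case True
  then show ?thesis by (intro exI[of _ "b - 1"]) auto
next
  case False
  have f: "finite {s \<in> S. s < b}" using assms by simp
  have "Max {s \<in> S. s < b} < b" using Max_in[OF f False] by auto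
  moreover have "{Max {s \<in> S. s < b}<..<b} \<inter> S = {}" using Max_ge[OF f] by fastforce
  ultimately show ?thesis by blast
qed

context dg_mesh
begin

text \<open>\<open>jump\<close> with the one-sided traces replaced by values of functions
  \<open>g K\<close> on the whole plane. No limits are involved, and \<open>g\<close> may be any
  family, in particular the powers of the element polynomials.\<close>

definition pjump :: "((real^2) set \<Rightarrow> real^2 \<Rightarrow> complex) \<Rightarrow> (real^2) set \<Rightarrow> real^2 \<Rightarrow> complex" where
  "pjump g E x = (if outer E then g (elem1 \<K> n E) x
     else g (elem1 \<K> n E) x - g (elem2 \<K> n E) x)"

lemma triangle_point_cases:
  assumes "K \<in> \<K>" "x \<in> K" "x \<notin> interior K"
  shows "\<exists>E. E edge_of K \<and> x \<in> E"
proof -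
  note tf = triangle_facts[OF simplex[OF assms(1)]]
  have "x \<in> rel_frontier K" using assms tf unfolding rel_frontier_def by simp
  then obtain F where F: "F facet_of K" "x \<in> F"
    using rel_frontier_of_polyhedron[OF tf(4)] by auto
  then show ?thesis using tf(6) unfolding facet_of_def edge_of_def by auto
qed

lemma interior_not_on_edge:
  assumes "K \<in> \<K>" "x \<in> interior K" "E \<in> \<E>"
  shows "x \<notin> E"
proof
  assume x: "x \<in> E"
  obtain K' where K': "K' \<in> \<K>" "E edge_of K'" using assms(3) unfolding edges_def by blast
  then have "x \<in> K'" using x edge_of_imp_subset by blast
  then have "K' = K" using mesh_eqI[OF assms(1) K'(1) assms(2)] by simp
  then have "E face_of K" "E \<noteq> K" using K' triangle_facts(6)[OF simplex[OF assms(1)]] by (auto simp: edge_of_def)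
  then show False using face_of_disjoint_interior x assms(2) by blast
qed

lemma edge_closed_segment:
  assumes "E \<in> \<E>"
  shows "\<exists>a b. a \<noteq> b \<and> E = closed_segment a b \<and> a \<in> vertices \<and> b \<in> vertices"
  using assms edge_segment[OF simplex] unfolding edges_def vertices_def by blast

text \<open>A linear functional supporting the convex domain at \<open>p\<close> is minimal over the
  edge at a relatively interior point, hence constant on the edge; so the whole edge lies on the
  supporting line and misses the open domain.\<close>

lemma outside_imp_boundary_edge:
  assumes E: "E \<in> \<E>" and p: "p \<in> E" "p \<notin> \<Omega>" "p \<notin> vertices"
  shows "outer E"
proof -
  have E\<Omega>: "E \<subseteq> closure \<Omega>" using E Union_mesh edge_of_imp_subset unfolding edges_def by blast
  have r: "rel_interior \<Omega> = \<Omega>" using domain_facts(1) by (rule rel_interior_open)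
  obtain c where c: "\<And>y. y \<in> closure \<Omega> \<Longrightarrow> c \<bullet> p \<le> c \<bullet> y" "\<And>y. y \<in> \<Omega> \<Longrightarrow> c \<bullet> p < c \<bullet> y"
    using supporting_hyperplane_relative_frontier[of \<Omega> p] domain_facts(4) p E\<Omega> r by (metis subsetD)
  obtain a b where ab: "E = closed_segment a b" "a \<in> vertices" "b \<in> vertices"
    using edge_closed_segment[OF E] by blast
  have "p \<in> open_segment a b" using p ab unfolding open_segment_def by auto
  then obtain t where t: "0 < t" "t < 1" "p = (1 - t) *\<^sub>R a + t *\<^sub>R b" by (auto simp: in_segment)
  have cab: "c \<bullet> p \<le> c \<bullet> a" "c \<bullet> p \<le> c \<bullet> b" using c E\<Omega> ab by auto
  have "c \<bullet> p = (1 - t) * (c \<bullet> a) + t * (c \<bullet> b)" using t by (simp add: inner_add_right)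
  then have "(1 - t) * (c \<bullet> a - c \<bullet> p) + t * (c \<bullet> b - c \<bullet> p) = 0" by (simp add: algebra_simps)
  moreover have "(1 - t) * (c \<bullet> a - c \<bullet> p) \<ge> 0" "t * (c \<bullet> b - c \<bullet> p) \<ge> 0" using cab t by auto
  ultimately have "(1 - t) * (c \<bullet> a - c \<bullet> p) = 0" "t * (c \<bullet> b - c \<bullet> p) = 0" by linarith+
  then have eq: "c \<bullet> a = c \<bullet> p" "c \<bullet> b = c \<bullet> p" using t by auto
  have "c \<bullet> x = c \<bullet> p" if "x \<in> E" for x
  proof -
    have "\<exists>u. x = (1 - u) *\<^sub>R a + u *\<^sub>R b" using \<open>x \<in> E\<close> unfolding ab(1) in_segment by blast
    then obtain u where "x = (1 - u) *\<^sub>R a + u *\<^sub>R b" ..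
    then have "c \<bullet> x = (1 - u) * (c \<bullet> a) + u * (c \<bullet> b)" by (simp only: inner_add_right inner_scaleR_right)
    then show ?thesis unfolding eq by (simp add: left_diff_distrib)
  qed
  then have "E \<inter> \<Omega> = {}" using c(2) by fastforce
  then show ?thesis
    using E\<Omega> domain_facts(1) unfolding boundary_edge_def frontier_def by (auto simp: interior_open)
qed

section \<open>Axis-parallel lines that avoid every vertex\<close>

context
  fixes i o' :: 2 and y :: real
  assumes oi: "o' \<noteq> i"
    and generic: "\<And>v. v \<in> vertices \<Longrightarrow> v $ o' \<noteq> y"
begin

lemma slice_not_vertex: "slice i y s \<notin> vertices"
  using generic[of "slice i y s"] oi by (auto simp: slice_nth)

text \<open>Since the line avoids the vertices, an edge that it meets cannot be parallel to it;
  hence the crossing point is determined by the coordinate \<open>y\<close> alone. The formula is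
  the one used in \<open>crossval\<close>.\<close>

lemma edge_crossing_param:
  assumes E: "E \<in> \<E>" "slice i y s \<in> E" and ab: "E = closed_segment a b"
    "a \<in> vertices"
  shows "a $ o' \<noteq> b $ o'" "(y - a $ o') / (b $ o' - a $ o') \<in> {0..1}"
    "slice i y s = linepath a b ((y - a $ o') / (b $ o' - a $ o'))"
proof -
  obtain t where t: "0 \<le> t" "t \<le> 1" "slice i y s = (1 - t) *\<^sub>R a + t *\<^sub>R b"
    using E ab by (auto simp: in_segment)
  have "slice i y s $ o' = (1 - t) * a $ o' + t * b $ o'" using t(3) by simp
  then have y: "y = a $ o' + t * (b $ o' - a $ o')" using oi by (simp add: slice_nth algebra_simps)
  then show ne: "a $ o' \<noteq> b $ o'" using generic[OF ab(2)] by auto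
  then have "(y - a $ o') / (b $ o' - a $ o') = t" using y by (simp add: field_simps)
  then show "(y - a $ o') / (b $ o' - a $ o') \<in> {0..1}"
    "slice i y s = linepath a b ((y - a $ o') / (b $ o' - a $ o'))"
    using t by (auto simp: linepath_def)
qed

lemma edge_crossing_unique:
  assumes "E \<in> \<E>" "slice i y s \<in> E" "slice i y s' \<in> E"
  shows "s = s'"
proof -
  obtain a b where ab: "E = closed_segment a b" "a \<in> vertices"
    using edge_closed_segment[OF assms(1)] by blast
  have "slice i y s = slice i y s'"
    using edge_crossing_param(3)[OF assms(1,2) ab] edge_crossing_param(3)[OF assms(1,3) ab] by simp
  then have "slice i y s $ i = slice i y s' $ i" by simp
  then show ?thesis by (simp add: slice_nth)
qed

definition crossings :: "real set" where
  "crossings = {s. \<exists>E\<in>\<E>. slice i y s \<in> E}"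

lemma finite_crossings: "finite crossings"
proof -
  have "finite {s. slice i y s \<in> E}" if "E \<in> \<E>" for E
  proof (cases "\<exists>s. slice i y s \<in> E")
    case True
    then obtain s where "slice i y s \<in> E" by blast
    then have "{s. slice i y s \<in> E} \<subseteq> {s}" using edge_crossing_unique[OF that] by blast
    then show ?thesis using finite_subset by blast
  qed simp
  moreover have "crossings = (\<Union>E\<in>\<E>. {s. slice i y s \<in> E})"
    unfolding crossings_def by blast
  ultimately show ?thesis using finite_edges by simp
qed

lemma not_crossing_interior:
  assumes "s \<notin> crossings" "K \<in> \<K>" "slice i y s \<in> K"
  shows "slice i y s \<in> interior K"
proof (rule ccontr)
  assume "slice i y s \<notin> interior K"
  then obtain E where "E edge_of K" "slice i y s \<in> E"
    using triangle_point_cases[OF assms(2,3)] by blast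
  then show False using assms(1,2) unfolding crossings_def edges_def by blast
qed

text \<open>Leaving \<open>K\<close> along a connected set means meeting its frontier, which
  consists of edges, that is, producing a crossing.\<close>

lemma stays_inside:
  assumes "connected I" "I \<inter> crossings = {}" "s0 \<in> I" "K \<in> \<K>" "slice i y s0 \<in> K" "s \<in> I"
  shows "slice i y s \<in> interior K"
proof (rule ccontr)
  assume out: "slice i y s \<notin> interior K"
  have c: "connected (slice i y ` I)"
    by (intro connected_continuous_image continuous_on_slice' assms)
  have nK: "slice i y s \<notin> K" using out not_crossing_interior assms by blast
  obtain t where t: "t \<in> I" "slice i y t \<in> frontier K"
    using connected_Int_frontier[OF c, of K] assms(3,5,6) nK by blast
  then have "slice i y t \<in> K" "slice i y t \<notin> interior K"
    using triangle_facts(3)[OF simplex[OF assms(4)]] by (auto simp: frontier_def)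
  then show False using not_crossing_interior t(1) assms(2,4) by blast
qed

text \<open>Going back along the line from \<open>s\<close>, the value changes by the integral of
  the derivative inside an element and by a jump at each crossing, until the line has left the
  domain. The induction is on the number of crossings before \<open>s\<close>. Every edge
  contributes at most once because the line meets it at most once.\<close>

lemma slice_bound:
  assumes g: "\<And>K. K \<in> \<K> \<Longrightarrow> g K \<in> Poly m"
    and c: "\<And>E s. E \<in> \<E> \<Longrightarrow> slice i y s \<in> E \<Longrightarrow> enorm (pjump g E (slice i y s)) \<le> c E"
    and K: "K \<in> \<K>" "slice i y s \<in> interior K"
  shows "enorm (g K (slice i y s)) \<le>
    (\<integral>\<^sup>+r. indicator {..<s} r * (\<Sum>K\<in>\<K>. indicator K (slice i y r) * enorm (partial i (g K) (slice i y r))) \<partial>lborel)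
    + (\<Sum>E\<in>{E\<in>\<E>. \<exists>r<s. slice i y r \<in> E}. c E)"
  using K
proof (induction "card {r \<in> crossings. r < s}" arbitrary: s K rule: less_induct)
  case less
  define q where "q r = (\<Sum>K\<in>\<K>. indicator K (slice i y r) * enorm (partial i (g K) (slice i y r)))" for r
  define B where "B s = (\<integral>\<^sup>+r. indicator {..<s} r * q r \<partial>lborel)" for s
  define X where "X s = {E\<in>\<E>. \<exists>r<s. slice i y r \<in> E}" for s
  have qm[measurable]: "q \<in> borel_measurable borel"
  proof -
    have sm[measurable]: "slice i y \<in> borel_measurable borel"
      by (rule borel_measurable_continuous_onI[OF continuous_on_slice'])
    have [measurable]: "partial i (g K) \<in> borel_measurable borel" if "K \<in> \<K>" for K
      by (rule borel_measurable_continuous_onI[OF continuous_on_Poly[OF Poly_has_derivative(2)[OF g[OF that]]]])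
    have [measurable]: "K \<in> sets borel" if "K \<in> \<K>" for K
      using triangle_facts(3)[OF simplex[OF that]] by (rule borel_closed)
    show ?thesis unfolding q_def by measurable
  qed
  have fX: "finite (X s)" for s using finite_edges unfolding X_def by simp
  have scr: "s \<notin> crossings"
    using interior_not_on_edge[OF less.prems] unfolding crossings_def by blast
  note tf = triangle_facts[OF simplex[OF less.prems(1)]]
  have gcont: "continuous_on S (\<lambda>s. g K (slice i y s))" if "K \<in> \<K>" for K S
    by (rule continuous_on_compose2[OF continuous_on_Poly[OF g[OF that], of UNIV] continuous_on_slice']) simp
  let ?S = "{r \<in> crossings. r < s}"
  have fS: "finite ?S" using finite_crossings by simp
  \<comment> \<open>Elements are bounded, so the half-line ending at \<open>s\<close> has to leave
    \<open>K\<close>; there is no base case without crossings.\<close>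
  have "?S \<noteq> {}"
  proof
    assume "?S = {}"
    then have "{..s} \<inter> crossings = {}" using scr by (auto simp: order_le_less)
    then have all: "slice i y r \<in> interior K" if "r \<le> s" for r
      using stays_inside[of "{..s}" s K r, OF connected_Iic _ _ less.prems(1)] less.prems(2) interior_subset that by auto
    obtain M where M: "\<And>x. x \<in> K \<Longrightarrow> norm x \<le> M"
      using compact_imp_bounded[OF tf(2)] unfolding bounded_iff by blast
    define r where "r = - (\<bar>M\<bar> + \<bar>s\<bar> + 1)"
    have "r \<le> s" by (simp add: r_def)
    then have "slice i y r \<in> K" using all interior_subset by blast
    then have "norm (slice i y r) \<le> M" by (rule M)
    then have "\<bar>slice i y r $ i\<bar> \<le> M" using component_le_norm_cart order_trans by blast
    then show False by (simp add: slice_nth r_def)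
  qed
  define s1 where "s1 = Max ?S"
  have s1: "s1 \<in> crossings" "s1 < s" using Max_in[OF fS \<open>?S \<noteq> {}\<close>] by (auto simp: s1_def)
  have gap1: "{s1<..s} \<inter> crossings = {}"
    using Max_ge[OF fS] scr unfolding s1_def by (fastforce simp: order_le_less)
  have inK: "slice i y r \<in> interior K" if "s1 < r" "r \<le> s" for r
    using stays_inside[of "{s1<..s}" s K r] gap1 s1 less.prems interior_subset that by auto
  let ?p = "slice i y s1" and ?D = "\<integral>\<^sup>+r. indicator {s1<..<s} r * q r \<partial>lborel"
  have pK: "?p \<in> K"
  proof -
    have "slice i y ` closure {s1<..s} \<subseteq> K"
    proof (rule image_closure_subset[OF continuous_on_slice' tf(3)])
      show "slice i y ` {s1<..s} \<subseteq> K" using inK interior_subset by fastforce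
    qed
    then show ?thesis using s1(2) by auto
  qed
  have pv: "?p \<notin> vertices" by (rule slice_not_vertex)
  obtain a where a: "a < s1" "{a<..<s1} \<inter> crossings = {}"
    using finite_set_gap_below[OF finite_crossings] by blast
  have left: "\<exists>K'\<in>\<K>. \<forall>r\<in>{a<..<s1}. slice i y r \<in> interior K'" if "r0 \<in> {a<..<s1}" "slice i y r0 \<in> closure \<Omega>" for r0
  proof -
    have "slice i y r0 \<in> \<Union>\<K>" using that(2) by (simp only: Union_mesh)
    then obtain K' where K': "K' \<in> \<K>" "slice i y r0 \<in> K'" by (elim UnionE)
    have "slice i y r \<in> interior K'" if "r \<in> {a<..<s1}" for r
      by (rule stays_inside[OF _ a(2) \<open>r0 \<in> {a<..<s1}\<close> K' that]) simp
    then show ?thesis using K'(1) by blast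
  qed
  \<comment> \<open>The induction hypothesis applies only at parameters \<open>r < s1\<close>, where
    the point is interior to \<open>K'\<close>; it is carried to \<open>s1\<close> itself by letting
    \<open>r\<close> tend to \<open>s1\<close> from the left, where the polynomial
    \<open>g K'\<close> is continuous.\<close>
  have IH: "enorm (g K' ?p) \<le> B s1 + (\<Sum>E\<in>X s1. c E)"
    if K': "K' \<in> \<K>" "\<And>r. r \<in> {a<..<s1} \<Longrightarrow> slice i y r \<in> interior K'" for K'
  proof -
    have bd: "enorm (g K' (slice i y r)) \<le> B s1 + (\<Sum>E\<in>X s1. c E)" if r: "r \<in> {a<..<s1}" for r
    proof -
      have "{t \<in> crossings. t < r} \<subset> ?S"
      proof (rule psubsetI)
        show "{t \<in> crossings. t < r} \<subseteq> ?S" using r s1 by auto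
        have "s1 \<in> ?S" "s1 \<notin> {t \<in> crossings. t < r}" using r s1 by simp_all
        then show "{t \<in> crossings. t < r} \<noteq> ?S" by metis
      qed
      then have "card {t \<in> crossings. t < r} < card ?S" by (rule psubset_card_mono[OF fS])
      then have "enorm (g K' (slice i y r)) \<le> B r + (\<Sum>E\<in>X r. c E)"
        using less.hyps[of r K'] K' r unfolding B_def q_def X_def by simp
      also have "\<dots> \<le> B s1 + (\<Sum>E\<in>X s1. c E)"
        unfolding B_def using r fX
        by (intro add_mono nn_integral_mono sum_mono2) (auto simp: X_def indicator_def intro: less_trans)
      finally show ?thesis .
    qed
    have "((\<lambda>r. enorm (g K' (slice i y r))) \<longlongrightarrow> enorm (g K' ?p)) (at_left s1)"
    proof (intro tendsto_ennrealI tendsto_norm)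
      have "isCont (\<lambda>r. g K' (slice i y r)) s1"
        using gcont[OF K'(1), of UNIV] by (simp add: continuous_on_eq_continuous_at)
      then show "((\<lambda>r. g K' (slice i y r)) \<longlongrightarrow> g K' ?p) (at_left s1)"
        unfolding isCont_def by (rule filterlim_mono) (simp_all add: at_le)
    qed
    moreover have "\<forall>\<^sub>F r in at_left s1. enorm (g K' (slice i y r)) \<le> B s1 + (\<Sum>E\<in>X s1. c E)"
      using eventually_at_left_real[OF a(1)] by eventually_elim (rule bd, simp)
    ultimately show ?thesis
      by (rule tendsto_upperbound) simp
  qed
  \<comment> \<open>Edges through the point at \<open>s1\<close> are crossed nowhere else, so their
    \<open>c E\<close> has not yet been spent in the bound at \<open>s1\<close>.\<close>
  have new: "\<exists>r<s. slice i y r \<in> E" "E \<notin> X s1" if "E \<in> \<E>" "?p \<in> E" for E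
    using that s1 edge_crossing_unique[OF that(1) that(2)] unfolding X_def by blast+
  have XX: "X s1 \<subseteq> X s" using s1(2) unfolding X_def by (auto intro: less_trans)
  have jump: "enorm (g K ?p) \<le> B s1 + (\<Sum>E\<in>X s. c E)"
  proof -
    \<comment> \<open>What lies just before \<open>s1\<close>: the gap has no crossing, so it is
      inside one element or entirely outside. In the last case the point at \<open>s1\<close> is on
      a boundary edge, where \<open>pjump\<close> is the full value.\<close>
    consider (same) "\<And>r. r \<in> {a<..<s1} \<Longrightarrow> slice i y r \<in> interior K"
      | (other) K' where "K' \<in> \<K>" "K' \<noteq> K" "\<And>r. r \<in> {a<..<s1} \<Longrightarrow> slice i y r \<in> interior K'"
      | (out) "\<And>r. r \<in> {a<..<s1} \<Longrightarrow> slice i y r \<notin> closure \<Omega>"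
      using left less.prems(1) by metis
    then show ?thesis
    proof cases
      case same
      have "(\<Sum>E\<in>X s1. c E) \<le> (\<Sum>E\<in>X s. c E)" by (intro sum_mono2 fX XX) simp
      then show ?thesis using IH[OF less.prems(1) same] by (meson add_left_mono order_trans)
    next
      case other
      have pK': "?p \<in> K'"
      proof -
        have "slice i y ` closure {a<..<s1} \<subseteq> K'"
        proof (rule image_closure_subset[OF continuous_on_slice' triangle_facts(3)[OF simplex[OF other(1)]]])
          show "slice i y ` {a<..<s1} \<subseteq> K'" using other(3) interior_subset by blast
        qed
        then show ?thesis using a(1) by auto
      qed
      let ?E = "K \<inter> K'"
      note se = shared_edge[OF less.prems(1) other(1) other(2)[symmetric] pK pK' pv]
      have E: "?E \<in> \<E>" "?p \<in> ?E" using se(3) pK pK' by auto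
      have nb: "\<not> outer ?E"
      proof
        assume b: "outer ?E"
        show False
          using side_unique[OF E(1), of "n ?E" K K'] boundary_edge_side[OF less.prems(1) se(1) b]
            boundary_edge_side[OF other(1) se(2) b] other(2) by simp
      qed
      have "cmod (pjump g ?E ?p) = cmod (g K ?p - g K' ?p)"
        using se(4) elem1_eq[OF E(1)] elem2_eq[OF E(1)] nb unfolding pjump_def
        by (auto simp: norm_minus_commute)
      then have ce: "enorm (g K ?p - g K' ?p) \<le> c ?E" using c[OF E] by simp
      have "enorm (g K ?p) \<le> ennreal (cmod (g K' ?p) + cmod (g K ?p - g K' ?p))"
        using norm_triangle_ineq[of "g K' ?p" "g K ?p - g K' ?p"] by (intro ennreal_leI) simp
      also have "\<dots> = enorm (g K' ?p) + enorm (g K ?p - g K' ?p)" by (simp add: ennreal_plus)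
      also have "\<dots> \<le> (B s1 + (\<Sum>E\<in>X s1. c E)) + c ?E"
        by (rule add_mono[OF IH[OF other(1,3)] ce])
      also have "\<dots> = B s1 + (\<Sum>E\<in>insert ?E (X s1). c E)"
        using new(2)[OF E] fX by (simp add: add_ac)
      also have "\<dots> \<le> B s1 + (\<Sum>E\<in>X s. c E)"
        using E new(1)[OF E] XX by (intro add_left_mono sum_mono2 fX) (auto simp: X_def)
      finally show ?thesis .
    next
      case out
      have lim: "(slice i y \<longlongrightarrow> ?p) (at_left s1)"
      proof -
        have "isCont (slice i y) s1"
          using continuous_on_slice'[of UNIV i y] by (simp add: continuous_on_eq_continuous_at)
        then show ?thesis unfolding isCont_def by (rule filterlim_mono) (simp_all add: at_le)
      qed
      have pO: "?p \<notin> \<Omega>"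
      proof
        assume "?p \<in> \<Omega>"
        then have "\<forall>\<^sub>F r in at_left s1. slice i y r \<in> \<Omega>" using lim domain_facts(1) topological_tendstoD by blast
        then have "\<forall>\<^sub>F r in at_left s1. False"
          using eventually_at_left_real[OF a(1)] by eventually_elim (use out closure_subset in blast)
        then show False by simp
      qed
      then have "?p \<notin> interior K" using interior_subset_domain[OF less.prems(1)] by blast
      then obtain E where E: "E edge_of K" "?p \<in> E" using triangle_point_cases[OF less.prems(1) pK] by blast
      then have EE: "E \<in> \<E>" using less.prems(1) unfolding edges_def by blast
      have b: "outer E" by (rule outside_imp_boundary_edge[OF EE E(2) pO pv])
      have "elem1 \<K> n E = K" by (rule elem1_eq[OF EE boundary_edge_side[OF less.prems(1) E(1) b]])
      then have "pjump g E ?p = g K ?p" using b by (simp add: pjump_def)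
      then have "enorm (g K ?p) \<le> c E" using c[OF EE E(2)] by simp
      also have "\<dots> \<le> (\<Sum>E\<in>X s. c E)"
        using EE new(1)[OF EE E(2)] by (intro member_le_sum fX) (auto simp: X_def)
      also have "\<dots> \<le> B s1 + \<dots>" by simp
      finally show ?thesis .
    qed
  qed
  have "enorm (g K (slice i y s)) \<le> ennreal (cmod (g K ?p) + cmod (g K (slice i y s) - g K ?p))"
    using norm_triangle_ineq[of "g K ?p" "g K (slice i y s) - g K ?p"] by (intro ennreal_leI) simp
  also have "\<dots> = enorm (g K ?p) + enorm (g K (slice i y s) - g K ?p)" by (simp add: ennreal_plus)
  also have "\<dots> \<le> (B s1 + (\<Sum>E\<in>X s. c E)) + ?D"
  proof (rule add_mono[OF jump])
    have "enorm (g K (slice i y s) - g K ?p)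
      \<le> (\<integral>\<^sup>+r. indicator {s1..s} r * enorm (partial i (g K) (slice i y r)) \<partial>lborel)"
      by (rule FTC_norm_bound[OF g[OF less.prems(1)]]) (use s1 in simp)
    also have "\<dots> = (\<integral>\<^sup>+r. indicator {s1<..<s} r * enorm (partial i (g K) (slice i y r)) \<partial>lborel)"
    proof (rule nn_integral_cong_AE)
      show "AE r in lborel. indicator {s1..s} r * enorm (partial i (g K) (slice i y r))
        = indicator {s1<..<s} r * enorm (partial i (g K) (slice i y r))"
        using AE_lborel_singleton[of s1] AE_lborel_singleton[of s]
        by eventually_elim (auto simp: indicator_def)
    qed
    also have "\<dots> \<le> ?D"
    proof (rule nn_integral_mono)
      fix r
      show "indicator {s1<..<s} r * enorm (partial i (g K) (slice i y r)) \<le> indicator {s1<..<s} r * q r"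
      proof (cases "r \<in> {s1<..<s}")
        case True
        then have "slice i y r \<in> K" using inK[of r] interior_subset by auto
        then have "enorm (partial i (g K) (slice i y r))
          = indicator K (slice i y r) * enorm (partial i (g K) (slice i y r))" by simp
        also have "\<dots> \<le> q r" unfolding q_def by (rule member_le_sum[OF less.prems(1) _ finite_mesh]) simp
        finally show ?thesis by (simp add: mult_left_mono)
      qed simp
    qed
    finally show "enorm (g K (slice i y s) - g K ?p) \<le> ?D" .
  qed
  also have "\<dots> = (B s1 + ?D) + (\<Sum>E\<in>X s. c E)" by (simp add: add_ac)
  also have "B s1 + ?D
      = (\<integral>\<^sup>+r. indicator {..<s1} r * q r + indicator {s1<..<s} r * q r \<partial>lborel)"
    unfolding B_def by (rule nn_integral_add[symmetric]) measurable
  also have "\<dots> \<le> B s"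
    unfolding B_def using s1(2) by (intro nn_integral_mono) (auto simp: indicator_def)
  finally show ?case unfolding B_def q_def X_def by (simp add: add_right_mono)
qed

end

end

section \<open>Embedding of broken functions of bounded variation\<close>

text \<open>A name for the choice of end points made inside \<open>edge_integral\<close>, so that
  crossing points are parametrised by exactly the segment that is integrated over.\<close>

definition ends :: "(real^2) set \<Rightarrow> (real^2) \<times> (real^2)" where
  "ends E = (SOME (a, b). E = closed_segment a b)"

lemma edge_integral_ends:
  "edge_integral E f = dist (fst (ends E)) (snd (ends E)) *\<^sub>R
     (LINT s:{0..1}|lborel. f (linepath (fst (ends E)) (snd (ends E)) s))"
  by (simp add: edge_integral_def ends_def case_prod_unfold Let_def)

lemma ends_segment: "E = closed_segment a b \<Longrightarrow> E = closed_segment (fst (ends E)) (snd (ends E))"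
  using someI[of "\<lambda>(a, b). E = closed_segment a b" "(a, b)"]
  by (simp add: ends_def case_prod_unfold)

text \<open>The value of \<open>J\<close> where the edge meets the line on which coordinate
  \<open>l\<close> equals \<open>y\<close>. The default 0 covers lines that miss the edge and edges
  parallel to the line. As an explicit function of \<open>y\<close> it is visibly
  measurable.\<close>

definition crossval :: "(real^2 \<Rightarrow> real) \<Rightarrow> (real^2) set \<Rightarrow> 2 \<Rightarrow> real \<Rightarrow> real" where
  "crossval J E l y = (let a = fst (ends E); b = snd (ends E); t = (y - a $ l) / (b $ l - a $ l)
     in if a $ l \<noteq> b $ l \<and> t \<in> {0..1} then J (linepath a b t) else 0)"

text \<open>The substitution \<open>y = a $ l + (b $ l - a $ l) * t\<close> has a Jacobian bounded
  by the length of the edge: projection to an axis does not increase length.\<close>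

lemma crossval_integral:
  assumes J: "continuous_on UNIV J" "\<And>x. J x \<ge> 0"
  shows "(\<lambda>y. ennreal (crossval J E l y)) \<in> borel_measurable borel"
    "(\<integral>\<^sup>+y. ennreal (crossval J E l y) \<partial>lborel) \<le> ennreal (edge_integral E J)"
proof -
  define a b where ab: "a = fst (ends E)" "b = snd (ends E)"
  define h where "h t = ennreal (indicator {0..1} t *\<^sub>R J (linepath a b t))" for t
  have cJ: "continuous_on S (\<lambda>t. J (linepath a b t))" for S
    by (rule continuous_on_compose2[OF J(1)]) (auto intro: continuous_on_linepath)
  have int: "integrable lborel (\<lambda>t. indicator {0..1} t *\<^sub>R J (linepath a b t))"
    by (rule borel_integrable_compact) (auto intro: cJ)
  then have hm[measurable]: "h \<in> borel_measurable borel" unfolding h_def by measurable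
  have hint: "(\<integral>\<^sup>+t. h t \<partial>lborel) = ennreal (LINT t:{0..1}|lborel. J (linepath a b t))"
    unfolding h_def set_lebesgue_integral_def using J(2) by (intro nn_integral_eq_integral int) auto
  have EI: "edge_integral E J = dist a b * (LINT t:{0..1}|lborel. J (linepath a b t))"
    by (simp add: edge_integral_ends ab)
  have I0: "(LINT t:{0..1}|lborel. J (linepath a b t)) \<ge> 0"
    unfolding set_lebesgue_integral_def using J(2) by (intro integral_nonneg_AE) auto
  show "(\<lambda>y. ennreal (crossval J E l y)) \<in> borel_measurable borel"
  proof (cases "a $ l = b $ l")
    case False
    then have "(\<lambda>y. ennreal (crossval J E l y)) = (\<lambda>y. h ((y - a $ l) / (b $ l - a $ l)))"
      by (auto simp: crossval_def h_def ab Let_def indicator_def)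
    then show ?thesis by simp
  qed (simp add: crossval_def ab)
  show "(\<integral>\<^sup>+y. ennreal (crossval J E l y) \<partial>lborel) \<le> ennreal (edge_integral E J)"
  proof (cases "a $ l = b $ l")
    case False
    then have "(\<lambda>y. ennreal (crossval J E l y)) = (\<lambda>y. h ((y - a $ l) / (b $ l - a $ l)))"
      by (auto simp: crossval_def h_def ab Let_def indicator_def)
    then have "(\<integral>\<^sup>+y. ennreal (crossval J E l y) \<partial>lborel) = (\<integral>\<^sup>+y. h ((y - a $ l) / (b $ l - a $ l)) \<partial>lborel)"
      by simp
    also have "\<dots> = \<bar>b $ l - a $ l\<bar> * (\<integral>\<^sup>+t. h ((a $ l + (b $ l - a $ l) * t - a $ l) / (b $ l - a $ l)) \<partial>lborel)"
      by (rule nn_integral_real_affine) (use False in auto)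
    also have "\<dots> = \<bar>b $ l - a $ l\<bar> * (\<integral>\<^sup>+t. h t \<partial>lborel)"
      using False by simp
    also have "\<dots> \<le> ennreal (dist a b) * (\<integral>\<^sup>+t. h t \<partial>lborel)"
      using component_le_norm_cart[of "b - a" l]
      by (intro mult_right_mono ennreal_leI) (auto simp: dist_norm norm_minus_commute)
    also have "\<dots> = ennreal (edge_integral E J)"
      unfolding hint EI using I0 by (simp add: ennreal_mult)
    finally show ?thesis .
  qed (simp add: crossval_def ab)
qed

lemma edge_integral_nonneg:
  fixes J :: "real^2 \<Rightarrow> real"
  assumes "\<And>x. J x \<ge> 0" shows "edge_integral E J \<ge> 0"
  unfolding edge_integral_ends set_lebesgue_integral_def using assms by (auto intro!: mult_nonneg_nonneg integral_nonneg_AE)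

lemma set_integral_nonneg:
  fixes J :: "'a \<Rightarrow> real"
  assumes "\<And>x. J x \<ge> 0" shows "(LINT x:A|M. J x) \<ge> 0"
  unfolding set_lebesgue_integral_def using assms by (auto intro!: integral_nonneg_AE)

context dg_mesh
begin

lemma nn_integral_interior:
  assumes "K \<in> \<K>" "continuous_on UNIV h" "\<And>x. h x \<ge> 0"
  shows "(\<integral>\<^sup>+x. indicator (interior K) x * ennreal (h x) \<partial>lborel) = ennreal (LINT x:K|lebesgue. h x)"
    "(\<integral>\<^sup>+x. indicator K x * ennreal (h x) \<partial>lborel) = ennreal (LINT x:K|lebesgue. h x)"
proof -
  note tf = triangle_facts[OF simplex[OF assms(1)]]
  have ch: "continuous_on S h" for S using assms(2) continuous_on_subset by blast
  have fr: "frontier K \<in> null_sets lborel"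
    using tf(9) by (simp add: negligible_iff_null_sets null_sets_completion_iff)
  have int: "integrable lborel (\<lambda>x. indicator K x *\<^sub>R h x)"
    by (rule borel_integrable_compact[OF tf(2) ch])
  have "(\<integral>\<^sup>+x. indicator K x * ennreal (h x) \<partial>lborel) = (\<integral>\<^sup>+x. ennreal (indicator K x *\<^sub>R h x) \<partial>lborel)"
    by (intro nn_integral_cong) (simp add: indicator_def)
  also have "\<dots> = ennreal (LINT x:K|lborel. h x)"
    unfolding set_lebesgue_integral_def using assms(3) by (intro nn_integral_eq_integral int) auto
  also have "\<dots> = ennreal (LINT x:K|lebesgue. h x)"
    by (simp add: compact_integrable(3)[OF tf(2) ch])
  finally show *: "(\<integral>\<^sup>+x. indicator K x * ennreal (h x) \<partial>lborel) = ennreal (LINT x:K|lebesgue. h x)" .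
  have "(\<integral>\<^sup>+x. indicator (interior K) x * ennreal (h x) \<partial>lborel) = (\<integral>\<^sup>+x. indicator K x * ennreal (h x) \<partial>lborel)"
  proof (rule nn_integral_cong_AE)
    show "AE x in lborel. indicator (interior K) x * ennreal (h x) = indicator K x * ennreal (h x)"
      using AE_not_in[OF fr]
    proof eventually_elim
      case (elim x)
      then have "x \<in> interior K \<longleftrightarrow> x \<in> K"
        using tf(3) interior_subset by (auto simp: frontier_def)
      then show ?case by (simp add: indicator_def)
    qed
  qed
  with * show "(\<integral>\<^sup>+x. indicator (interior K) x * ennreal (h x) \<partial>lborel) = ennreal (LINT x:K|lebesgue. h x)" by simp
qed

lemma elem1_mesh: "E \<in> \<E> \<Longrightarrow> elem1 \<K> n E \<in> \<K>"
  and elem1_edge: "E \<in> \<E> \<Longrightarrow> E edge_of elem1 \<K> n E"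
  using elem1_side unfolding side_def by auto

lemma elem2_mesh: "E \<in> \<E> \<Longrightarrow> \<not> outer E \<Longrightarrow> elem2 \<K> n E \<in> \<K>"
  and elem2_edge: "E \<in> \<E> \<Longrightarrow> \<not> outer E \<Longrightarrow> E edge_of elem2 \<K> n E"
  using elem2_side unfolding side_def by auto

lemma continuous_on_pjump:
  assumes "\<And>K. K \<in> \<K> \<Longrightarrow> continuous_on UNIV (g K)" "E \<in> \<E>"
  shows "continuous_on UNIV (pjump g E)"
  unfolding pjump_def[abs_def] using assms elem1_mesh[OF assms(2)] elem2_mesh[OF assms(2)]
  by (cases "outer E") (auto intro!: continuous_on_diff)

lemma edge_ends:
  assumes "E \<in> \<E>"
  shows "E = closed_segment (fst (ends E)) (snd (ends E))"
    "fst (ends E) \<in> vertices" "snd (ends E) \<in> vertices" "fst (ends E) \<noteq> snd (ends E)"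
proof -
  obtain a b where ab: "a \<noteq> b" "E = closed_segment a b" "a \<in> vertices" "b \<in> vertices"
    using edge_closed_segment[OF assms] by blast
  show s: "E = closed_segment (fst (ends E)) (snd (ends E))" using ends_segment[OF ab(2)] .
  then have "{fst (ends E), snd (ends E)} = {a, b}" using ab(2) closed_segment_eq by metis
  then show "fst (ends E) \<in> vertices" "snd (ends E) \<in> vertices" "fst (ends E) \<noteq> snd (ends E)"
    using ab by (auto simp: doubleton_eq_iff)
qed

text \<open>An upper bound of the variation in direction \<open>i\<close>: the jump term carries the
  full length of the edge and not its projection.\<close>

definition total_var :: "((real^2) set \<Rightarrow> real^2 \<Rightarrow> complex) \<Rightarrow> 2 \<Rightarrow> real" where
  "total_var g i = (\<Sum>K\<in>\<K>. LINT x:K|lebesgue. cmod (partial i (g K) x))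
     + (\<Sum>E\<in>\<E>. edge_integral E (\<lambda>x. cmod (pjump g E x)))"

text \<open>The bound from \<open>slice_bound\<close> with the restriction to parameters before
  \<open>s\<close> dropped. It depends on \<open>y\<close> alone, and this independence of
  \<open>s\<close> is what the Gagliardo argument needs.\<close>

definition slice_var :: "((real^2) set \<Rightarrow> real^2 \<Rightarrow> complex) \<Rightarrow> 2 \<Rightarrow> 2 \<Rightarrow> real \<Rightarrow> ennreal" where
  "slice_var g i l y = (\<integral>\<^sup>+s. (\<Sum>K\<in>\<K>. indicator K (slice i y s) * enorm (partial i (g K) (slice i y s))) \<partial>lborel)
     + (\<Sum>E\<in>\<E>. ennreal (crossval (\<lambda>x. cmod (pjump g E x)) E l y))"

lemma slice_var_bound:
  assumes g: "\<And>K. K \<in> \<K> \<Longrightarrow> g K \<in> Poly m" and il: "l \<noteq> i"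
    and gen: "\<And>v. v \<in> vertices \<Longrightarrow> v $ l \<noteq> y"
    and K: "K \<in> \<K>" "slice i y s \<in> interior K"
  shows "enorm (g K (slice i y s)) \<le> slice_var g i l y"
proof -
  define c where "c E = ennreal (crossval (\<lambda>x. cmod (pjump g E x)) E l y)" for E
  have cE: "enorm (pjump g E (slice i y s)) \<le> c E" if E: "E \<in> \<E>" "slice i y s \<in> E" for E s
  proof -
    note p = edge_crossing_param[OF il gen E edge_ends(1,2)[OF E(1)]]
    show ?thesis unfolding c_def crossval_def Let_def using p by simp
  qed
  have "enorm (g K (slice i y s)) \<le>
    (\<integral>\<^sup>+r. indicator {..<s} r * (\<Sum>K\<in>\<K>. indicator K (slice i y r) * enorm (partial i (g K) (slice i y r))) \<partial>lborel)
    + (\<Sum>E\<in>{E\<in>\<E>. \<exists>r<s. slice i y r \<in> E}. c E)"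
    by (rule slice_bound[OF il gen g cE K])
  also have "\<dots> \<le> slice_var g i l y"
    unfolding slice_var_def c_def[symmetric]
    by (intro add_mono nn_integral_mono sum_mono2 finite_edges) (auto simp: indicator_def)
  finally show ?thesis .
qed

lemma slice_var_integral:
  assumes g: "\<And>K. K \<in> \<K> \<Longrightarrow> g K \<in> Poly m"
  shows "slice_var g i l \<in> borel_measurable borel"
    "(\<integral>\<^sup>+y. slice_var g i l y \<partial>lborel) \<le> ennreal (total_var g i)"
proof -
  have cp: "continuous_on S (partial i (g K))" if "K \<in> \<K>" for K S
    by (rule continuous_on_Poly[OF Poly_has_derivative(2)[OF g[OF that]]])
  have cj: "continuous_on UNIV (\<lambda>x. cmod (pjump g E x))" if "E \<in> \<E>" for E
    by (intro continuous_on_norm continuous_on_pjump that continuous_on_Poly[OF g])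
  let ?f = "\<lambda>x. \<Sum>K\<in>\<K>. indicator K x * enorm (partial i (g K) x)"
  have km: "(\<lambda>x. indicator K x * enorm (partial i (g K) x)) \<in> borel_measurable borel" if "K \<in> \<K>" for K
  proof -
    have [measurable]: "K \<in> sets borel" "partial i (g K) \<in> borel_measurable borel"
      using triangle_facts(3)[OF simplex[OF that]] borel_measurable_continuous_onI[OF cp[OF that]] by auto
    show ?thesis by measurable
  qed
  then have fm: "?f \<in> borel_measurable borel" by (rule borel_measurable_sum)
  note sl = nn_integral_slice[OF fm, of i]
  have cm: "(\<lambda>y. ennreal (crossval (\<lambda>x. cmod (pjump g E x)) E l y)) \<in> borel_measurable borel" if "E \<in> \<E>" for E
    by (rule crossval_integral(1)[OF cj[OF that]]) simp
  show "slice_var g i l \<in> borel_measurable borel"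
    unfolding slice_var_def[abs_def] by (intro borel_measurable_add sl(2) borel_measurable_sum cm)
  have "(\<integral>\<^sup>+y. slice_var g i l y \<partial>lborel) = (\<integral>\<^sup>+x. ?f x \<partial>lborel)
      + (\<integral>\<^sup>+y. (\<Sum>E\<in>\<E>. ennreal (crossval (\<lambda>x. cmod (pjump g E x)) E l y)) \<partial>lborel)"
    unfolding slice_var_def sl(1) using sl(2) cm by (intro nn_integral_add) (auto intro!: borel_measurable_sum)
  also have "\<dots> = (\<Sum>K\<in>\<K>. \<integral>\<^sup>+x. indicator K x * enorm (partial i (g K) x) \<partial>lborel)
      + (\<Sum>E\<in>\<E>. \<integral>\<^sup>+y. ennreal (crossval (\<lambda>x. cmod (pjump g E x)) E l y) \<partial>lborel)"
    using km cm by (subst (1 2) nn_integral_sum) auto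
  also have "\<dots> \<le> (\<Sum>K\<in>\<K>. ennreal (LINT x:K|lebesgue. cmod (partial i (g K) x)))
      + (\<Sum>E\<in>\<E>. ennreal (edge_integral E (\<lambda>x. cmod (pjump g E x))))"
    using nn_integral_interior(2) cp by (intro add_mono sum_mono crossval_integral(2) cj) (auto simp: continuous_on_norm)
  also have "\<dots> = ennreal (total_var g i)"
    unfolding total_var_def
    by (simp add: sum_ennreal edge_integral_nonneg set_integral_nonneg sum_nonneg ennreal_plus)
  finally show "(\<integral>\<^sup>+y. slice_var g i l y \<partial>lborel) \<le> ennreal (total_var g i)" .
qed

text \<open>The Gagliardo argument: the value at a point is bounded by the variation along the horizontal
  and along the vertical line through it.\<close>
theorem broken_BV_embedding:
  assumes g: "\<And>K. K \<in> \<K> \<Longrightarrow> g K \<in> Poly m"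
  shows "(\<Sum>K\<in>\<K>. LINT x:K|lebesgue. (cmod (g K x))\<^sup>2) \<le> total_var g 1 * total_var g 2"
proof -
  define F where "F x = (\<Sum>K\<in>\<K>. indicator (interior K) x * ennreal ((cmod (g K x))\<^sup>2))" for x
  have cg: "continuous_on UNIV (\<lambda>x. (cmod (g K x))\<^sup>2)" if "K \<in> \<K>" for K
    by (intro continuous_intros continuous_on_Poly[OF g[OF that]])
  have km: "(\<lambda>x. indicator (interior K) x * ennreal ((cmod (g K x))\<^sup>2)) \<in> borel_measurable borel" if "K \<in> \<K>" for K
  proof -
    have [measurable]: "(\<lambda>x. (cmod (g K x))\<^sup>2) \<in> borel_measurable borel"
      by (rule borel_measurable_continuous_onI[OF cg[OF that]])
    show ?thesis by measurable
  qed
  have Fm: "F \<in> borel_measurable borel" unfolding F_def by (rule borel_measurable_sum[OF km])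
  \<comment> \<open>One factor of the square is estimated along each direction, the same point being
    read as a horizontal and as a vertical slice. The product separates the variables, so the double
    integral factors.\<close>
  have Fb: "F (slice 1 y s) \<le> slice_var g 1 2 y * slice_var g 2 1 s"
    if gen: "y \<notin> (\<lambda>v. v $ 2) ` vertices" "s \<notin> (\<lambda>v. v $ 1) ` vertices" for y s
  proof (cases "\<exists>K\<in>\<K>. slice 1 y s \<in> interior K")
    case True
    then obtain K where K: "K \<in> \<K>" "slice 1 y s \<in> interior K" by blast
    have sl: "slice 1 y s = slice 2 s y" by (simp add: vec_eq_iff slice_nth forall_2)
    have "F (slice 1 y s) = (\<Sum>K'\<in>{K}. indicator (interior K') (slice 1 y s) * ennreal ((cmod (g K' (slice 1 y s)))\<^sup>2))"
      unfolding F_def using K finite_mesh mesh_eqI[OF K(1) _ K(2)] interior_subset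
      by (intro sum.mono_neutral_right) (auto simp: indicator_def)
    also have "\<dots> = enorm (g K (slice 1 y s)) * enorm (g K (slice 2 s y))"
      using K(2) by (simp add: power2_eq_square ennreal_mult sl)
    also have "\<dots> \<le> slice_var g 1 2 y * slice_var g 2 1 s"
      using gen K by (intro mult_mono slice_var_bound[OF g]) (auto simp: sl)
    finally show ?thesis .
  next
    case False
    then have "F (slice 1 y s) = 0" unfolding F_def by (auto simp: indicator_def)
    then show ?thesis by simp
  qed
  have fin: "AE z in lborel. z \<notin> (\<lambda>v. v $ l) ` vertices" for l :: 2
    by (rule AE_not_in[OF finite_imp_null_set_lborel]) (simp add: finite_vertices)
  note sv = slice_var_integral[OF g]
  have "ennreal (\<Sum>K\<in>\<K>. LINT x:K|lebesgue. (cmod (g K x))\<^sup>2) = (\<Sum>K\<in>\<K>. \<integral>\<^sup>+x. indicator (interior K) x * ennreal ((cmod (g K x))\<^sup>2) \<partial>lborel)"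
  proof -
    have "(\<Sum>K\<in>\<K>. \<integral>\<^sup>+x. indicator (interior K) x * ennreal ((cmod (g K x))\<^sup>2) \<partial>lborel)
      = (\<Sum>K\<in>\<K>. ennreal (LINT x:K|lebesgue. (cmod (g K x))\<^sup>2))"
      by (intro sum.cong refl nn_integral_interior(1) cg) auto
    also have "\<dots> = ennreal (\<Sum>K\<in>\<K>. LINT x:K|lebesgue. (cmod (g K x))\<^sup>2)"
      by (intro sum_ennreal set_integral_nonneg) simp
    finally show ?thesis by simp
  qed
  also have "\<dots> = (\<integral>\<^sup>+x. F x \<partial>lborel)"
    unfolding F_def using km by (subst nn_integral_sum) auto
  also have "\<dots> = (\<integral>\<^sup>+y. \<integral>\<^sup>+s. F (slice 1 y s) \<partial>lborel \<partial>lborel)"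
    by (rule nn_integral_slice(1)[OF Fm])
  also have "\<dots> \<le> (\<integral>\<^sup>+y. \<integral>\<^sup>+s. slice_var g 1 2 y * slice_var g 2 1 s \<partial>lborel \<partial>lborel)"
  proof (rule nn_integral_mono_AE)
    show "AE y in lborel. (\<integral>\<^sup>+s. F (slice 1 y s) \<partial>lborel) \<le> (\<integral>\<^sup>+s. slice_var g 1 2 y * slice_var g 2 1 s \<partial>lborel)"
      using fin[of 2]
    proof eventually_elim
      case (elim y)
      show ?case
      proof (rule nn_integral_mono_AE)
        show "AE s in lborel. F (slice 1 y s) \<le> slice_var g 1 2 y * slice_var g 2 1 s"
          using fin[of 1] by eventually_elim (rule Fb[OF elim])
      qed
    qed
  qed
  also have "\<dots> = (\<integral>\<^sup>+y. slice_var g 1 2 y \<partial>lborel) * (\<integral>\<^sup>+s. slice_var g 2 1 s \<partial>lborel)"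
    using sv(1) by (simp add: nn_integral_cmult nn_integral_multc)
  also have "\<dots> \<le> ennreal (total_var g 1) * ennreal (total_var g 2)"
    by (intro mult_mono sv(2)) auto
  also have "\<dots> = ennreal (total_var g 1 * total_var g 2)"
    by (subst ennreal_mult) (auto simp: total_var_def intro!: add_nonneg_nonneg sum_nonneg edge_integral_nonneg set_integral_nonneg)
  finally show ?thesis
    by (subst (asm) ennreal_le_iff) (auto simp: total_var_def intro!: mult_nonneg_nonneg add_nonneg_nonneg sum_nonneg edge_integral_nonneg set_integral_nonneg)
qed

end

section \<open>Discrete Gagliardo--Nirenberg inequalities\<close>

text \<open>Factor out \<open>a - b\<close>; each of the \<open>Suc j\<close> remaining products is
  at most the \<open>j\<close>-th power of the larger modulus.\<close>

lemma norm_power_diff_le: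
  fixes a b :: complex
  shows "cmod (a ^ Suc j - b ^ Suc j) \<le> cmod (a - b) * (real (Suc j) * (cmod a ^ j + cmod b ^ j))"
proof -
  have t: "cmod (b ^ (Suc j - Suc i) * a ^ i) \<le> cmod a ^ j + cmod b ^ j" if "i < Suc j" for i
  proof -
    let ?m = "max (cmod a) (cmod b)"
    have "?m \<ge> 0" by (simp add: le_max_iff_disj)
    then have "cmod (b ^ (Suc j - Suc i) * a ^ i) \<le> ?m ^ (Suc j - Suc i) * ?m ^ i"
      unfolding norm_mult norm_power by (intro mult_mono power_mono zero_le_power) auto
    also have "\<dots> = ?m ^ j" using that by (simp add: power_add[symmetric])
    also have "\<dots> \<le> cmod a ^ j + cmod b ^ j" by (simp add: max_def)
    finally show ?thesis .
  qed
  have "cmod (a ^ Suc j - b ^ Suc j) = cmod (a - b) * cmod (\<Sum>i<Suc j. b ^ (Suc j - Suc i) * a ^ i)"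
    unfolding power_diff_sumr2 norm_mult ..
  also have "\<dots> \<le> cmod (a - b) * (\<Sum>i<Suc j. cmod a ^ j + cmod b ^ j)"
    by (intro mult_left_mono order_trans[OF norm_sum] sum_mono t) auto
  finally show ?thesis by simp
qed

lemma diameter_closed_segment: "diameter (closed_segment a b) = dist a b" for a b :: "'a::euclidean_space"
proof (rule antisym)
  have "norm (x - y) \<le> dist a b" if "x \<in> closed_segment a b" "y \<in> closed_segment a b" for x y
  proof -
    have "norm (x - y) \<le> norm (a - y) \<or> norm (x - y) \<le> norm (b - y)"
      using segment_furthest_le[OF that(1), of y] by (simp add: norm_minus_commute)
    then show ?thesis using dist_in_closed_segment[OF that(2)] by (auto simp: dist_norm norm_minus_commute)
  qed
  then show "diameter (closed_segment a b) \<le> dist a b" by (intro diameter_le) auto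
  show "dist a b \<le> diameter (closed_segment a b)"
    by (rule diameter_bounded_bound) (auto intro: compact_imp_bounded)
qed

text \<open>The choice \<open>e = 2 * Y / B\<close> gives the claim, and \<open>Y = 0\<close>
  contradicts \<open>B > 0\<close> for a small \<open>e\<close>. It turns a family of Young bounds
  back into a product estimate.\<close>

lemma le_young_imp_power2_le:
  fixes B X Y :: real
  assumes "B \<ge> 0" "X \<ge> 0" "Y \<ge> 0" and b: "\<And>e. e > 0 \<Longrightarrow> B \<le> e * X + Y / e"
  shows "B\<^sup>2 \<le> 4 * X * Y"
proof (cases "B = 0")
  case False
  then have B: "B > 0" using assms by simp
  have Y: "Y > 0"
  proof (rule ccontr)
    assume "\<not> Y > 0"
    then have "Y = 0" using assms by simp
    then have "B \<le> B / (2 * (X + 1)) * X" using b[of "B / (2 * (X + 1))"] B assms by simp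
    also have "\<dots> = B * (X / (2 * (X + 1)))" by simp
    also have "\<dots> < B * 1" using B assms by (intro mult_strict_left_mono) (auto simp: field_simps)
    finally show False by simp
  qed
  have "B \<le> 2 * Y / B * X + B / 2" using b[of "2 * Y / B"] B Y by simp
  then have "B / 2 \<le> 2 * Y / B * X" by simp
  then show ?thesis using B by (simp add: field_simps power2_eq_square)
qed (use assms in auto)

lemma continuous_linepath: "continuous_on UNIV f \<Longrightarrow> continuous_on S (\<lambda>s. f (linepath a b s))"
  for f :: "real^2 \<Rightarrow> 'a::topological_space"
  by (rule continuous_on_compose2[of UNIV]) (auto intro: continuous_on_linepath)

lemma edge_integrable:
  fixes f :: "real^2 \<Rightarrow> 'a::{banach, second_countable_topology}"
  shows "continuous_on UNIV f \<Longrightarrow> set_integrable lborel {0..1} (\<lambda>s. f (linepath a b s))"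
  by (rule compact_integrable(1)) (auto intro: continuous_linepath)

lemma edge_integral_add:
  fixes f g :: "real^2 \<Rightarrow> 'a::{banach, second_countable_topology}"
  assumes "continuous_on UNIV f" "continuous_on UNIV g"
  shows "edge_integral E (\<lambda>x. f x + g x) = edge_integral E f + edge_integral E g"
  unfolding edge_integral_ends
  by (subst set_integral_add(2)) (auto intro: edge_integrable assms simp: scaleR_add_right)

lemma edge_integral_cmult:
  fixes f :: "real^2 \<Rightarrow> 'a::{real_normed_field, banach, second_countable_topology}"
  shows "edge_integral E (\<lambda>x. c * f x) = c * edge_integral E f"
  unfolding edge_integral_ends by (simp add: scaleR_conv_of_real)

lemma edge_integral_sum:
  fixes f :: "'i \<Rightarrow> real^2 \<Rightarrow> 'a::{banach, second_countable_topology}"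
  assumes "\<And>i. i \<in> I \<Longrightarrow> continuous_on UNIV (f i)"
  shows "edge_integral E (\<lambda>x. \<Sum>i\<in>I. f i x) = (\<Sum>i\<in>I. edge_integral E (f i))"
  unfolding edge_integral_ends
  by (subst set_integral_sum) (auto intro: edge_integrable assms simp: scaleR_sum_right)

lemma edge_integral_mono:
  fixes f g :: "real^2 \<Rightarrow> real"
  assumes "continuous_on UNIV f" "continuous_on UNIV g" "\<And>x. f x \<le> g x"
  shows "edge_integral E f \<le> edge_integral E g"
  unfolding edge_integral_ends real_scaleR_def
  by (intro mult_left_mono set_integral_mono edge_integrable assms) auto

text \<open>Faces are convex hulls of subsets of the three vertices; counting all
  \<open>2 ^ 3\<close> subsets is crude but independent of the mesh.\<close>

lemma card_edges_le:
  assumes "2 simplex K" shows "card {E. E edge_of K} \<le> 8"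
proof -
  obtain C where C: "\<not> affine_dependent C" "card C = 3" "K = convex hull C"
    using assms unfolding simplex_def by auto
  have f: "finite C" using C(2) card_ge_0_finite by force
  have sub: "{E. E edge_of K} \<subseteq> (\<lambda>c. convex hull c) ` Pow C"
    using C(1,3) by (auto simp: edge_of_def face_of_convex_hull_affine_independent)
  have "card {E. E edge_of K} \<le> card ((\<lambda>c. convex hull c) ` Pow C)"
    using f by (intro card_mono sub) simp
  also have "\<dots> \<le> card (Pow C)" using f by (intro card_image_le) simp
  also have "\<dots> = 8" using f C(2) by (simp add: card_Pow)
  finally show ?thesis .
qed

context dg_mesh
begin

lemma edge_integral_cong:
  assumes "E \<in> \<E>" "\<And>x. x \<in> E \<Longrightarrow> f x = g x"
  shows "edge_integral E f = edge_integral E g"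
proof -
  have "f (linepath (fst (ends E)) (snd (ends E)) s) = g (linepath (fst (ends E)) (snd (ends E)) s)" if "s \<in> {0..1}" for s
    using assms(2) edge_ends(1)[OF assms(1)] linepath_in_path[OF that] by metis
  then show ?thesis
    unfolding edge_integral_ends
    by (intro arg_cong2[where f = scaleR] refl set_lebesgue_integral_cong) auto
qed

lemma edge_diameter:
  assumes "E \<in> \<E>"
  shows "diameter E = dist (fst (ends E)) (snd (ends E))" "diameter E > 0"
proof -
  show "diameter E = dist (fst (ends E)) (snd (ends E))"
    using edge_ends(1)[OF assms] diameter_closed_segment by metis
  then show "diameter E > 0" using edge_ends(4)[OF assms] by simp
qed

lemma mesh_size_ge: "K \<in> \<K> \<Longrightarrow> diameter K \<le> mesh_size \<K>"
  unfolding mesh_size_def using finite_mesh by simp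

text \<open>Every point of the edge lies within one mesh size of the centre \<open>z\<close> of a
  disc inside \<open>K\<close>, so the pointwise inverse estimate applies to it. The factor
  \<open>diameter E\<close> occurs twice, once through arc length, and is at most the mesh size.
  Quasi-uniformity enters through the radius of the disc.\<close>

lemma trace_inverse_estimate:
  assumes K: "K \<in> \<K>" "E edge_of K" and z: "cball z (\<sigma> * mesh_size \<K>) \<subseteq> K" "\<sigma> > 0"
    and C: "C > 0" "\<And>z h x. x \<in> cball z h \<Longrightarrow> 0 < h \<Longrightarrow>
      h\<^sup>2 * (cmod (q x))\<^sup>2 \<le> C * (LINT y:cball z (\<sigma> * h)|lebesgue. (cmod (q y))\<^sup>2)"
    and q: "continuous_on UNIV q"
  shows "diameter E * edge_integral E (\<lambda>x. (cmod (q x))\<^sup>2) \<le> C * (LINT x:K|lebesgue. (cmod (q x))\<^sup>2)"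
proof -
  note tf = triangle_facts[OF simplex[OF K(1)]]
  have E: "E \<in> \<E>" using K unfolding edges_def by blast
  define h where "h = mesh_size \<K>"
  have bK: "bounded K" using tf(2) by (rule compact_imp_bounded)
  have EK: "E \<subseteq> K" using K(2) edge_of_imp_subset by blast
  have "diameter E \<le> diameter K" by (rule diameter_subset[OF EK bK])
  then have dh: "diameter E \<le> h" using mesh_size_ge[OF K(1)] by (simp add: h_def)
  then have h: "h > 0" using edge_diameter(2)[OF E] by simp
  have cq: "continuous_on S (\<lambda>x. (cmod (q x))\<^sup>2)" for S
    by (intro continuous_intros continuous_on_subset[OF q]) simp
  define M where "M = C * (LINT x:K|lebesgue. (cmod (q x))\<^sup>2)"
  have zK: "z \<in> K" using z h by (auto simp: h_def)
  have bd: "h\<^sup>2 * (cmod (q x))\<^sup>2 \<le> M" if "x \<in> E" for x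
  proof -
    have "dist z x \<le> h"
      using diameter_bounded_bound[OF bK zK] that EK mesh_size_ge[OF K(1)] by (force simp: h_def)
    then have "h\<^sup>2 * (cmod (q x))\<^sup>2 \<le> C * (LINT y:cball z (\<sigma> * h)|lebesgue. (cmod (q y))\<^sup>2)"
      using C(2)[of x z h] h by simp
    also have "\<dots> \<le> M"
    proof -
      have "(LINT y:cball z (\<sigma> * h)|lebesgue. (cmod (q y))\<^sup>2) \<le> (LINT x:K|lebesgue. (cmod (q x))\<^sup>2)"
        unfolding set_lebesgue_integral_def
        using compact_integrable(2)[OF _ cq, of "cball z (\<sigma> * h)"] compact_integrable(2)[OF tf(2) cq] z(1)
        by (intro integral_mono) (auto simp: set_integrable_def indicator_def h_def)
      then show ?thesis unfolding M_def using C(1) by (simp add: mult_left_mono)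
    qed
    finally show ?thesis .
  qed
  let ?d = "diameter E" and ?l = "linepath (fst (ends E)) (snd (ends E))"
  have "?d * edge_integral E (\<lambda>x. (cmod (q x))\<^sup>2) = (LINT s:{0..1}|lborel. ?d\<^sup>2 * (cmod (q (?l s)))\<^sup>2)"
    unfolding edge_integral_ends edge_diameter(1)[OF E, symmetric] by (simp add: power2_eq_square)
  also have "\<dots> \<le> (LINT s:{0..1::real}|lborel. M)"
  proof (rule set_integral_mono)
    show "set_integrable lborel {0..1} (\<lambda>s. ?d\<^sup>2 * (cmod (q (?l s)))\<^sup>2)"
      by (intro set_integrable_mult_right impI edge_integrable[of "\<lambda>x. (cmod (q x))\<^sup>2"] cq)
    show "set_integrable lborel {0..1::real} (\<lambda>s. M)"
      by (rule compact_integrable(1)) auto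
    fix s :: real assume s: "s \<in> {0..1}"
    have "?l s \<in> E" using edge_ends(1)[OF E] linepath_in_path[OF s] by metis
    then have "h\<^sup>2 * (cmod (q (?l s)))\<^sup>2 \<le> M" by (rule bd)
    moreover have "?d\<^sup>2 * (cmod (q (?l s)))\<^sup>2 \<le> h\<^sup>2 * (cmod (q (?l s)))\<^sup>2"
      using dh edge_diameter(2)[OF E] by (intro mult_right_mono power_mono) auto
    ultimately show "?d\<^sup>2 * (cmod (q (?l s)))\<^sup>2 \<le> M" by linarith
  qed
  also have "\<dots> = M" by (simp add: set_integral_const)
  finally show ?thesis unfolding M_def .
qed

text \<open>Element polynomials taken as functions on the whole plane. Traces, jumps and integrals
  are rewritten in terms of them, so that the arbitrary values of \<open>v\<close> on edges
  disappear.\<close>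

definition pieces :: "nat \<Rightarrow> (real^2 \<Rightarrow> complex) \<Rightarrow> ((real^2) set \<Rightarrow> real^2 \<Rightarrow> complex) \<Rightarrow> bool" where
  "pieces m v p \<longleftrightarrow> (\<forall>K\<in>\<K>. p K \<in> Poly m \<and> (\<forall>x\<in>interior K. v x = p K x))"

lemma DG_pieces: "v \<in> V\<^sub>h k \<Longrightarrow> \<exists>p. pieces k v p"
  unfolding DG_space_def pieces_def by (auto intro!: bchoice)

text \<open>The squared DG norm read on element polynomials; see
  \<open>DG_norm_pieces\<close>.\<close>

definition broken_energy :: "((real^2) set \<Rightarrow> real^2 \<Rightarrow> complex) \<Rightarrow> real" where
  "broken_energy p = (\<Sum>K\<in>\<K>. LINT x:K|lebesgue. (\<Sum>i\<in>UNIV. (cmod (partial i (p K) x))\<^sup>2))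
     + (\<Sum>E\<in>\<E>. 1 / diameter E * edge_integral E (\<lambda>x. (cmod (pjump p E x))\<^sup>2))"

text \<open>Young's inequality weighted by \<open>diameter E\<close>: the first term is the jump
  part of the DG norm, and the second has the scaling that \<open>trace_inverse_estimate\<close>
  turns into a volume integral.\<close>

lemma pjump_power_bound:
  assumes E: "E \<in> \<E>" and "e > 0"
  shows "cmod (pjump (\<lambda>K x. p K x ^ Suc j) E x) \<le> 1 / (2 * e) * (1 / diameter E * (cmod (pjump p E x))\<^sup>2)
     + e * (real (Suc j))\<^sup>2 * (diameter E * (\<Sum>K\<in>{K\<in>\<K>. E edge_of K}. (cmod (p K x ^ j))\<^sup>2))"
proof -
  let ?d = "diameter E" and ?N = "{K\<in>\<K>. E edge_of K}"
  let ?S = "\<Sum>K\<in>?N. (cmod (p K x ^ j))\<^sup>2"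
  have d: "?d > 0" by (rule edge_diameter(2)[OF E])
  have fN: "finite ?N" using finite_mesh by simp
  define K1 K2 where "K1 = elem1 \<K> n E" and "K2 = elem2 \<K> n E"
  have K1: "K1 \<in> ?N" using elem1_mesh[OF E] elem1_edge[OF E] by (simp add: K1_def)
  \<comment> \<open>\<open>B\<close> is the sum of the \<open>j\<close>-th powers of the moduli from
    the adjacent elements; \<open>norm_power_diff_le\<close> shows that it relates the jump of the
    power to the jump of \<open>p\<close>.\<close>
  have "\<exists>B\<ge>0. cmod (pjump (\<lambda>K x. p K x ^ Suc j) E x) \<le> cmod (pjump p E x) * (real (Suc j) * B) \<and> B\<^sup>2 \<le> 2 * ?S"
  proof (cases "outer E")
    case True
    let ?a = "cmod (p K1 x)"
    have "?a ^ Suc j \<le> ?a * (real (Suc j) * ?a ^ j)"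
      using mult_right_mono[of 1 "real (Suc j)" "?a ^ Suc j"] by (simp add: mult_ac)
    moreover have "(?a ^ j)\<^sup>2 \<le> 2 * ?S"
    proof -
      have "(cmod (p K1 x ^ j))\<^sup>2 \<le> ?S" by (rule member_le_sum[OF K1 _ fN]) simp
      moreover have "?S \<ge> 0" by (intro sum_nonneg) simp
      ultimately show ?thesis by (simp add: norm_power)
    qed
    ultimately show ?thesis
      using True by (intro exI[of _ "?a ^ j"]) (simp add: pjump_def K1_def norm_power norm_mult)
  next
    case False
    let ?a = "cmod (p K1 x)" and ?b = "cmod (p K2 x)"
    have K2: "K2 \<in> ?N" using elem2_mesh[OF E False] elem2_edge[OF E False] by (simp add: K2_def)
    \<comment> \<open>Distinctness makes the two sides separate terms of the sum over adjacent
      elements.\<close>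
    have ne: "K1 \<noteq> K2"
    proof
      assume "K1 = K2"
      then have po: "points_out (n E) E K1" "points_out (- n E) E K1"
        using elem1_side[OF E] elem2_side[OF E False] by (auto simp: side_def K1_def K2_def)
      obtain x y where "x \<in> E" "y \<in> interior K1"
        using edge_ends(1)[OF E] triangle_facts(7)[OF simplex] K1 by (metis (no_types, lifting) ends_in_segment(1) ex_in_conv mem_Collect_eq)
      then show False using po unfolding points_out_def by (metis inner_minus_left neg_less_0_iff_less not_less_iff_gr_or_eq)
    qed
    have "(?a ^ j + ?b ^ j)\<^sup>2 \<le> 2 * ((?a ^ j)\<^sup>2 + (?b ^ j)\<^sup>2)"
      using sum_squares_bound[of "?a ^ j" "?b ^ j"] by (simp add: power2_sum)
    also have "(?a ^ j)\<^sup>2 + (?b ^ j)\<^sup>2 = (\<Sum>K\<in>{K1, K2}. (cmod (p K x ^ j))\<^sup>2)"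
      using ne by (simp add: norm_power)
    also have "\<dots> \<le> ?S" using K1 K2 by (intro sum_mono2 fN) auto
    finally have "(?a ^ j + ?b ^ j)\<^sup>2 \<le> 2 * ?S" by simp
    then show ?thesis
      using False norm_power_diff_le[of "p K1 x" j "p K2 x"]
      by (intro exI[of _ "?a ^ j + ?b ^ j"]) (simp add: pjump_def K1_def K2_def)
  qed
  then obtain B where B: "cmod (pjump (\<lambda>K x. p K x ^ Suc j) E x) \<le> cmod (pjump p E x) * (real (Suc j) * B)" "B\<^sup>2 \<le> 2 * ?S"
    by blast
  let ?a = "cmod (pjump p E x)" and ?c = "real (Suc j)"
  have "0 \<le> (?a - e * ?d * ?c * B)\<^sup>2 / (2 * e * ?d)" using assms d by simp
  also have "\<dots> = 1 / (2 * e) * (1 / ?d * ?a\<^sup>2) + e * ?c\<^sup>2 * (?d * (B\<^sup>2 / 2)) - ?a * (?c * B)"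
    using assms d by (simp add: field_simps power2_eq_square del: of_nat_Suc)
  finally have "?a * (?c * B) \<le> 1 / (2 * e) * (1 / ?d * ?a\<^sup>2) + e * ?c\<^sup>2 * (?d * (B\<^sup>2 / 2))" by simp
  also have "\<dots> \<le> 1 / (2 * e) * (1 / ?d * ?a\<^sup>2) + e * ?c\<^sup>2 * (?d * ?S)"
    using B(2) assms d by (intro add_left_mono mult_left_mono) auto
  finally show ?thesis using B(1) by linarith
qed

text \<open>The broken BV embedding applied to \<open>v ^ Suc j\<close>; Young's inequality with a free parameter
  replaces the Cauchy-Schwarz inequalities on the elements and on the edges.\<close>
theorem broken_power_estimate:
  assumes p: "\<And>K. K \<in> \<K> \<Longrightarrow> p K \<in> Poly m"
    and \<sigma>: "\<sigma> > 0" "\<And>K. K \<in> \<K> \<Longrightarrow> \<exists>z. cball z (\<sigma> * mesh_size \<K>) \<subseteq> K"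
    and C: "C > 0" "\<And>q z h x. q \<in> Poly (j * m) \<Longrightarrow> x \<in> cball z h \<Longrightarrow> 0 < h \<Longrightarrow>
      h\<^sup>2 * (cmod (q x))\<^sup>2 \<le> C * (LINT y:cball z (\<sigma> * h)|lebesgue. (cmod (q y))\<^sup>2)"
  shows "(\<Sum>K\<in>\<K>. LINT x:K|lebesgue. (cmod (p K x ^ Suc j))\<^sup>2)
    \<le> (real (Suc j))\<^sup>2 * (2 + 16 * C) * (\<Sum>K\<in>\<K>. LINT x:K|lebesgue. (cmod (p K x ^ j))\<^sup>2) * broken_energy p"
proof -
  let ?I = "\<lambda>K. LINT x:K|lebesgue. (cmod (p K x ^ j))\<^sup>2"
  let ?J = "\<lambda>E. edge_integral E (\<lambda>x. (cmod (pjump p E x))\<^sup>2)"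
  let ?N = "\<lambda>E. {K\<in>\<K>. E edge_of K}"
  let ?c = "real (Suc j)"
  define g where "g = (\<lambda>K x. p K x ^ Suc j)"
  define X where "X = (\<Sum>K\<in>\<K>. ?I K)"
  define D where "D = broken_energy p"
  have gP: "g K \<in> Poly (Suc j * m)" if "K \<in> \<K>" for K unfolding g_def by (rule Poly_power[OF p[OF that]])
  have cp: "continuous_on S (p K)" "continuous_on S (partial i (p K))" if "K \<in> \<K>" for K i S
    using continuous_on_Poly Poly_has_derivative(2) p[OF that] by blast+
  have cj: "continuous_on UNIV (pjump p E)" if "E \<in> \<E>" for E
    by (rule continuous_on_pjump[OF cp(1) that])
  have cjg: "continuous_on UNIV (pjump g E)" if "E \<in> \<E>" for E
    unfolding g_def by (rule continuous_on_pjump[OF continuous_on_power[OF cp(1)] that])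
  have X0: "X \<ge> 0" unfolding X_def by (intro sum_nonneg set_integral_nonneg) simp
  have dpos: "diameter E > 0" if "E \<in> \<E>" for E by (rule edge_diameter(2)[OF that])
  have D0: "D \<ge> 0" unfolding D_def broken_energy_def
    by (intro add_nonneg_nonneg sum_nonneg set_integral_nonneg mult_nonneg_nonneg edge_integral_nonneg)
       (auto intro: less_imp_le[OF dpos])
  have tv0: "total_var g i \<ge> 0" for i
    unfolding total_var_def by (intro add_nonneg_nonneg sum_nonneg set_integral_nonneg edge_integral_nonneg) auto
  have bound: "total_var g i \<le> e * (?c\<^sup>2 * (1 / 2 + 8 * C) * X) + (D / 2) / e" if e: "e > 0" for e i
  proof -
    have vol: "(LINT x:K|lebesgue. cmod (partial i (g K) x)) \<le> e / 2 * ?c\<^sup>2 * ?I K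
        + 1 / (2 * e) * (LINT x:K|lebesgue. (\<Sum>i\<in>UNIV. (cmod (partial i (p K) x))\<^sup>2))" if K: "K \<in> \<K>" for K
    proof -
      note ci = compact_integrable(2)[OF triangle_facts(2)[OF simplex[OF K]]]
      have c1: "continuous_on K (\<lambda>x. (cmod (p K x ^ j))\<^sup>2)"
        by (intro continuous_intros cp K)
      have c2: "continuous_on K (\<lambda>x. \<Sum>i\<in>UNIV. (cmod (partial i (p K) x))\<^sup>2)"
        by (intro continuous_intros cp K)
      have "(LINT x:K|lebesgue. cmod (partial i (g K) x)) \<le> (LINT x:K|lebesgue. e / 2 * ?c\<^sup>2 * (cmod (p K x ^ j))\<^sup>2
        + 1 / (2 * e) * (\<Sum>i\<in>UNIV. (cmod (partial i (p K) x))\<^sup>2))"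
      proof (rule set_integral_mono)
        show "set_integrable lebesgue K (\<lambda>x. cmod (partial i (g K) x))"
          by (intro ci continuous_on_norm continuous_on_Poly[OF Poly_has_derivative(2)[OF gP[OF K]]])
        show "set_integrable lebesgue K (\<lambda>x. e / 2 * ?c\<^sup>2 * (cmod (p K x ^ j))\<^sup>2
          + 1 / (2 * e) * (\<Sum>i\<in>UNIV. (cmod (partial i (p K) x))\<^sup>2))"
          by (intro ci continuous_on_add continuous_on_mult continuous_on_const c1 c2)
        fix x
        let ?a = "cmod (partial i (p K) x)" and ?b = "cmod (p K x ^ j)"
        have "partial i (g K) x = of_nat (Suc j) * p K x ^ j * partial i (p K) x"
          unfolding g_def using Poly_power_partial[OF p[OF K], of i "Suc j" x] by (simp del: of_nat_Suc)
        then have "cmod (partial i (g K) x) = ?c * ?b * ?a" by (simp add: norm_mult del: of_nat_Suc)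
        also have "\<dots> \<le> e / 2 * ?c\<^sup>2 * ?b\<^sup>2 + 1 / (2 * e) * ?a\<^sup>2"
        proof -
          have "0 \<le> (?a - e * ?c * ?b)\<^sup>2 / (2 * e)" using e by simp
          also have "\<dots> = e / 2 * ?c\<^sup>2 * ?b\<^sup>2 + 1 / (2 * e) * ?a\<^sup>2 - ?c * ?b * ?a"
            using e by (simp add: field_simps power2_eq_square del: of_nat_Suc)
          finally show ?thesis by simp
        qed
        also have "?a\<^sup>2 \<le> (\<Sum>i\<in>UNIV. (cmod (partial i (p K) x))\<^sup>2)"
          by (rule member_le_sum) auto
        finally show "cmod (partial i (g K) x) \<le> e / 2 * ?c\<^sup>2 * ?b\<^sup>2
          + 1 / (2 * e) * (\<Sum>i\<in>UNIV. (cmod (partial i (p K) x))\<^sup>2)"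
          using e by (simp add: divide_right_mono del: of_nat_Suc)
      qed
      also have "\<dots> = e / 2 * ?c\<^sup>2 * ?I K
        + 1 / (2 * e) * (LINT x:K|lebesgue. (\<Sum>i\<in>UNIV. (cmod (partial i (p K) x))\<^sup>2))"
        by (subst set_integral_add(2))
           (intro ci continuous_on_mult continuous_on_const c1 c2, intro ci continuous_on_mult continuous_on_const c1 c2,
            simp only: set_integral_mult_right)
      finally show ?thesis .
    qed
    have edge: "edge_integral E (\<lambda>x. cmod (pjump g E x)) \<le> 1 / (2 * e) * (1 / diameter E * ?J E)
       + e * ?c\<^sup>2 * C * (\<Sum>K\<in>?N E. ?I K)" if E: "E \<in> \<E>" for E
    proof -
      have c1: "continuous_on UNIV (\<lambda>x. (cmod (p K x ^ j))\<^sup>2)" if "K \<in> \<K>" for K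
        by (intro continuous_intros cp that)
      have c2: "continuous_on UNIV (\<lambda>x. (cmod (pjump p E x))\<^sup>2)" by (intro continuous_intros cj E)
      have c3: "continuous_on UNIV (\<lambda>x. \<Sum>K\<in>?N E. (cmod (p K x ^ j))\<^sup>2)" by (intro continuous_on_sum c1) simp
      have "edge_integral E (\<lambda>x. cmod (pjump g E x)) \<le> edge_integral E (\<lambda>x. 1 / (2 * e) * (1 / diameter E * (cmod (pjump p E x))\<^sup>2)
         + e * ?c\<^sup>2 * (diameter E * (\<Sum>K\<in>?N E. (cmod (p K x ^ j))\<^sup>2)))"
        unfolding g_def
        by (intro edge_integral_mono pjump_power_bound E e continuous_on_norm cjg[unfolded g_def]
            continuous_on_add continuous_on_mult continuous_on_const c2 c3)
      also have "\<dots> = 1 / (2 * e) * (1 / diameter E * ?J E)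
         + e * ?c\<^sup>2 * (\<Sum>K\<in>?N E. diameter E * edge_integral E (\<lambda>x. (cmod (p K x ^ j))\<^sup>2))"
      proof -
        have *: "edge_integral E (\<lambda>x. \<Sum>K\<in>?N E. (cmod (p K x ^ j))\<^sup>2) = (\<Sum>K\<in>?N E. edge_integral E (\<lambda>x. (cmod (p K x ^ j))\<^sup>2))"
          by (rule edge_integral_sum) (simp add: c1)
        show ?thesis
          by (subst edge_integral_add)
             (intro continuous_on_mult continuous_on_const c2 c3, intro continuous_on_mult continuous_on_const c2 c3,
              simp only: edge_integral_cmult *, simp only: sum_distrib_left)
      qed
      also have "\<dots> \<le> 1 / (2 * e) * (1 / diameter E * ?J E)
         + e * ?c\<^sup>2 * (\<Sum>K\<in>?N E. C * ?I K)"
      proof (intro add_left_mono mult_left_mono sum_mono)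
        fix K assume "K \<in> ?N E"
        then have K: "K \<in> \<K>" "E edge_of K" by auto
        obtain z where z: "cball z (\<sigma> * mesh_size \<K>) \<subseteq> K" using \<sigma>(2)[OF K(1)] by blast
        have q: "(\<lambda>x. p K x ^ j) \<in> Poly (j * m)" by (rule Poly_power[OF p[OF K(1)]])
        show "diameter E * edge_integral E (\<lambda>x. (cmod (p K x ^ j))\<^sup>2) \<le> C * ?I K"
          by (rule trace_inverse_estimate[OF K z \<sigma>(1) C(1) C(2)[OF q] continuous_on_Poly[OF q]])
      qed (use e in auto)
      finally show ?thesis by (simp add: sum_distrib_left mult_ac)
    qed
    \<comment> \<open>Counting by elements instead of by edges: each element is charged once per
      edge, hence at most eight times. The 16 in the constant originates here.\<close>
    have "(\<Sum>E\<in>\<E>. \<Sum>K\<in>?N E. ?I K)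
        = (\<Sum>K\<in>\<K>. \<Sum>E\<in>{E\<in>\<E>. E edge_of K}. ?I K)"
      by (rule sum.swap_restrict[OF finite_edges finite_mesh])
    also have "\<dots> \<le> (\<Sum>K\<in>\<K>. 8 * ?I K)"
    proof (rule sum_mono)
      fix K assume K: "K \<in> \<K>"
      have "{E\<in>\<E>. E edge_of K} = {E. E edge_of K}" using K unfolding edges_def by blast
      then have "real (card {E\<in>\<E>. E edge_of K}) \<le> 8" using card_edges_le[OF simplex[OF K]] by simp
      then show "(\<Sum>E\<in>{E\<in>\<E>. E edge_of K}. ?I K) \<le> 8 * ?I K"
        by (simp add: mult_right_mono set_integral_nonneg)
    qed
    also have "\<dots> = 8 * X" by (simp add: X_def sum_distrib_left)
    finally have cnt: "(\<Sum>E\<in>\<E>. \<Sum>K\<in>?N E. ?I K) \<le> 8 * X" .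
    have "total_var g i \<le> (\<Sum>K\<in>\<K>. e / 2 * ?c\<^sup>2 * ?I K
        + 1 / (2 * e) * (LINT x:K|lebesgue. (\<Sum>i\<in>UNIV. (cmod (partial i (p K) x))\<^sup>2)))
      + (\<Sum>E\<in>\<E>. 1 / (2 * e) * (1 / diameter E * ?J E)
       + e * ?c\<^sup>2 * C * (\<Sum>K\<in>?N E. ?I K))"
      unfolding total_var_def by (intro add_mono sum_mono vol edge)
    also have "\<dots> = e / 2 * ?c\<^sup>2 * X + 1 / (2 * e) * D
       + e * ?c\<^sup>2 * C * (\<Sum>E\<in>\<E>. \<Sum>K\<in>?N E. ?I K)"
      unfolding sum.distrib X_def D_def broken_energy_def sum_distrib_left[symmetric]
      by (simp only: distrib_left add_ac)
    also have "\<dots> \<le> e / 2 * ?c\<^sup>2 * X + 1 / (2 * e) * D + e * ?c\<^sup>2 * C * (8 * X)"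
      using cnt e C(1) by (intro add_left_mono mult_left_mono) auto
    also have "\<dots> = e * (?c\<^sup>2 * (1 / 2 + 8 * C) * X) + (D / 2) / e"
      by (simp add: algebra_simps del: of_nat_Suc)
    finally show ?thesis .
  qed
  have sq: "(total_var g i)\<^sup>2 \<le> 4 * (?c\<^sup>2 * (1 / 2 + 8 * C) * X) * (D / 2)" for i
    by (rule le_young_imp_power2_le[OF tv0 _ _ bound]) (use X0 D0 C(1) in auto)
  have "(\<Sum>K\<in>\<K>. LINT x:K|lebesgue. (cmod (g K x))\<^sup>2) \<le> total_var g 1 * total_var g 2"
    by (rule broken_BV_embedding[OF gP])
  also have "\<dots> \<le> ((total_var g 1)\<^sup>2 + (total_var g 2)\<^sup>2) / 2"
    using sum_squares_bound[of "total_var g 1" "total_var g 2"] by simp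
  also have "\<dots> \<le> 4 * (?c\<^sup>2 * (1 / 2 + 8 * C) * X) * (D / 2)"
  proof -
    have avg: "(a + b) / 2 \<le> M" if "a \<le> M" "b \<le> M" for a b M :: real using that by simp
    show ?thesis by (rule avg[OF sq sq])
  qed
  \<comment> \<open>Here \<open>4 * (1 / 2 + 8 * C) / 2\<close> equals \<open>1 + 16 * C\<close>,
    which is rounded up.\<close>
  also have "\<dots> \<le> ?c\<^sup>2 * (2 + 16 * C) * X * D"
    using X0 D0 C(1) by (simp add: algebra_simps del: of_nat_Suc)
  finally show ?thesis unfolding X_def D_def g_def .
qed

section \<open>The bilinear form in terms of element polynomials\<close>

text \<open>A triangle is the closure of its interior, so \<open>x\<close> is a limit point of the
  interior and \<open>Lim\<close> returns a genuine limit instead of an arbitrary value.\<close>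

lemma trace_from_piece:
  assumes K: "K \<in> \<K>" "x \<in> K" and p: "continuous_on UNIV p" "\<And>y. y \<in> interior K \<Longrightarrow> f y = p y"
  shows "trace_from K f x = p x"
  unfolding trace_from_def
proof (rule tendsto_Lim)
  have "x \<in> closure (interior K)" using triangle_facts(8)[OF simplex[OF K(1)]] K(2) by simp
  then have "x islimpt interior K"
    by (metis closure_def UnE interior_interior interior_limit_point mem_Collect_eq)
  then show "at x within interior K \<noteq> bot" using trivial_limit_within by blast
  have "(p \<longlongrightarrow> p x) (at x within interior K)"
    using p(1) by (metis UNIV_I continuous_on_def subset_UNIV tendsto_within_subset)
  moreover have "\<forall>\<^sub>F y in at x within interior K. p y = f y"
    unfolding eventually_at_filter using p(2) by (auto intro!: always_eventually)
  ultimately show "(f \<longlongrightarrow> p x) (at x within interior K)"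
    using tendsto_cong by fast
qed

lemma partial_piece:
  assumes "p \<in> Poly m" "\<And>y. y \<in> interior K \<Longrightarrow> f y = p y" "x \<in> interior K"
  shows "partial i f x = partial i p x"
proof -
  have "(f has_derivative frechet_derivative p (at x)) (at x)"
    by (rule has_derivative_transform_within_open[OF Poly_frechet[OF assms(1)] open_interior assms(3)])
       (simp add: assms(2))
  from frechet_derivative_at[OF this] show ?thesis by (simp add: partial_def)
qed

lemma piece_cont:
  assumes "pieces m v p" "K \<in> \<K>"
  shows "continuous_on S (p K)" "continuous_on S (partial i (p K))"
  using assms continuous_on_Poly Poly_has_derivative(2) unfolding pieces_def by blast+

definition skeleton :: "(real^2) set" where "skeleton = \<Union>(frontier ` \<K>)"

lemma negligible_skeleton: "negligible skeleton"
  unfolding skeleton_def using finite_mesh triangle_facts(9)[OF simplex] by (intro negligible_Union) auto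

lemma spike_integral:
  fixes f g :: "real^2 \<Rightarrow> 'b::euclidean_space"
  assumes "negligible T" "set_integrable lebesgue S g" "\<And>x. x \<in> S - T \<Longrightarrow> f x = g x" "S \<in> sets lebesgue"
  shows "set_integrable lebesgue S f" "(LINT x:S|lebesgue. f x) = (LINT x:S|lebesgue. g x)"
proof -
  show f: "set_integrable lebesgue S f"
    by (rule absolutely_integrable_spike[OF assms(2,1,3)])
  have "integral S f = integral S g" by (rule integral_spike[OF assms(1)]) (use assms(3) in auto)
  then show "(LINT x:S|lebesgue. f x) = (LINT x:S|lebesgue. g x)"
    using set_lebesgue_integral_eq_integral(2) f assms(2) by metis
qed

text \<open>Functions of the DG space are known only in the element interiors. The element frontiers
  form a null set, so continuous representatives on the closed elements decide both integrability
  over \<Omega> and the value of the integral.\<close>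

lemma mesh_integral:
  fixes f :: "real^2 \<Rightarrow> 'b::euclidean_space"
  assumes "\<And>K. K \<in> \<K> \<Longrightarrow> continuous_on K (F K)" "\<And>K x. K \<in> \<K> \<Longrightarrow> x \<in> interior K \<Longrightarrow> f x = F K x"
  shows "set_integrable lebesgue \<Omega> f" "(LINT x:\<Omega>|lebesgue. f x) = (\<Sum>K\<in>\<K>. LINT x:K|lebesgue. F K x)"
proof -
  let ?g = "\<lambda>x. \<Sum>K\<in>\<K>. indicator K x *\<^sub>R F K x"
  have Fi: "set_integrable lebesgue K (F K)" if "K \<in> \<K>" for K
    by (rule compact_integrable(2)[OF triangle_facts(2)[OF simplex[OF that]] assms(1)[OF that]])
  have gi: "integrable lebesgue ?g"
    using Fi unfolding set_integrable_def by (intro Bochner_Integration.integrable_sum)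
  have O: "\<Omega> \<in> sets lebesgue" using domain_facts(1) by (simp add: borel_open sets_completionI_sets)
  have gO: "indicator \<Omega> x *\<^sub>R ?g x = ?g x" if "x \<notin> skeleton" for x
  proof (cases "x \<in> \<Omega>")
    case False
    have "x \<notin> K" if "K \<in> \<K>" for K
    proof
      assume "x \<in> K"
      then have "x \<in> interior K" using \<open>x \<notin> skeleton\<close> that triangle_facts(3)[OF simplex[OF that]]
        unfolding skeleton_def by (auto simp: frontier_def)
      then show False using False interior_subset_domain[OF that] by blast
    qed
    then show ?thesis by simp
  qed simp
  have gs: "set_integrable lebesgue \<Omega> ?g"
    unfolding set_integrable_def by (rule integrable_mult_indicator[OF O gi])
  have fg: "f x = ?g x" if x: "x \<in> \<Omega> - skeleton" for x
  proof -
    have "x \<in> \<Union>\<K>" using x Union_mesh closure_subset by blast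
    then obtain K where K: "K \<in> \<K>" "x \<in> K" by blast
    have "x \<in> interior K" using x K triangle_facts(3)[OF simplex[OF K(1)]]
      unfolding skeleton_def by (auto simp: frontier_def)
    then have "?g x = (\<Sum>K'\<in>{K}. indicator K' x *\<^sub>R F K' x)"
      using K finite_mesh mesh_eqI[OF K(1)] by (intro sum.mono_neutral_right) (auto simp: indicator_def)
    then show ?thesis using assms(2)[OF K(1) \<open>x \<in> interior K\<close>] K by simp
  qed
  show "set_integrable lebesgue \<Omega> f" by (rule spike_integral(1)[OF negligible_skeleton gs fg O])
  have "(LINT x:\<Omega>|lebesgue. f x) = (LINT x:\<Omega>|lebesgue. ?g x)"
    by (rule spike_integral(2)[OF negligible_skeleton gs fg O])
  also have "\<dots> = (LINT x:UNIV|lebesgue. indicator \<Omega> x *\<^sub>R ?g x)"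
    unfolding set_lebesgue_integral_def by simp
  also have "\<dots> = (LINT x:UNIV|lebesgue. ?g x)"
    by (rule spike_integral(2)[OF negligible_skeleton]) (use gi gO in \<open>auto simp: set_integrable_def\<close>)
  also have "\<dots> = (\<Sum>K\<in>\<K>. LINT x:K|lebesgue. F K x)"
    unfolding set_lebesgue_integral_def using Fi
    by (simp add: set_integrable_def Bochner_Integration.integral_sum)
  finally show "(LINT x:\<Omega>|lebesgue. f x) = (\<Sum>K\<in>\<K>. LINT x:K|lebesgue. F K x)" .
qed

lemma jump_pieces:
  assumes "E \<in> \<E>" "x \<in> E" "pieces m f p"
  shows "jump \<Omega> \<K> n E f x = pjump p E x"
proof -
  have "trace_from K f x = p K x" if "K \<in> \<K>" "x \<in> K" for K
    by (rule trace_from_piece[OF that piece_cont(1)[OF assms(3) that(1)]])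
       (use assms(3) that in \<open>auto simp: pieces_def\<close>)
  moreover have "x \<in> elem1 \<K> n E" "\<not> outer E \<Longrightarrow> x \<in> elem2 \<K> n E"
    using elem1_edge[OF assms(1)] elem2_edge[OF assms(1)] assms(2) edge_of_imp_subset by blast+
  ultimately show ?thesis
    unfolding jump_def pjump_def using elem1_mesh[OF assms(1)] elem2_mesh[OF assms(1)] by auto
qed

definition pflux :: "((real^2) set \<Rightarrow> real^2 \<Rightarrow> complex) \<Rightarrow> (real^2) set \<Rightarrow> real^2 \<Rightarrow> complex" where
  "pflux p E x = (\<Sum>i\<in>UNIV. (if outer E then partial i (p (elem1 \<K> n E)) x
     else (partial i (p (elem1 \<K> n E)) x + partial i (p (elem2 \<K> n E)) x) / 2) * of_real (n E $ i))"

lemma flux_pieces: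
  assumes E: "E \<in> \<E>" "x \<in> E" and p: "pieces m f p"
  shows "flux \<Omega> \<K> n E f x = pflux p E x"
proof -
  have x: "x \<in> elem1 \<K> n E" "\<not> outer E \<Longrightarrow> x \<in> elem2 \<K> n E"
    using elem1_edge[OF E(1)] elem2_edge[OF E(1)] E(2) edge_of_imp_subset by blast+
  have "trace_from K (partial i f) x = partial i (p K) x" if "K \<in> \<K>" "x \<in> K" for K i
    by (rule trace_from_piece[OF that piece_cont(2)[OF p that(1)]])
       (use partial_piece[of "p K" m K f] p that in \<open>auto simp: pieces_def\<close>)
  then have "average \<Omega> \<K> n E (partial i f) x = (if outer E then partial i (p (elem1 \<K> n E)) x
     else (partial i (p (elem1 \<K> n E)) x + partial i (p (elem2 \<K> n E)) x) / 2)" for i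
    unfolding average_def using x elem1_mesh[OF E(1)] elem2_mesh[OF E(1)] by simp
  then show ?thesis unfolding flux_def pflux_def by simp
qed

lemma continuous_on_pjump': "pieces m f p \<Longrightarrow> E \<in> \<E> \<Longrightarrow> continuous_on UNIV (pjump p E)"
  by (rule continuous_on_pjump) (auto intro: piece_cont(1))

lemma continuous_on_pflux:
  assumes "pieces m f p" "E \<in> \<E>" shows "continuous_on UNIV (pflux p E)"
proof (cases "outer E")
  case True
  then show ?thesis unfolding pflux_def[abs_def] if_P[OF True]
    by (intro continuous_intros piece_cont(2)[OF assms(1)] elem1_mesh assms(2))
next
  case False
  then show ?thesis unfolding pflux_def[abs_def] if_not_P[OF False]
    by (intro continuous_intros piece_cont(2)[OF assms(1)] elem1_mesh elem2_mesh assms(2)) auto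
qed

lemma DG_norm_pieces:
  assumes "pieces m v p"
  shows "(DG_norm \<Omega> \<K> n v)\<^sup>2 = broken_energy p"
proof -
  have "(LINT x:K|lebesgue. (\<Sum>i\<in>UNIV. (cmod (partial i v x))\<^sup>2)) = (LINT x:K|lebesgue. (\<Sum>i\<in>UNIV. (cmod (partial i (p K) x))\<^sup>2))"
    if K: "K \<in> \<K>" for K
  proof (rule spike_integral(2)[of "frontier K"])
    note tf = triangle_facts[OF simplex[OF K]]
    show "negligible (frontier K)" by (rule tf(9))
    show "set_integrable lebesgue K (\<lambda>x. \<Sum>i\<in>UNIV. (cmod (partial i (p K) x))\<^sup>2)"
      by (intro compact_integrable(2) tf(2) continuous_intros piece_cont(2)[OF assms K])
    show "K \<in> sets lebesgue" using tf(3) by (simp add: borel_closed sets_completionI_sets)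
    fix x assume "x \<in> K - frontier K"
    then have "x \<in> interior K" using tf(3) by (auto simp: frontier_def)
    then show "(\<Sum>i\<in>UNIV. (cmod (partial i v x))\<^sup>2) = (\<Sum>i\<in>UNIV. (cmod (partial i (p K) x))\<^sup>2)"
      using partial_piece[of "p K" m K v x] assms K unfolding pieces_def by simp
  qed
  moreover have "edge_integral E (\<lambda>x. (cmod (jump \<Omega> \<K> n E v x))\<^sup>2) = edge_integral E (\<lambda>x. (cmod (pjump p E x))\<^sup>2)"
    if "E \<in> \<E>" for E
    by (rule edge_integral_cong[OF that]) (simp add: jump_pieces[OF that _ assms])
  ultimately have "DG_norm \<Omega> \<K> n v = sqrt (broken_energy p)"
    unfolding DG_norm_def broken_energy_def by simp
  moreover have "broken_energy p \<ge> 0"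
    unfolding broken_energy_def
    by (intro add_nonneg_nonneg sum_nonneg set_integral_nonneg mult_nonneg_nonneg edge_integral_nonneg)
       (auto intro: less_imp_le[OF edge_diameter(2)])
  ultimately show ?thesis by simp
qed

text \<open>\<open>a_h\<close> on element polynomials. All integrands are continuous here, so
  linearity follows by splitting integrals.\<close>

definition pform :: "real \<Rightarrow> ((real^2) set \<Rightarrow> real^2 \<Rightarrow> complex) \<Rightarrow> ((real^2) set \<Rightarrow> real^2 \<Rightarrow> complex) \<Rightarrow> complex" where
  "pform lam p q = (\<Sum>K\<in>\<K>. LINT x:K|lebesgue. (\<Sum>i\<in>UNIV. partial i (p K) x * cnj (partial i (q K) x)))
     - (\<Sum>E\<in>\<E>. edge_integral E (\<lambda>x. pflux p E x * cnj (pjump q E x)))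
     - (\<Sum>E\<in>\<E>. edge_integral E (\<lambda>x. pjump p E x * cnj (pflux q E x)))
     + (\<Sum>E\<in>\<E>. of_real (lam / diameter E) * edge_integral E (\<lambda>x. pjump p E x * cnj (pjump q E x)))"

lemma a_h_pieces:
  assumes p: "pieces m v p" and q: "pieces l w q"
  shows "a_h \<Omega> \<K> n lam v w = pform lam p q"
proof -
  have "(LINT x:\<Omega>|lebesgue. (\<Sum>i\<in>UNIV. partial i v x * cnj (partial i w x)))
    = (\<Sum>K\<in>\<K>. LINT x:K|lebesgue. (\<Sum>i\<in>UNIV. partial i (p K) x * cnj (partial i (q K) x)))"
  proof (rule mesh_integral(2))
    fix K assume K: "K \<in> \<K>"
    show "continuous_on K (\<lambda>x. \<Sum>i\<in>UNIV. partial i (p K) x * cnj (partial i (q K) x))"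
      by (intro continuous_intros piece_cont(2)[OF p K] piece_cont(2)[OF q K])
    show "(\<Sum>i\<in>UNIV. partial i v x * cnj (partial i w x)) = (\<Sum>i\<in>UNIV. partial i (p K) x * cnj (partial i (q K) x))"
      if "x \<in> interior K" for x
      using partial_piece[of "p K" m K v x] partial_piece[of "q K" l K w x] p q K that unfolding pieces_def by simp
  qed
  moreover have "edge_integral E (\<lambda>x. flux \<Omega> \<K> n E v x * cnj (jump \<Omega> \<K> n E w x)) = edge_integral E (\<lambda>x. pflux p E x * cnj (pjump q E x))"
    "edge_integral E (\<lambda>x. jump \<Omega> \<K> n E v x * cnj (flux \<Omega> \<K> n E w x)) = edge_integral E (\<lambda>x. pjump p E x * cnj (pflux q E x))"
    "edge_integral E (\<lambda>x. jump \<Omega> \<K> n E v x * cnj (jump \<Omega> \<K> n E w x)) = edge_integral E (\<lambda>x. pjump p E x * cnj (pjump q E x))"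
    if E: "E \<in> \<E>" for E
    by (rule edge_integral_cong[OF E]; simp add: jump_pieces[OF E] flux_pieces[OF E] p q jump_pieces[OF E _ p] jump_pieces[OF E _ q]
        flux_pieces[OF E _ p] flux_pieces[OF E _ q])+
  ultimately show ?thesis unfolding a_h_def pform_def by simp
qed

lemma pieces_add: "pieces m v p \<Longrightarrow> pieces m w q \<Longrightarrow> pieces m (\<lambda>x. v x + w x) (\<lambda>K x. p K x + q K x)"
  unfolding pieces_def by (auto intro: Poly_add)

lemma pieces_cmult: "pieces m v p \<Longrightarrow> pieces m (\<lambda>x. c * v x) (\<lambda>K x. c * p K x)"
  unfolding pieces_def by (auto intro: Poly_cmult)

lemma partial_add:
  assumes "f \<in> Poly m" "g \<in> Poly m"
  shows "partial i (\<lambda>x. f x + g x) x = partial i f x + partial i g x"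
  using frechet_derivative_at[OF has_derivative_add[OF Poly_frechet[OF assms(1)] Poly_frechet[OF assms(2)]]]
  by (simp add: partial_def fun_eq_iff)

lemma partial_cmult:
  assumes "f \<in> Poly m"
  shows "partial i (\<lambda>x. c * f x) x = c * partial i f x"
  using frechet_derivative_at[OF has_derivative_mult_right[OF Poly_frechet[OF assms]]]
  by (simp add: partial_def fun_eq_iff)

lemma pjump_add: "pjump (\<lambda>K x. p K x + q K x) E x = pjump p E x + pjump q E x"
  and pjump_cmult: "pjump (\<lambda>K x. c * p K x) E x = c * pjump p E x"
  by (simp_all add: pjump_def algebra_simps)

lemma pflux_add:
  assumes "pieces m v p" "pieces m w q" "E \<in> \<E>"
  shows "pflux (\<lambda>K x. p K x + q K x) E x = pflux p E x + pflux q E x"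
proof -
  have *: "partial i (\<lambda>x. p K x + q K x) x = partial i (p K) x + partial i (q K) x" if "K \<in> \<K>" for K i
    using assms that unfolding pieces_def by (intro partial_add) auto
  show ?thesis
    unfolding pflux_def sum.distrib[symmetric] using elem1_mesh[OF assms(3)] elem2_mesh[OF assms(3)]
    by (intro sum.cong refl) (auto simp: * field_simps)
qed

lemma pflux_cmult:
  assumes "pieces m v p" "E \<in> \<E>"
  shows "pflux (\<lambda>K x. c * p K x) E x = c * pflux p E x"
proof -
  have *: "partial i (\<lambda>x. c * p K x) x = c * partial i (p K) x" if "K \<in> \<K>" for K i
    using assms that unfolding pieces_def by (intro partial_cmult) auto
  show ?thesis
    unfolding pflux_def sum_distrib_left using elem1_mesh[OF assms(2)] elem2_mesh[OF assms(2)]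
    by (intro sum.cong refl) (auto simp: * field_simps)
qed

lemma pform_add:
  assumes p: "pieces m v p" and q: "pieces m w q" and r: "pieces m z r"
  shows "pform lam (\<lambda>K x. p K x + q K x) r = pform lam p r + pform lam q r"
proof -
  have "(LINT x:K|lebesgue. (\<Sum>i\<in>UNIV. partial i (\<lambda>x. p K x + q K x) x * cnj (partial i (r K) x)))
     = (LINT x:K|lebesgue. (\<Sum>i\<in>UNIV. partial i (p K) x * cnj (partial i (r K) x)))
     + (LINT x:K|lebesgue. (\<Sum>i\<in>UNIV. partial i (q K) x * cnj (partial i (r K) x)))" if K: "K \<in> \<K>" for K
  proof -
    have *: "partial i (\<lambda>x. p K x + q K x) x = partial i (p K) x + partial i (q K) x" for x i
      using p q K unfolding pieces_def by (intro partial_add) auto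
    show ?thesis
      unfolding * distrib_right sum.distrib
      by (intro set_integral_add(2) compact_integrable(2) triangle_facts(2)[OF simplex[OF K]] continuous_intros
          piece_cont(2)[OF p K] piece_cont(2)[OF q K] piece_cont(2)[OF r K])
  qed
  moreover have "edge_integral E (\<lambda>x. (f x + g x) * cnj (h x)) = edge_integral E (\<lambda>x. f x * cnj (h x)) + edge_integral E (\<lambda>x. g x * cnj (h x))"
    if "continuous_on UNIV f" "continuous_on UNIV g" "continuous_on UNIV h" for E and f g h :: "real^2 \<Rightarrow> complex"
    unfolding distrib_right by (intro edge_integral_add continuous_on_mult continuous_on_cnj that)
  ultimately show ?thesis
    unfolding pform_def
    by (simp add: pjump_add pflux_add[OF p q] p[THEN continuous_on_pjump'] q[THEN continuous_on_pjump'] r[THEN continuous_on_pjump']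
        p[THEN continuous_on_pflux] q[THEN continuous_on_pflux] r[THEN continuous_on_pflux] sum.distrib distrib_left)
qed

lemma pform_cmult:
  assumes p: "pieces m v p"
  shows "pform lam (\<lambda>K x. c * p K x) r = c * pform lam p r"
proof -
  have "(LINT x:K|lebesgue. (\<Sum>i\<in>UNIV. partial i (\<lambda>x. c * p K x) x * cnj (partial i (r K) x)))
     = c * (LINT x:K|lebesgue. (\<Sum>i\<in>UNIV. partial i (p K) x * cnj (partial i (r K) x)))" if K: "K \<in> \<K>" for K
  proof -
    have *: "partial i (\<lambda>x. c * p K x) x = c * partial i (p K) x" for x i
      using p K unfolding pieces_def by (intro partial_cmult) auto
    show ?thesis
      unfolding * by (simp only: mult.assoc sum_distrib_left[symmetric] set_integral_mult_right)
  qed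
  then show ?thesis
    unfolding pform_def
    by (simp add: pjump_cmult pflux_cmult[OF p] mult.assoc edge_integral_cmult sum_distrib_left right_diff_distrib distrib_left mult.left_commute)
qed

text \<open>Conjugation exchanges the two flux sums. It holds for arbitrary functions, since Bochner
  integration commutes with conjugation even where the integrand is not integrable.\<close>

lemma a_h_hermitian: "a_h \<Omega> \<K> n lam w v = cnj (a_h \<Omega> \<K> n lam v w)"
proof -
  have sc: "(LINT x:A|M. cnj (f x)) = cnj (LINT x:A|M. f x)" for A and M :: "'a measure" and f
  proof -
    have "(\<lambda>x. indicator A x *\<^sub>R cnj (f x)) = (\<lambda>x. cnj (indicator A x *\<^sub>R f x))" by (simp add: fun_eq_iff)
    then show ?thesis unfolding set_lebesgue_integral_def by (simp only: Bochner_Integration.integral_cnj)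
  qed
  have ec: "edge_integral E (\<lambda>x. cnj (f x)) = cnj (edge_integral E f)" for E f
    unfolding edge_integral_ends by (simp add: sc)
  show ?thesis
    unfolding a_h_def
    by (simp add: sc[symmetric] ec[symmetric] mult.commute)
qed

end

section \<open>Pointwise inequalities and the discontinuous finite element space\<close>

lemma set_integral_Re:
  fixes f :: "'a \<Rightarrow> complex"
  assumes "set_integrable M A f"
  shows "(LINT x:A|M. Re (f x)) = Re (LINT x:A|M. f x)" "set_integrable M A (\<lambda>x. Re (f x))"
proof -
  have *: "(\<lambda>x. indicator A x *\<^sub>R Re (f x)) = (\<lambda>x. Re (indicator A x *\<^sub>R f x))" by (simp add: fun_eq_iff)
  show "(LINT x:A|M. Re (f x)) = Re (LINT x:A|M. f x)" "set_integrable M A (\<lambda>x. Re (f x))"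
    using assms integral_bounded_linear[OF bounded_linear_Re, of M "\<lambda>x. indicator A x *\<^sub>R f x"]
      integrable_bounded_linear[OF bounded_linear_Re, of M "\<lambda>x. indicator A x *\<^sub>R f x"]
    unfolding set_lebesgue_integral_def set_integrable_def * by simp_all
qed

text \<open>Case distinction on which term dominates: if \<open>c * b \<le> \<kappa> * a\<close> the
  first summand suffices, otherwise \<open>a\<close> is at most \<open>c / \<kappa> * b\<close>. The
  coefficient of \<open>a ^ 4\<close> is exactly \<kappa>, so that the damping term of the equation
  cancels it.\<close>

lemma young_cubic:
  fixes a b :: real
  assumes "0 \<le> a" "0 \<le> b" "\<kappa> > 0" "c \<ge> 0"
  shows "c * a ^ 3 * b \<le> \<kappa> * a ^ 4 + c * (c / \<kappa>) ^ 3 * b ^ 4"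
proof (cases "c * b \<le> \<kappa> * a")
  case True
  then have "(c * b) * a ^ 3 \<le> (\<kappa> * a) * a ^ 3" using assms by (intro mult_right_mono) auto
  also have "\<dots> = \<kappa> * a ^ 4" by (simp add: power_def numeral_eq_Suc)
  finally show ?thesis using assms by (simp add: mult_ac add_increasing2)
next
  case False
  then have "a \<le> c / \<kappa> * b" using assms by (simp add: field_simps)
  then have "a ^ 3 \<le> (c / \<kappa> * b) ^ 3" using assms by (intro power_mono) auto
  then have "(c * b) * a ^ 3 \<le> (c * b) * (c / \<kappa> * b) ^ 3" using assms by (intro mult_left_mono) auto
  also have "\<dots> = c * (c / \<kappa>) ^ 3 * b ^ 4" by (simp add: power_mult_distrib numeral_eq_Suc)
  finally have "(c * b) * a ^ 3 \<le> c * (c / \<kappa>) ^ 3 * b ^ 4" .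
  moreover have "\<kappa> * a ^ 4 \<ge> 0" using assms by simp
  ultimately show ?thesis by (simp add: mult_ac)
qed

lemma Re_mult_cnj_self: "Re (z * cnj z) = (cmod z)\<^sup>2" "z * cnj z = of_real ((cmod z)\<^sup>2)"
  by (simp_all add: complex_norm_square[symmetric] flip: of_real_power)

lemma cmod_parallelogram: "(cmod (2 * a - b))\<^sup>2 + (cmod b)\<^sup>2 = 2 * (cmod a)\<^sup>2 + 2 * (cmod (a - b))\<^sup>2"
  unfolding cmod_power2 by (simp add: algebra_simps power2_eq_square)

definition reaction :: "real \<Rightarrow> real \<Rightarrow> real \<Rightarrow> complex \<Rightarrow> complex" where
  "reaction \<kappa> \<beta> \<gamma> a = Complex \<kappa> \<beta> * (of_real ((cmod a)\<^sup>2) * a) - of_real \<gamma> * a"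

text \<open>Here and below \<open>a\<close> is the midpoint value, \<open>b\<close> the old and
  \<open>2 * a - b\<close> the new one. The difference quotient gives an exact difference of
  squares, and completing the square hides the \<gamma> term in half of the quartic one.\<close>

lemma pointwise_energy:
  assumes "\<tau> > 0" "\<kappa> > 0"
  shows "Re ((of_real (2 / \<tau>) * (a - b) + reaction \<kappa> \<beta> \<gamma> a) * cnj a) \<ge>
    1 / (2 * \<tau>) * ((cmod (2 * a - b))\<^sup>2 - (cmod b)\<^sup>2) + \<kappa> / 2 * cmod a ^ 4 - \<gamma>\<^sup>2 / (2 * \<kappa>)"
proof -
  have 1: "Re ((a - b) * cnj a) = ((cmod (2 * a - b))\<^sup>2 - (cmod b)\<^sup>2) / 4"
    unfolding cmod_power2 by (simp add: algebra_simps power2_eq_square)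
  have "reaction \<kappa> \<beta> \<gamma> a * cnj a = (Complex \<kappa> \<beta> * of_real ((cmod a)\<^sup>2) - of_real \<gamma>) * (a * cnj a)"
    unfolding reaction_def by (simp add: algebra_simps)
  also have "\<dots> = (Complex \<kappa> \<beta> * of_real ((cmod a)\<^sup>2) - of_real \<gamma>) * of_real ((cmod a)\<^sup>2)"
    unfolding Re_mult_cnj_self(2) ..
  finally have "Re (reaction \<kappa> \<beta> \<gamma> a * cnj a) = (\<kappa> * (cmod a)\<^sup>2 - \<gamma>) * (cmod a)\<^sup>2"
    by (simp del: of_real_power)
  then have 2: "Re (reaction \<kappa> \<beta> \<gamma> a * cnj a) = \<kappa> * cmod a ^ 4 - \<gamma> * (cmod a)\<^sup>2"
    by (simp add: algebra_simps power2_eq_square numeral_eq_Suc)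
  have "0 \<le> (\<kappa> * (cmod a)\<^sup>2 - \<gamma>)\<^sup>2 / (2 * \<kappa>)" using assms by simp
  also have "\<dots> = \<kappa> / 2 * cmod a ^ 4 - \<gamma> * (cmod a)\<^sup>2 + \<gamma>\<^sup>2 / (2 * \<kappa>)"
    using assms by (simp add: field_simps power2_eq_square numeral_eq_Suc)
  finally have 3: "\<gamma> * (cmod a)\<^sup>2 \<le> \<kappa> / 2 * cmod a ^ 4 + \<gamma>\<^sup>2 / (2 * \<kappa>)" by simp
  have 4: "Re ((of_real s * c + d) * e) = s * Re (c * e) + Re (d * e)" for s and c d e :: complex
    by (simp add: algebra_simps)
  have 5: "2 / \<tau> * (X / 4) = 1 / (2 * \<tau>) * X" for X
    using assms(1) by (simp add: field_simps)
  show ?thesis unfolding 4 1 2 5 using 3 by linarith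
qed

text \<open>The damping term cancels the cubic cross term by \<open>young_cubic\<close>, and the
  square of the increment is dropped. No \<tau> is left on the right, which is why the midpoint
  energy can be bounded for every step size.\<close>

lemma pointwise_increment:
  assumes "\<tau> > 0" "\<kappa> > 0" "c = cmod (Complex \<kappa> \<beta>)"
  shows "Re ((of_real (2 / \<tau>) * (a - b) + reaction \<kappa> \<beta> \<gamma> a) * cnj (a - b)) \<ge>
    - (c * (c / \<kappa>) ^ 3 * cmod b ^ 4 + \<bar>\<gamma>\<bar> / 2 * ((cmod (2 * a - b))\<^sup>2 + (cmod b)\<^sup>2))"
proof -
  let ?z = "Complex \<kappa> \<beta> * of_real ((cmod a)\<^sup>2)"
  have "Re ((of_real s * (a - b) + reaction \<kappa> \<beta> \<gamma> a) * cnj (a - b))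
    = s * (cmod (a - b))\<^sup>2 + Re (?z * (a * cnj a)) - Re (?z * a * cnj b) - \<gamma> * Re (a * cnj (a - b))" for s
    unfolding reaction_def cmod_power2 by (simp add: algebra_simps power2_eq_square)
  note this[of "2 / \<tau>"]
  moreover have "Re (?z * (a * cnj a)) = \<kappa> * cmod a ^ 4"
    unfolding Re_mult_cnj_self(2) by (simp add: power2_eq_square numeral_eq_Suc del: of_real_power)
  moreover have "Re (?z * a * cnj b) \<le> \<kappa> * cmod a ^ 4 + c * (c / \<kappa>) ^ 3 * cmod b ^ 4"
  proof -
    have "Re (?z * a * cnj b) \<le> cmod (?z * a * cnj b)" by (rule complex_Re_le_cmod)
    also have "\<dots> = c * cmod a ^ 3 * cmod b" using assms(3) by (simp add: norm_mult numeral_eq_Suc power2_eq_square)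
    also have "\<dots> \<le> \<kappa> * cmod a ^ 4 + c * (c / \<kappa>) ^ 3 * cmod b ^ 4"
      by (rule young_cubic) (use assms in auto)
    finally show ?thesis .
  qed
  moreover have "\<gamma> * Re (a * cnj (a - b)) \<le> \<bar>\<gamma>\<bar> / 2 * ((cmod (2 * a - b))\<^sup>2 + (cmod b)\<^sup>2)"
  proof -
    have "\<gamma> * Re (a * cnj (a - b)) \<le> \<bar>\<gamma>\<bar> * \<bar>Re (a * cnj (a - b))\<bar>" by (metis abs_ge_self abs_mult)
    also have "\<dots> \<le> \<bar>\<gamma>\<bar> * (cmod a * cmod (a - b))"
      using abs_Re_le_cmod[of "a * cnj (a - b)"] unfolding norm_mult complex_mod_cnj by (intro mult_left_mono) auto
    also have "\<dots> \<le> \<bar>\<gamma>\<bar> * (((cmod (2 * a - b))\<^sup>2 + (cmod b)\<^sup>2) / 2)"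
      unfolding cmod_parallelogram using sum_squares_bound[of "cmod a" "cmod (a - b)"]
      by (intro mult_left_mono) (auto simp: algebra_simps add_increasing2 intro: order_trans[OF _ add_mono])
    finally show ?thesis by simp
  qed
  moreover have "2 / \<tau> * (cmod (a - b))\<^sup>2 \<ge> 0" using assms by simp
  ultimately show ?thesis by linarith
qed

text \<open>Multiplying by \<open>cnj z\<close> leaves \<open>2 * \<nu> / \<tau>\<close> times the
  squared increment. One half absorbs the cubic term and one half the linear term by Young's
  inequality; what remains carries a factor \<tau> and can be summed over the steps.\<close>

lemma pointwise_rotated:
  assumes "\<tau> > 0" "\<nu> > 0" "z = Complex \<nu> \<alpha>" "c = cmod (Complex \<kappa> \<beta>)"
  shows "Re (cnj z * ((of_real (2 / \<tau>) * (a - b) + reaction \<kappa> \<beta> \<gamma> a) * cnj (a - b))) \<ge>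
    - (\<tau> / (4 * \<nu>) * (cmod z)\<^sup>2 * (c\<^sup>2 * cmod a ^ 6 + \<gamma>\<^sup>2 * (cmod a)\<^sup>2))"
proof -
  let ?y = "cmod (a - b)"
  define R1 where "R1 = cnj z * (Complex \<kappa> \<beta> * (of_real ((cmod a)\<^sup>2) * a)) * cnj (a - b)"
  define R2 where "R2 = cnj z * (of_real \<gamma> * a) * cnj (a - b)"
  have "cnj z * ((of_real s * (a - b) + reaction \<kappa> \<beta> \<gamma> a) * cnj (a - b))
    = cnj z * of_real s * ((a - b) * cnj (a - b)) + R1 - R2" for s
    unfolding reaction_def R1_def R2_def by (simp add: algebra_simps)
  note this[of "2 / \<tau>"]
  moreover have "Re (cnj z * of_real s * ((a - b) * cnj (a - b))) = \<nu> * s * ?y\<^sup>2" for s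
    unfolding Re_mult_cnj_self(2) using assms(3) by (simp del: of_real_power)
  ultimately have "Re (cnj z * ((of_real (2 / \<tau>) * (a - b) + reaction \<kappa> \<beta> \<gamma> a) * cnj (a - b)))
    = \<nu> * (2 / \<tau>) * ?y\<^sup>2 + Re R1 - Re R2"
    by simp
  moreover have "\<bar>Re R1\<bar> \<le> (cmod z * c * cmod a ^ 3) * ?y"
  proof -
    have "cmod R1 = (cmod z * c * cmod a ^ 3) * ?y"
      unfolding R1_def norm_mult complex_mod_cnj assms(4) norm_of_real by (simp add: power2_eq_square power3_eq_cube)
    then show ?thesis using abs_Re_le_cmod[of R1] by simp
  qed
  moreover have "\<bar>Re R2\<bar> \<le> (cmod z * \<bar>\<gamma>\<bar> * cmod a) * ?y"
  proof -
    have "cmod R2 = (cmod z * \<bar>\<gamma>\<bar> * cmod a) * ?y"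
      unfolding R2_def norm_mult complex_mod_cnj norm_of_real by simp
    then show ?thesis using abs_Re_le_cmod[of R2] by simp
  qed
  moreover have yo: "q * ?y \<le> \<nu> / \<tau> * ?y\<^sup>2 + \<tau> / (4 * \<nu>) * q\<^sup>2" for q :: real
  proof -
    have "0 \<le> (2 * \<nu> * ?y - \<tau> * q)\<^sup>2 / (4 * \<nu> * \<tau>)" using assms by simp
    also have "\<dots> = \<nu> / \<tau> * ?y\<^sup>2 + \<tau> / (4 * \<nu>) * q\<^sup>2 - q * ?y"
      using assms(1,2) by (simp add: field_simps power2_eq_square)
    finally show ?thesis by simp
  qed
  moreover have "\<tau> / (4 * \<nu>) * (cmod z * c * cmod a ^ 3)\<^sup>2 + \<tau> / (4 * \<nu>) * (cmod z * \<bar>\<gamma>\<bar> * cmod a)\<^sup>2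
     = \<tau> / (4 * \<nu>) * (cmod z)\<^sup>2 * (c\<^sup>2 * cmod a ^ 6 + \<gamma>\<^sup>2 * (cmod a)\<^sup>2)"
    by (simp add: power_mult_distrib algebra_simps flip: power_mult)
  moreover have "\<nu> * (2 / \<tau>) * ?y\<^sup>2 = \<nu> / \<tau> * ?y\<^sup>2 + \<nu> / \<tau> * ?y\<^sup>2" by (simp add: field_simps)
  ultimately show ?thesis using yo[of "cmod z * c * cmod a ^ 3"] yo[of "cmod z * \<bar>\<gamma>\<bar> * cmod a"] by linarith
qed

context dg_mesh
begin

text \<open>On each compact element the integrand is a continuous function of polynomials. This one
  statement supplies the integrability of the products and powers that occur in the scheme.\<close>

lemma DG_continuous_integrable:
  fixes \<Phi> :: "complex \<times> complex \<Rightarrow> 'b::euclidean_space"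
  assumes "v \<in> V\<^sub>h k" "w \<in> V\<^sub>h k" "continuous_on UNIV \<Phi>"
  shows "set_integrable lebesgue \<Omega> (\<lambda>x. \<Phi> (v x, w x))"
proof -
  obtain p q where pq: "pieces k v p" "pieces k w q" using DG_pieces assms by blast
  show ?thesis
  proof (rule mesh_integral(1))
    fix K assume K: "K \<in> \<K>"
    show "continuous_on K (\<lambda>x. \<Phi> (p K x, q K x))"
      by (rule continuous_on_compose2[OF assms(3)])
         (auto intro!: continuous_on_Pair piece_cont(1)[OF pq(1) K] piece_cont(1)[OF pq(2) K])
    show "\<Phi> (v x, w x) = \<Phi> (p K x, q K x)" if "x \<in> interior K" for x
      using pq K that unfolding pieces_def by simp
  qed
qed

lemma DG_space_pieces:
  assumes "set_borel_measurable lebesgue \<Omega> v" "pieces k v p"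
  shows "v \<in> V\<^sub>h k"
proof -
  have "set_integrable lebesgue \<Omega> (\<lambda>x. (cmod (v x))\<^sup>2)"
    by (rule mesh_integral(1)[of "\<lambda>K x. (cmod (p K x))\<^sup>2"])
       (use assms(2) in \<open>auto simp: pieces_def intro!: continuous_intros piece_cont(1)\<close>)
  then show ?thesis using assms unfolding DG_space_def sq_integrable_def pieces_def by auto
qed

lemma DG_space_add:
  assumes "v \<in> V\<^sub>h k" "w \<in> V\<^sub>h k"
  shows "(\<lambda>x. v x + w x) \<in> V\<^sub>h k"
proof -
  obtain p q where "pieces k v p" "pieces k w q" using DG_pieces assms by blast
  then have "pieces k (\<lambda>x. v x + w x) (\<lambda>K x. p K x + q K x)" by (rule pieces_add)
  moreover have "set_borel_measurable lebesgue \<Omega> (\<lambda>x. v x + w x)"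
    using assms unfolding DG_space_def sq_integrable_def set_borel_measurable_def by (auto simp: scaleR_add_right)
  ultimately show ?thesis by (rule DG_space_pieces[rotated])
qed

lemma DG_space_cmult:
  assumes "v \<in> V\<^sub>h k"
  shows "(\<lambda>x. c * v x) \<in> V\<^sub>h k"
proof -
  obtain p where "pieces k v p" using DG_pieces assms by blast
  then have "pieces k (\<lambda>x. c * v x) (\<lambda>K x. c * p K x)" by (rule pieces_cmult)
  moreover have "set_borel_measurable lebesgue \<Omega> (\<lambda>x. c * v x)"
    using assms borel_measurable_times[OF borel_measurable_const[of c]]
    unfolding DG_space_def sq_integrable_def set_borel_measurable_def
    by (auto simp: mult_scaleR_right[symmetric] simp del: mult_scaleR_right)
  ultimately show ?thesis by (rule DG_space_pieces[rotated])
qed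

lemma a_h_add_left:
  assumes "v \<in> V\<^sub>h k" "w \<in> V\<^sub>h k" "z \<in> V\<^sub>h k"
  shows "a_h \<Omega> \<K> n lam (\<lambda>x. v x + w x) z = a_h \<Omega> \<K> n lam v z + a_h \<Omega> \<K> n lam w z"
proof -
  obtain p q r where pq: "pieces k v p" "pieces k w q" "pieces k z r"
    using DG_pieces[OF assms(1)] DG_pieces[OF assms(2)] DG_pieces[OF assms(3)] by auto
  show ?thesis
    using a_h_pieces[OF pieces_add[OF pq(1,2)] pq(3)] a_h_pieces[OF pq(1,3)] a_h_pieces[OF pq(2,3)] pform_add[OF pq] by simp
qed

lemma a_h_cmult_left:
  assumes "v \<in> V\<^sub>h k" "z \<in> V\<^sub>h k"
  shows "a_h \<Omega> \<K> n lam (\<lambda>x. c * v x) z = c * a_h \<Omega> \<K> n lam v z"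
proof -
  obtain p r where pq: "pieces k v p" "pieces k z r" using DG_pieces assms by blast
  show ?thesis
    using a_h_pieces[OF pieces_cmult[OF pq(1)] pq(2)] a_h_pieces[OF pq] pform_cmult[OF pq(1)] by simp
qed

lemma a_h_add_right:
  assumes "v \<in> V\<^sub>h k" "w \<in> V\<^sub>h k" "z \<in> V\<^sub>h k"
  shows "a_h \<Omega> \<K> n lam z (\<lambda>x. v x + w x) = a_h \<Omega> \<K> n lam z v + a_h \<Omega> \<K> n lam z w"
  using a_h_add_left[OF assms] a_h_hermitian by (metis complex_cnj_add)

lemma a_h_cmult_right:
  assumes "v \<in> V\<^sub>h k" "z \<in> V\<^sub>h k"
  shows "a_h \<Omega> \<K> n lam z (\<lambda>x. c * v x) = cnj c * a_h \<Omega> \<K> n lam z v"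
  using a_h_cmult_left[OF assms] a_h_hermitian by (metis complex_cnj_mult)

text \<open>For \<open>j = 0, 1, 2\<close> this is a discrete Poincare inequality and the discrete
  Gagliardo-Nirenberg inequalities for \<open>L^4\<close> and \<open>L^6\<close>.\<close>

lemma DG_power_estimate:
  assumes v: "v \<in> V\<^sub>h k"
    and \<sigma>: "\<sigma> > 0" "\<And>K. K \<in> \<K> \<Longrightarrow> \<exists>z. cball z (\<sigma> * mesh_size \<K>) \<subseteq> K"
    and C: "C > 0" "\<And>q z h x. q \<in> Poly (j * k) \<Longrightarrow> x \<in> cball z h \<Longrightarrow> 0 < h \<Longrightarrow>
      h\<^sup>2 * (cmod (q x))\<^sup>2 \<le> C * (LINT y:cball z (\<sigma> * h)|lebesgue. (cmod (q y))\<^sup>2)"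
  shows "(LINT x:\<Omega>|lebesgue. cmod (v x) ^ (2 * Suc j))
    \<le> (real (Suc j))\<^sup>2 * (2 + 16 * C) * (LINT x:\<Omega>|lebesgue. cmod (v x) ^ (2 * j)) * (DG_norm \<Omega> \<K> n v)\<^sup>2"
proof -
  obtain p where p: "pieces k v p" using DG_pieces v by blast
  have P: "p K \<in> Poly k" if "K \<in> \<K>" for K using p that unfolding pieces_def by blast
  have *: "(LINT x:\<Omega>|lebesgue. cmod (v x) ^ (2 * i)) = (\<Sum>K\<in>\<K>. LINT x:K|lebesgue. (cmod (p K x ^ i))\<^sup>2)" for i
  proof (rule mesh_integral(2))
    fix K assume K: "K \<in> \<K>"
    show "continuous_on K (\<lambda>x. (cmod (p K x ^ i))\<^sup>2)" by (intro continuous_intros piece_cont(1)[OF p K])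
    show "cmod (v x) ^ (2 * i) = (cmod (p K x ^ i))\<^sup>2" if "x \<in> interior K" for x
      using p K that unfolding pieces_def by (simp add: norm_power power_mult[symmetric] mult.commute)
  qed
  show ?thesis
    unfolding * DG_norm_pieces[OF p] by (rule broken_power_estimate[OF P \<sigma> C])
qed

end

section \<open>One step of the scheme\<close>

text \<open>Young's inequality under the integral. The case distinction replaces a measurability
  argument for the product: a non-integrable product has Bochner integral 0 by convention.\<close>

lemma l2_inner_Re_bound:
  assumes "set_integrable lebesgue \<Omega> (\<lambda>x. (cmod (f x))\<^sup>2)" "set_integrable lebesgue \<Omega> (\<lambda>x. (cmod (g x))\<^sup>2)" "S > 0"
  shows "\<bar>Re (l2_inner \<Omega> f g)\<bar> \<le> S / 2 * (LINT x:\<Omega>|lebesgue. (cmod (f x))\<^sup>2) + 1 / (2 * S) * (LINT x:\<Omega>|lebesgue. (cmod (g x))\<^sup>2)"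
proof (cases "set_integrable lebesgue \<Omega> (\<lambda>x. f x * cnj (g x))")
  case True
  have pw: "\<bar>Re (f x * cnj (g x))\<bar> \<le> S / 2 * (cmod (f x))\<^sup>2 + 1 / (2 * S) * (cmod (g x))\<^sup>2" for x
  proof -
    have "0 \<le> (S * cmod (f x) - cmod (g x))\<^sup>2 / (2 * S)" using assms(3) by simp
    also have "\<dots> = S / 2 * (cmod (f x))\<^sup>2 + 1 / (2 * S) * (cmod (g x))\<^sup>2 - cmod (f x) * cmod (g x)"
      using assms(3) by (simp add: field_simps power2_eq_square)
    finally show ?thesis using abs_Re_le_cmod[of "f x * cnj (g x)"] by (simp add: norm_mult del: times_complex.sel)
  qed
  have int: "set_integrable lebesgue \<Omega> (\<lambda>x. S / 2 * (cmod (f x))\<^sup>2 + 1 / (2 * S) * (cmod (g x))\<^sup>2)"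
    by (intro set_integral_add(1) set_integrable_mult_right impI assms)
  note Re = set_integral_Re[OF True]
  have "\<bar>Re (l2_inner \<Omega> f g)\<bar> = \<bar>LINT x:\<Omega>|lebesgue. Re (f x * cnj (g x))\<bar>"
    unfolding l2_inner_def Re(1) ..
  also have "\<dots> \<le> (LINT x:\<Omega>|lebesgue. \<bar>Re (f x * cnj (g x))\<bar>)"
    unfolding set_lebesgue_integral_def using integral_abs_bound[of lebesgue "\<lambda>x. indicator \<Omega> x *\<^sub>R Re (f x * cnj (g x))"]
    by (simp add: abs_mult)
  also have "\<dots> \<le> (LINT x:\<Omega>|lebesgue. S / 2 * (cmod (f x))\<^sup>2 + 1 / (2 * S) * (cmod (g x))\<^sup>2)"
    by (intro set_integral_mono set_integrable_abs Re(2) int pw)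
  also have "\<dots> = S / 2 * (LINT x:\<Omega>|lebesgue. (cmod (f x))\<^sup>2) + 1 / (2 * S) * (LINT x:\<Omega>|lebesgue. (cmod (g x))\<^sup>2)"
    by (subst set_integral_add(2)) (use assms in auto)
  finally show ?thesis .
next
  case False
  then have "l2_inner \<Omega> f g = 0"
    unfolding l2_inner_def set_lebesgue_integral_def set_integrable_def by (rule not_integrable_integral_eq)
  then show ?thesis using assms(3) by (simp add: set_integral_nonneg)
qed

lemma sq_integrable_add:
  assumes "sq_integrable \<Omega> f" "sq_integrable \<Omega> g"
  shows "set_integrable lebesgue \<Omega> (\<lambda>x. (cmod (f x + g x))\<^sup>2)"
proof -
  have "set_integrable lebesgue \<Omega> (\<lambda>x. 2 * (cmod (f x))\<^sup>2 + 2 * (cmod (g x))\<^sup>2)"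
    using assms unfolding sq_integrable_def by (intro set_integral_add(1) set_integrable_mult_right) auto
  moreover have "(\<lambda>x. indicator \<Omega> x *\<^sub>R (cmod (f x + g x))\<^sup>2) \<in> borel_measurable lebesgue"
  proof -
    have [measurable]: "(\<lambda>x. indicator \<Omega> x *\<^sub>R f x) \<in> borel_measurable lebesgue" "(\<lambda>x. indicator \<Omega> x *\<^sub>R g x) \<in> borel_measurable lebesgue"
      using assms unfolding sq_integrable_def set_borel_measurable_def by auto
    have "(\<lambda>x. indicator \<Omega> x *\<^sub>R (cmod (f x + g x))\<^sup>2) = (\<lambda>x. (cmod (indicator \<Omega> x *\<^sub>R f x + indicator \<Omega> x *\<^sub>R g x))\<^sup>2)"
      by (auto simp: indicator_def)
    then show ?thesis by simp
  qed
  ultimately show ?thesis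
    unfolding set_integrable_def
  proof (rule Bochner_Integration.integrable_bound)
    have "(cmod (f x + g x))\<^sup>2 \<le> 2 * (cmod (f x))\<^sup>2 + 2 * (cmod (g x))\<^sup>2" for x
      using power_mono[OF norm_triangle_ineq[of "f x" "g x"], of 2] sum_squares_bound[of "cmod (f x)" "cmod (g x)"]
      by (simp add: power2_sum)
    then show "AE x in lebesgue. norm (indicat_real \<Omega> x *\<^sub>R (cmod (f x + g x))\<^sup>2)
        \<le> norm (indicat_real \<Omega> x *\<^sub>R (2 * (cmod (f x))\<^sup>2 + 2 * (cmod (g x))\<^sup>2))"
      by (auto simp: indicator_def)
  qed
qed

text \<open>The time-stepping estimates see the mesh only through \<open>C1\<close> and
  \<open>G\<close>. Both are later instantiated with values common to all meshes, which makes the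
  bounds derived here uniform.\<close>

locale dg_stable = dg_mesh +
  fixes k :: nat and lam C1 G :: real
  assumes C1: "C1 > 0" and G: "G > 0"
    and coercive: "\<And>v. v \<in> V\<^sub>h k \<Longrightarrow> C1 * (DG_norm \<Omega> \<K> n v)\<^sup>2 \<le> Re (a_h \<Omega> \<K> n lam v v)"
    and power_estimate: "\<And>v j. v \<in> V\<^sub>h k \<Longrightarrow> j \<le> 2 \<Longrightarrow>
      (LINT x:\<Omega>|lebesgue. cmod (v x) ^ (2 * Suc j)) \<le> G * (LINT x:\<Omega>|lebesgue. cmod (v x) ^ (2 * j)) * (DG_norm \<Omega> \<K> n v)\<^sup>2"
begin

abbreviation "V \<equiv> V\<^sub>h k"
abbreviation "a \<equiv> a_h \<Omega> \<K> n lam"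

definition en :: "(real^2 \<Rightarrow> complex) \<Rightarrow> real" where "en v = Re (a v v)"
text \<open>The \<open>j\<close>-th power of the \<open>L^j\<close> norm. \<open>pw 0\<close> is the
  area of the domain, which lets \<open>pw_estimate\<close> with \<open>j = 0\<close> act as a
  Poincare inequality.\<close>

definition pw :: "nat \<Rightarrow> (real^2 \<Rightarrow> complex) \<Rightarrow> real" where "pw j v = (LINT x:\<Omega>|lebesgue. cmod (v x) ^ j)"

lemma en_nonneg: "v \<in> V \<Longrightarrow> en v \<ge> 0"
  using coercive[of v] C1 unfolding en_def by (meson mult_nonneg_nonneg order_trans less_imp_le zero_le_power2)

lemma en_DG: "v \<in> V \<Longrightarrow> (DG_norm \<Omega> \<K> n v)\<^sup>2 \<le> en v / C1"
  using coercive[of v] C1 unfolding en_def by (simp add: field_simps)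

lemma pw_nonneg: "pw j v \<ge> 0"
  unfolding pw_def by (rule set_integral_nonneg) simp

lemma pw_estimate: "v \<in> V \<Longrightarrow> j \<le> 2 \<Longrightarrow> pw (2 * Suc j) v \<le> G / C1 * pw (2 * j) v * en v"
proof -
  assume v: "v \<in> V" and "j \<le> 2"
  then have "pw (2 * Suc j) v \<le> G * pw (2 * j) v * (DG_norm \<Omega> \<K> n v)\<^sup>2"
    unfolding pw_def by (rule power_estimate)
  also have "\<dots> \<le> G * pw (2 * j) v * (en v / C1)"
    using G pw_nonneg en_DG[OF v] by (intro mult_left_mono) auto
  finally show ?thesis by simp
qed

lemma a_real: "Im (a v v) = 0"
  using arg_cong[OF a_h_hermitian[of lam v v], of Im] by simp

lemma a_Re_commute: "Re (a v w) = Re (a w v)"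
  using a_h_hermitian[of lam v w] by simp

text \<open>Nonnegativity of the energy of \<open>(z / \<nu>) * v + w\<close>, multiplied by
  \<open>\<nu> / 2\<close>: a weighted Cauchy-Schwarz inequality for the Hermitian form.\<close>

lemma form_young:
  assumes "v \<in> V" "w \<in> V" "\<nu> > 0"
  shows "Re (z * a v w) \<ge> - ((cmod z)\<^sup>2 / (2 * \<nu>) * en v + \<nu> / 2 * en w)"
proof -
  define s where "s = z / of_real \<nu>"
  have sv: "(\<lambda>x. s * v x) \<in> V" by (rule DG_space_cmult[OF assms(1)])
  have x: "(\<lambda>x. s * v x + w x) \<in> V" by (rule DG_space_add[OF sv assms(2)])
  have "a (\<lambda>x. s * v x + w x) (\<lambda>x. s * v x + w x)
    = s * (cnj s * a v v) + s * a v w + (cnj s * a w v + a w w)"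
    unfolding a_h_add_left[OF sv assms(2) x] a_h_add_right[OF sv assms(2) sv] a_h_add_right[OF sv assms(2) assms(2)]
      a_h_cmult_left[OF assms(1) sv] a_h_cmult_left[OF assms(1,2)] a_h_cmult_right[OF assms(1,1)] a_h_cmult_right[OF assms(1,2)]
    by (simp add: distrib_left)
  moreover have "Re (cnj s * a w v) = Re (s * a v w)"
    by (subst a_h_hermitian) simp
  moreover have "Re (s * (cnj s * a v v)) = (cmod s)\<^sup>2 * en v"
    unfolding mult.assoc[symmetric] Re_mult_cnj_self(2) by (simp add: en_def del: of_real_power)
  ultimately have "en (\<lambda>x. s * v x + w x) = (cmod s)\<^sup>2 * en v + 2 * Re (s * a v w) + en w"
    by (simp add: en_def)
  then have "0 \<le> \<nu> / 2 * ((cmod s)\<^sup>2 * en v + 2 * Re (s * a v w) + en w)"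
    using en_nonneg[OF x] assms(3) by simp
  also have "\<dots> = \<nu> / 2 * (cmod s)\<^sup>2 * en v + \<nu> * Re (s * a v w) + \<nu> / 2 * en w"
    by (simp only: distrib_left)
  finally have "0 \<le> \<nu> / 2 * (cmod s)\<^sup>2 * en v + \<nu> * Re (s * a v w) + \<nu> / 2 * en w" .
  moreover have "\<nu> * Re (s * a v w) = Re (z * a v w)"
  proof -
    have "of_real \<nu> * (s * a v w) = z * a v w" using assms(3) by (simp add: s_def)
    then show ?thesis by (metis Re_complex_of_real Im_complex_of_real mult_zero_left diff_zero times_complex.sel(1))
  qed
  moreover have "\<nu> / 2 * (cmod s)\<^sup>2 = (cmod z)\<^sup>2 / (2 * \<nu>)"
    using assms(3) by (simp add: s_def norm_divide power_divide power2_eq_square)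
  ultimately show ?thesis by simp
qed

text \<open>With \<open>w = h - u\<close> the old value is \<open>h - w\<close> and the new one
  \<open>h + w\<close>; polarisation gives the second claim, and the first is the nonnegativity of
  the energy of \<open>u - w\<close>.\<close>

lemma energy_parallelogram:
  assumes "u \<in> V" "h \<in> V"
  shows "en h \<le> 2 * en u + 2 * en (\<lambda>x. h x - u x)"
    "en (\<lambda>x. 2 * h x - u x) - en u = 4 * Re (a h (\<lambda>x. h x - u x))"
    "a h (\<lambda>x. h x - u x) = a u (\<lambda>x. h x - u x) + a (\<lambda>x. h x - u x) (\<lambda>x. h x - u x)"
proof -
  define w where "w = (\<lambda>x. h x - u x)"
  have w: "w \<in> V"
    using DG_space_add[OF assms(2) DG_space_cmult[OF assms(1), of "- 1"]] by (simp add: w_def)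
  have h: "h = (\<lambda>x. u x + w x)" by (simp add: w_def fun_eq_iff)
  have en_add: "en (\<lambda>x. p x + q x) = en p + 2 * Re (a p q) + en q" if "p \<in> V" "q \<in> V" for p q
    unfolding en_def a_h_add_left[OF that DG_space_add[OF that]] a_h_add_right[OF that that(1)] a_h_add_right[OF that that(2)]
    using a_Re_commute[of q p] by simp
  have "en h = en u + 2 * Re (a u w) + en w" unfolding h by (rule en_add[OF assms(1) w])
  moreover have "en (\<lambda>x. u x + (- 1) * w x) = en u - 2 * Re (a u w) + en w"
    using en_add[OF assms(1) DG_space_cmult[OF w, of "- 1"]] unfolding en_def
    by (simp add: a_h_cmult_right[OF w, of _ lam "- 1", simplified] a_h_cmult_left[OF w, of _ lam "- 1", simplified] assms w DG_space_cmult[OF w, of "- 1", simplified])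
  moreover have "en (\<lambda>x. u x + (- 1) * w x) \<ge> 0"
    by (intro en_nonneg DG_space_add DG_space_cmult assms w)
  ultimately show "en h \<le> 2 * en u + 2 * en (\<lambda>x. h x - u x)" unfolding w_def[symmetric] by linarith
  show *: "a h (\<lambda>x. h x - u x) = a u (\<lambda>x. h x - u x) + a (\<lambda>x. h x - u x) (\<lambda>x. h x - u x)"
    unfolding w_def[symmetric] using a_h_add_left[OF assms(1) w w] h by simp
  have "en (\<lambda>x. h x + w x) = en h + 2 * Re (a h w) + en w" by (rule en_add[OF assms(2) w])
  moreover have "(\<lambda>x. 2 * h x - u x) = (\<lambda>x. h x + w x)" by (simp add: w_def fun_eq_iff)
  moreover have "Re (a h w) = Re (a u w) + en w" using * unfolding w_def[symmetric] en_def by simp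
  ultimately show "en (\<lambda>x. 2 * h x - u x) - en u = 4 * Re (a h (\<lambda>x. h x - u x))"
    using \<open>en h = en u + 2 * Re (a u w) + en w\<close> unfolding w_def[symmetric] by simp
qed

text \<open>One step of the scheme: \<open>u\<close> is the old value, \<open>h\<close> the midpoint, and the new value is \<open>2 h - u\<close>.\<close>
definition step_eq :: "real \<Rightarrow> complex \<Rightarrow> real \<Rightarrow> real \<Rightarrow> real \<Rightarrow> (real^2 \<Rightarrow> complex) \<Rightarrow> (real^2 \<Rightarrow> complex) \<Rightarrow> bool" where
  "step_eq \<tau> z \<kappa> \<beta> \<gamma> u h \<longleftrightarrow> u \<in> V \<and> h \<in> V \<and> (\<forall>v\<in>V.
     l2_inner \<Omega> (\<lambda>x. of_real (2 / \<tau>) * (h x - u x)) v + z * a h v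
     + Complex \<kappa> \<beta> * l2_inner \<Omega> (\<lambda>x. of_real ((cmod (h x))\<^sup>2) * h x) v
     - of_real \<gamma> * l2_inner \<Omega> h v = 0)"

text \<open>\<open>\<zeta>\<close> is the factor by which the tested equation is multiplied. Writing
  \<open>v\<close> as a continuous function \<Psi> of the midpoint and the old value makes every
  term integrable, so the pointwise lower bound \<open>g\<close> can be integrated and the form
  moved to the other side.\<close>

lemma step_tested_le:
  assumes eq: "step_eq \<tau> z \<kappa> \<beta> \<gamma> u h" and v: "v \<in> V" "v = (\<lambda>x. \<Psi> (h x, u x))" and \<Psi>: "continuous_on UNIV \<Psi>"
    and g: "set_integrable lebesgue \<Omega> g"
      "\<And>x. g x \<le> Re (\<zeta> * ((of_real (2 / \<tau>) * (h x - u x) + reaction \<kappa> \<beta> \<gamma> (h x)) * cnj (v x)))"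
  shows "(LINT x:\<Omega>|lebesgue. g x) \<le> - Re (\<zeta> * (z * a h v))"
proof -
  have uh: "h \<in> V" "u \<in> V" using eq unfolding step_eq_def by auto
  define f1 where "f1 = (\<lambda>x. (of_real (2 / \<tau>) * (h x - u x)) * cnj (v x))"
  define f2 where "f2 = (\<lambda>x. (of_real ((cmod (h x))\<^sup>2) * h x) * cnj (v x))"
  define f3 where "f3 = (\<lambda>x. h x * cnj (v x))"
  have i1: "set_integrable lebesgue \<Omega> f1"
    unfolding f1_def v(2)
    by (rule DG_continuous_integrable[OF uh, where \<Phi> = "\<lambda>y. (of_real (2 / \<tau>) * (fst y - snd y)) * cnj (\<Psi> y)", unfolded fst_conv snd_conv])
       (intro continuous_intros \<Psi>)
  have i2: "set_integrable lebesgue \<Omega> f2"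
    unfolding f2_def v(2)
    by (rule DG_continuous_integrable[OF uh, where \<Phi> = "\<lambda>y. (of_real ((cmod (fst y))\<^sup>2) * fst y) * cnj (\<Psi> y)", unfolded fst_conv])
       (intro continuous_intros \<Psi>)
  have i3: "set_integrable lebesgue \<Omega> f3"
    unfolding f3_def v(2)
    by (rule DG_continuous_integrable[OF uh, where \<Phi> = "\<lambda>y. fst y * cnj (\<Psi> y)", unfolded fst_conv])
       (intro continuous_intros \<Psi>)
  let ?F = "\<lambda>x. \<zeta> * (f1 x + (Complex \<kappa> \<beta> * f2 x - of_real \<gamma> * f3 x))"
  have F: "(\<lambda>x. \<zeta> * ((of_real (2 / \<tau>) * (h x - u x) + reaction \<kappa> \<beta> \<gamma> (h x)) * cnj (v x))) = ?F"
    unfolding f1_def f2_def f3_def reaction_def by (simp add: fun_eq_iff algebra_simps)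
  have i23: "set_integrable lebesgue \<Omega> (\<lambda>x. Complex \<kappa> \<beta> * f2 x - of_real \<gamma> * f3 x)"
    by (intro set_integral_diff(1) set_integrable_mult_right impI i2 i3)
  have iF: "set_integrable lebesgue \<Omega> ?F"
    by (intro set_integrable_mult_right impI set_integral_add(1) i1 i23)
  have "(LINT x:\<Omega>|lebesgue. ?F x) = \<zeta> * ((LINT x:\<Omega>|lebesgue. f1 x) + (Complex \<kappa> \<beta> * (LINT x:\<Omega>|lebesgue. f2 x) - of_real \<gamma> * (LINT x:\<Omega>|lebesgue. f3 x)))"
    unfolding set_integral_mult_right set_integral_add(2)[OF i1 i23]
    by (subst set_integral_diff(2)) (auto intro: i2 i3)
  then have "(LINT x:\<Omega>|lebesgue. ?F x) + \<zeta> * (z * a h v) = \<zeta> * (l2_inner \<Omega> (\<lambda>x. of_real (2 / \<tau>) * (h x - u x)) v + z * a h v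
     + Complex \<kappa> \<beta> * l2_inner \<Omega> (\<lambda>x. of_real ((cmod (h x))\<^sup>2) * h x) v
     - of_real \<gamma> * l2_inner \<Omega> h v)"
    unfolding l2_inner_def f1_def f2_def f3_def by (simp add: algebra_simps)
  also have "\<dots> = 0" using eq v(1) unfolding step_eq_def by simp
  finally have "Re (LINT x:\<Omega>|lebesgue. ?F x) + Re (\<zeta> * (z * a h v)) = 0" by (metis plus_complex.sel(1) zero_complex.sel(1))
  moreover have "(LINT x:\<Omega>|lebesgue. g x) \<le> (LINT x:\<Omega>|lebesgue. Re (?F x))"
    by (rule set_integral_mono[OF g(1) set_integral_Re(2)[OF iF]]) (use g(2) in \<open>simp only: F[THEN fun_cong]\<close>)
  ultimately show ?thesis unfolding set_integral_Re(1)[OF iF] by linarith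
qed

lemma pw_integrable: "v \<in> V \<Longrightarrow> set_integrable lebesgue \<Omega> (\<lambda>x. cmod (v x) ^ j)"
  by (rule DG_continuous_integrable[where \<Phi> = "\<lambda>y. cmod (fst y) ^ j", unfolded fst_conv])
     (auto intro!: continuous_intros)

lemma step_estimates:
  assumes eq: "step_eq \<tau> (Complex \<nu> \<alpha>) \<kappa> \<beta> \<gamma> u h" and pos: "\<tau> > 0" "\<nu> > 0" "\<kappa> > 0"
  defines "z \<equiv> Complex \<nu> \<alpha>" and "c \<equiv> cmod (Complex \<kappa> \<beta>)" and "u' \<equiv> \<lambda>x. 2 * h x - u x"
  shows "1 / (2 * \<tau>) * (pw 2 u' - pw 2 u) + \<kappa> / 2 * pw 4 h + \<nu> * en h \<le> \<gamma>\<^sup>2 / (2 * \<kappa>) * pw 0 h" (is ?A)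
    "\<nu> / 2 * en (\<lambda>x. h x - u x) \<le> (cmod z)\<^sup>2 / (2 * \<nu>) * en u + c * (c / \<kappa>) ^ 3 * pw 4 u + \<bar>\<gamma>\<bar> / 2 * (pw 2 u' + pw 2 u)" (is ?B)
    "(en u' - en u) / 4 \<le> \<tau> / (4 * \<nu>) * (c\<^sup>2 * pw 6 h + \<gamma>\<^sup>2 * pw 2 h)" (is ?C)
proof -
  let ?R = "\<lambda>x. of_real (2 / \<tau>) * (h x - u x) + reaction \<kappa> \<beta> \<gamma> (h x)" and ?w = "\<lambda>x. h x - u x"
  have uh: "h \<in> V" "u \<in> V" using eq unfolding step_eq_def by auto
  have w: "?w \<in> V"
    using DG_space_add[OF uh(1) DG_space_cmult[OF uh(2), of "- 1"]] by simp
  have u': "u' \<in> V"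
    using DG_space_add[OF DG_space_cmult[OF uh(1), of 2] DG_space_cmult[OF uh(2), of "- 1"]] by (simp add: u'_def)
  note pi = pw_integrable[OF uh(1)] pw_integrable[OF uh(2)] pw_integrable[OF u']
  have ch: "continuous_on UNIV (fst :: complex \<times> complex \<Rightarrow> complex)" "continuous_on UNIV (\<lambda>y :: complex \<times> complex. fst y - snd y)"
    by (intro continuous_intros)+
  show ?A
  proof -
    \<comment> \<open>The factor \<open>cmod (h x) ^ 0\<close> writes the constant so that its
      integral is a multiple of \<open>pw 0 h\<close>.\<close>
    let ?g = "\<lambda>x. 1 / (2 * \<tau>) * (cmod (u' x) ^ 2 - cmod (u x) ^ 2) + \<kappa> / 2 * cmod (h x) ^ 4 - \<gamma>\<^sup>2 / (2 * \<kappa>) * cmod (h x) ^ 0"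
    have "(LINT x:\<Omega>|lebesgue. ?g x) \<le> - Re (1 * (Complex \<nu> \<alpha> * a h h))"
    proof (rule step_tested_le[OF eq uh(1) _ ch(1)])
      show "set_integrable lebesgue \<Omega> ?g"
        by (intro set_integral_diff(1) set_integral_add(1) set_integrable_mult_right impI pi)
      show "?g x \<le> Re (1 * (?R x * cnj (h x)))" for x
        using pointwise_energy[OF pos(1,3), where a = "h x" and b = "u x" and \<beta> = \<beta> and \<gamma> = \<gamma>]
        unfolding u'_def by (simp only: mult_1 power_0 mult_1_right)
    qed simp
    also have "(LINT x:\<Omega>|lebesgue. ?g x)
      = 1 / (2 * \<tau>) * (pw 2 u' - pw 2 u) + \<kappa> / 2 * pw 4 h - \<gamma>\<^sup>2 / (2 * \<kappa>) * pw 0 h"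
      unfolding pw_def
      by (subst set_integral_diff(2) set_integral_add(2),
          (intro set_integral_diff(1) set_integral_add(1) set_integrable_mult_right impI pi)+)+ (simp only: set_integral_mult_right set_integral_diff(2)[OF pi(3)[of 2] pi(2)[of 2]])
    also have "Re (1 * (Complex \<nu> \<alpha> * a h h)) = \<nu> * en h" by (simp add: en_def a_real)
    finally show ?A by simp
  qed
  show ?B
  proof -
    let ?g = "\<lambda>x. (- (c * (c / \<kappa>) ^ 3)) * cmod (u x) ^ 4 + (- (\<bar>\<gamma>\<bar> / 2)) * (cmod (u' x) ^ 2 + cmod (u x) ^ 2)"
    have "(LINT x:\<Omega>|lebesgue. ?g x) \<le> - Re (1 * (z * a h ?w))"
      unfolding z_def
    proof (rule step_tested_le[OF eq w _ ch(2)])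
      show "set_integrable lebesgue \<Omega> ?g"
        by (intro set_integral_diff(1) set_integral_add(1) set_integrable_mult_right impI pi)
      show "?g x \<le> Re (1 * (?R x * cnj (h x - u x)))" for x
        using pointwise_increment[OF pos(1,3) c_def[THEN meta_eq_to_obj_eq], where a = "h x" and b = "u x" and \<gamma> = \<gamma>]
        unfolding u'_def by (simp only: mult_1) (simp only: minus_add_distrib mult_minus_left add_ac)
    qed simp
    also have "(LINT x:\<Omega>|lebesgue. ?g x) = (- (c * (c / \<kappa>) ^ 3)) * pw 4 u + (- (\<bar>\<gamma>\<bar> / 2)) * (pw 2 u' + pw 2 u)"
      unfolding pw_def
      by (subst set_integral_add(2), (intro set_integral_add(1) set_integrable_mult_right impI pi)+,
          simp only: set_integral_mult_right, subst set_integral_add(2), (intro pi)+, rule refl)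
    finally have "Re (z * a h ?w) \<le> c * (c / \<kappa>) ^ 3 * pw 4 u + \<bar>\<gamma>\<bar> / 2 * (pw 2 u' + pw 2 u)" by simp
    \<comment> \<open>The midpoint is split into \<open>u\<close> and \<open>h - u\<close>. The
      second part gives \<nu> times the energy of \<open>h - u\<close>, half of which absorbs the
      mixed part through \<open>form_young\<close>.\<close>
    moreover have "Re (z * a h ?w) = Re (z * a u ?w) + \<nu> * en ?w"
      unfolding energy_parallelogram(3)[OF uh(2,1)] en_def z_def using a_real[of ?w] by (simp add: algebra_simps)
    moreover have "Re (z * a u ?w) \<ge> - ((cmod z)\<^sup>2 / (2 * \<nu>) * en u + \<nu> / 2 * en ?w)"
      by (rule form_young[OF uh(2) w pos(2)])
    ultimately show ?B by linarith
  qed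
  show ?C
  proof -
    let ?q = "\<tau> / (4 * \<nu>) * (cmod z)\<^sup>2"
    let ?g = "\<lambda>x. (- ?q) * (c\<^sup>2 * cmod (h x) ^ 6 + \<gamma>\<^sup>2 * cmod (h x) ^ 2)"
    have "(LINT x:\<Omega>|lebesgue. ?g x) \<le> - Re (cnj z * (z * a h ?w))"
      unfolding z_def
    proof (rule step_tested_le[OF eq w _ ch(2)])
      show "set_integrable lebesgue \<Omega> (\<lambda>x. - (\<tau> / (4 * \<nu>) * (cmod (Complex \<nu> \<alpha>))\<^sup>2) * (c\<^sup>2 * cmod (h x) ^ 6 + \<gamma>\<^sup>2 * cmod (h x) ^ 2))"
        by (intro set_integral_add(1) set_integrable_mult_right impI pi)
      show "- (\<tau> / (4 * \<nu>) * (cmod (Complex \<nu> \<alpha>))\<^sup>2) * (c\<^sup>2 * cmod (h x) ^ 6 + \<gamma>\<^sup>2 * cmod (h x) ^ 2)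
        \<le> Re (cnj (Complex \<nu> \<alpha>) * (?R x * cnj (h x - u x)))" for x
        using pointwise_rotated[OF pos(1,2) refl c_def[THEN meta_eq_to_obj_eq], where a = "h x" and b = "u x" and \<gamma> = \<gamma>]
        by (simp only: mult_minus_left)
    qed simp
    also have "(LINT x:\<Omega>|lebesgue. ?g x) = (- ?q) * (c\<^sup>2 * pw 6 h + \<gamma>\<^sup>2 * pw 2 h)"
      unfolding pw_def set_integral_mult_right
      by (subst set_integral_add(2), (intro set_integrable_mult_right impI pi)+, simp only: set_integral_mult_right)
    also have "Re (cnj z * (z * a h ?w)) = (cmod z)\<^sup>2 * Re (a h ?w)"
    proof -
      have *: "cnj z * (z * X) = (z * cnj z) * X" for X by (simp add: mult_ac)
      show ?thesis unfolding * Re_mult_cnj_self(2) by (simp del: of_real_power)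
    qed
    finally have "(cmod z)\<^sup>2 * Re (a h ?w) \<le> (cmod z)\<^sup>2 * (\<tau> / (4 * \<nu>) * (c\<^sup>2 * pw 6 h + \<gamma>\<^sup>2 * pw 2 h))"
      by (simp add: mult_ac)
    moreover have "(cmod z)\<^sup>2 > 0" using pos(2) by (auto simp: z_def complex_eq_iff)
    ultimately have "Re (a h ?w) \<le> \<tau> / (4 * \<nu>) * (c\<^sup>2 * pw 6 h + \<gamma>\<^sup>2 * pw 2 h)"
      by (simp only: mult_le_cancel_left_pos)
    then show ?C using energy_parallelogram(2)[OF uh(2,1)] unfolding u'_def by simp
  qed
qed

end

section \<open>Uniform bounds\<close>

text \<open>Read off from \<open>step_growth\<close>: \<open>g\<close> stands for
  \<open>G / C1\<close>, \<open>L\<close> for the area and \<open>M\<close> for a bound of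
  \<open>pw 2\<close>. \<open>W\<close> bounds the energy of \<open>h - u\<close> relative to
  \<open>1 + en u\<close>, and \<open>2 + 2 * W\<close> does the same for \<open>h\<close>.\<close>

definition growth_rate :: "real \<Rightarrow> real \<Rightarrow> real \<Rightarrow> real \<Rightarrow> real \<Rightarrow> real \<Rightarrow> real \<Rightarrow> real \<Rightarrow> real" where
  "growth_rate \<nu> \<alpha> \<kappa> \<beta> \<gamma> g L M = (let c = cmod (Complex \<kappa> \<beta>);
     W = 2 / \<nu> * ((cmod (Complex \<nu> \<alpha>))\<^sup>2 / (2 * \<nu>) + c * (c / \<kappa>) ^ 3 * (g * M) + \<bar>\<gamma>\<bar> * M)
   in g * (2 + 2 * W) * (c\<^sup>2 + \<gamma>\<^sup>2 * L) / \<nu>)"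

context dg_stable
begin

lemma pw_0: "pw 0 v = (LINT x:\<Omega>|lebesgue. (1::real))"
  by (simp add: pw_def)

text \<open>The sixth power is estimated by \<open>pw 4 h * en h\<close>, and \<open>en h\<close> by
  the old energy only, so nothing has to be absorbed into the left side. \<open>pw 4 h\<close> stays
  in the exponent since only its weighted sum over the steps is bounded.\<close>

lemma step_growth:
  assumes eq: "step_eq \<tau> (Complex \<nu> \<alpha>) \<kappa> \<beta> \<gamma> u h" and pos: "\<tau> > 0" "\<nu> > 0" "\<kappa> > 0"
    and M: "pw 2 u \<le> M" "pw 2 (\<lambda>x. 2 * h x - u x) \<le> M"
  defines "L \<equiv> LINT x:\<Omega>|lebesgue. (1::real)"
  defines "Q \<equiv> growth_rate \<nu> \<alpha> \<kappa> \<beta> \<gamma> (G / C1) L M"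
  shows "1 + en (\<lambda>x. 2 * h x - u x) \<le> (1 + en u) * exp (Q * (\<tau> * pw 4 h + \<tau>))"
proof -
  define c where "c = cmod (Complex \<kappa> \<beta>)"
  define W where "W = 2 / \<nu> * ((cmod (Complex \<nu> \<alpha>))\<^sup>2 / (2 * \<nu>) + c * (c / \<kappa>) ^ 3 * (G / C1 * M) + \<bar>\<gamma>\<bar> * M)"
  have Q: "Q = G / C1 * (2 + 2 * W) * (c\<^sup>2 + \<gamma>\<^sup>2 * L) / \<nu>"
    unfolding Q_def growth_rate_def Let_def W_def c_def ..
  let ?P = "(2 + 2 * W) * (1 + en u)"
  have uh: "u \<in> V" "h \<in> V" using eq unfolding step_eq_def by auto
  note st = step_estimates[OF eq pos]
  have e0: "en u \<ge> 0" "en h \<ge> 0" using en_nonneg uh by auto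
  have M0: "M \<ge> 0" using M(1) pw_nonneg order_trans by blast
  have c0: "c \<ge> 0" by (simp add: c_def)
  have L0: "L \<ge> 0" unfolding L_def by (rule set_integral_nonneg) simp
  have GC: "G / C1 > 0" using G C1 by simp
  define k1 where "k1 = (cmod (Complex \<nu> \<alpha>))\<^sup>2 / (2 * \<nu>)"
  define k2 where "k2 = c * (c / \<kappa>) ^ 3"
  have k: "k1 \<ge> 0" "k2 \<ge> 0" using pos c0 by (auto simp: k1_def k2_def)
  \<comment> \<open>Linear in the energy because the \<open>L^2\<close> norm is already bounded; a
    higher power would make the growth factor depend on the energy itself.\<close>
  have p4: "pw 4 u \<le> G / C1 * M * en u"
  proof -
    have "pw 4 u \<le> G / C1 * pw 2 u * en u" using pw_estimate[OF uh(1), of 1] by simp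
    also have "\<dots> \<le> G / C1 * M * en u" using GC M(1) e0 by (intro mult_right_mono mult_left_mono) auto
    finally show ?thesis .
  qed
  have "\<nu> / 2 * en (\<lambda>x. h x - u x) \<le> k1 * en u + k2 * pw 4 u + \<bar>\<gamma>\<bar> / 2 * (pw 2 (\<lambda>x. 2 * h x - u x) + pw 2 u)"
    using st(2) unfolding k1_def k2_def c_def .
  also have "\<dots> \<le> k1 * en u + k2 * (G / C1 * M * en u) + \<bar>\<gamma>\<bar> / 2 * (M + M)"
    using k M p4 by (intro add_mono mult_left_mono order_refl) auto
  also have "\<dots> \<le> (k1 + k2 * (G / C1 * M) + \<bar>\<gamma>\<bar> * M) * (1 + en u)"
  proof -
    have "0 \<le> k1 + k2 * (G / C1 * M) + \<bar>\<gamma>\<bar> * M * en u"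
      using k GC M0 e0 by (intro add_nonneg_nonneg mult_nonneg_nonneg) auto
    then show ?thesis by (simp add: algebra_simps)
  qed
  finally have "en (\<lambda>x. h x - u x) \<le> W * (1 + en u)"
    using pos(2) unfolding W_def k1_def k2_def by (simp add: field_simps)
  then have eh: "en h \<le> ?P"
    using energy_parallelogram(1)[OF uh] e0 by (simp add: algebra_simps)
  have p6: "pw 6 h \<le> G / C1 * pw 4 h * ?P"
  proof -
    have "pw 6 h \<le> G / C1 * pw 4 h * en h" using pw_estimate[OF uh(2), of 2] by simp
    also have "\<dots> \<le> G / C1 * pw 4 h * ?P"
      by (intro mult_left_mono eh mult_nonneg_nonneg pw_nonneg less_imp_le[OF GC])
    finally show ?thesis .
  qed
  have p2: "pw 2 h \<le> G / C1 * L * ?P"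
  proof -
    have "pw 2 h \<le> G / C1 * L * en h" using pw_estimate[OF uh(2), of 0] by (simp add: pw_0 L_def)
    also have "\<dots> \<le> G / C1 * L * ?P"
      by (intro mult_left_mono eh mult_nonneg_nonneg L0 less_imp_le[OF GC])
    finally show ?thesis .
  qed
  define Z where "Z = G / C1 * ?P"
  have "?P \<ge> 0" using eh e0 by linarith
  then have Z0: "Z \<ge> 0" unfolding Z_def by (rule mult_nonneg_nonneg[OF less_imp_le[OF GC]])
  have "en (\<lambda>x. 2 * h x - u x) - en u \<le> 4 * (\<tau> / (4 * \<nu>) * (c\<^sup>2 * pw 6 h + \<gamma>\<^sup>2 * pw 2 h))"
  proof -
    have "x \<le> 4 * y" if "x / 4 \<le> y" for x y :: real using that by simp
    then show ?thesis using st(3) unfolding c_def .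
  qed
  also have "\<dots> \<le> 4 * (\<tau> / (4 * \<nu>) * (c\<^sup>2 * (pw 4 h * Z) + \<gamma>\<^sup>2 * (L * Z)))"
    using p6 p2 pos unfolding Z_def by (intro mult_left_mono add_mono) (auto simp: mult_ac)
  also have "\<dots> = \<tau> / \<nu> * Z * (c\<^sup>2 * pw 4 h + \<gamma>\<^sup>2 * L)" by (simp add: algebra_simps)
  also have "\<dots> \<le> \<tau> / \<nu> * Z * ((c\<^sup>2 + \<gamma>\<^sup>2 * L) * (pw 4 h + 1))"
  proof (intro mult_left_mono)
    have "0 \<le> c\<^sup>2 + \<gamma>\<^sup>2 * L * pw 4 h" using L0 pw_nonneg[of 4 h] by simp
    then show "c\<^sup>2 * pw 4 h + \<gamma>\<^sup>2 * L \<le> (c\<^sup>2 + \<gamma>\<^sup>2 * L) * (pw 4 h + 1)" by (simp add: algebra_simps)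
  qed (use pos Z0 in simp)
  also have "\<dots> = (1 + en u) * (Q * (\<tau> * pw 4 h + \<tau>))"
    unfolding Z_def Q by (simp add: algebra_simps add_divide_distrib)
  finally have "1 + en (\<lambda>x. 2 * h x - u x) \<le> (1 + en u) * (1 + Q * (\<tau> * pw 4 h + \<tau>))"
    by (simp add: algebra_simps)
  also have "\<dots> \<le> (1 + en u) * exp (Q * (\<tau> * pw 4 h + \<tau>))"
    using e0 by (intro mult_left_mono exp_ge_add_one_self) auto
  finally show ?thesis .
qed

text \<open>Two inductions over the steps: the first bounds the \<open>L^2\<close> norm together
  with the accumulated quartic sum \<open>S\<close>, the second is the Gronwall argument, whose
  exponent is controlled by that sum.\<close>

lemma scheme_bound:
  assumes pos: "\<tau> > 0" "\<nu> > 0" "\<kappa> > 0" "real N * \<tau> \<le> T"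
    and eq: "\<And>m. m < N \<Longrightarrow> step_eq \<tau> (Complex \<nu> \<alpha>) \<kappa> \<beta> \<gamma> (U m) (H m)"
    and UH: "\<And>m. m < N \<Longrightarrow> U (Suc m) = (\<lambda>x. 2 * H m x - U m x)"
    and init: "U 0 \<in> V" "en (U 0) \<le> A0" "pw 2 (U 0) \<le> M0"
  defines "L \<equiv> LINT x:\<Omega>|lebesgue. (1::real)"
  defines "M \<equiv> M0 + T * (\<gamma>\<^sup>2 / \<kappa> * L)"
  defines "Q \<equiv> growth_rate \<nu> \<alpha> \<kappa> \<beta> \<gamma> (G / C1) L M"
  assumes "m \<le> N"
  shows "U m \<in> V" "en (U m) \<le> (1 + A0) * exp (Q * (M / \<kappa> + T))"
proof -
  define S where "S m = (\<Sum>i<m. \<tau> * pw 4 (H i))" for m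
  have S0: "S m \<ge> 0" for m unfolding S_def using pos pw_nonneg by (intro sum_nonneg) auto
  have L0: "L \<ge> 0" unfolding L_def by (rule set_integral_nonneg) simp
  define X where "X = \<gamma>\<^sup>2 / \<kappa> * L"
  have g0: "X \<ge> 0" using L0 pos by (simp add: X_def)
  have mT: "real m * \<tau> \<le> T" if "m \<le> N" for m
    using that pos by (meson mult_right_mono of_nat_le_iff order_trans less_imp_le)
  have T0: "T \<ge> 0" using mT[of 0] by simp
  have UV: "U m \<in> V" if "m \<le> N" for m
  proof (cases m)
    case (Suc i)
    have "H i \<in> V" "U i \<in> V" using eq[of i] that Suc unfolding step_eq_def by auto
    then have "(\<lambda>x. 2 * H i x + (- 1) * U i x) \<in> V" by (intro DG_space_add DG_space_cmult)
    then show ?thesis using UH[of i] that Suc by simp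
  qed (use init in simp)
  then show "U m \<in> V" using assms by blast
  \<comment> \<open>The first step estimate multiplied by \<open>2 * \<tau>\<close>. The right side
    adds \<open>\<tau> * X\<close> per step, which is why \<open>M\<close> exceeds \<open>M0\<close>
    by \<open>T * X\<close>.\<close>
  have l2: "pw 2 (U m) + \<kappa> * S m \<le> M0 + real m * \<tau> * X" if "m \<le> N" for m
    using that
  proof (induction m)
    case 0
    then show ?case using init by (simp add: S_def)
  next
    case (Suc m)
    then have m: "m < N" by simp
    have hV: "H m \<in> V" using eq[OF m] unfolding step_eq_def by simp
    have "1 / (2 * \<tau>) * (pw 2 (U (Suc m)) - pw 2 (U m)) + \<kappa> / 2 * pw 4 (H m) + \<nu> * en (H m) \<le> \<gamma>\<^sup>2 / (2 * \<kappa>) * L"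
      using step_estimates(1)[OF eq[OF m] pos(1,2,3)] unfolding UH[OF m] pw_0 L_def .
    moreover have "\<nu> * en (H m) \<ge> 0" using en_nonneg[OF hV] pos by simp
    ultimately have "1 / (2 * \<tau>) * (pw 2 (U (Suc m)) - pw 2 (U m)) + \<kappa> / 2 * pw 4 (H m) \<le> \<gamma>\<^sup>2 / (2 * \<kappa>) * L" by linarith
    then have "(2 * \<tau>) * (1 / (2 * \<tau>) * (pw 2 (U (Suc m)) - pw 2 (U m)) + \<kappa> / 2 * pw 4 (H m)) \<le> (2 * \<tau>) * (\<gamma>\<^sup>2 / (2 * \<kappa>) * L)"
      using pos by (intro mult_left_mono) auto
    then have "pw 2 (U (Suc m)) - pw 2 (U m) + \<kappa> * (\<tau> * pw 4 (H m)) \<le> \<tau> * X"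
      using pos unfolding X_def by (simp add: distrib_left) (simp add: mult_ac)
    moreover have "pw 2 (U m) + \<kappa> * S m \<le> M0 + real m * \<tau> * X" using Suc by simp
    ultimately show ?case by (simp add: S_def algebra_simps)
  qed
  have l2M: "pw 2 (U m) + \<kappa> * S m \<le> M" if "m \<le> N" for m
  proof -
    have "real m * \<tau> * X \<le> T * X" by (rule mult_right_mono[OF mT[OF that] g0])
    then show ?thesis using l2[OF that] unfolding M_def X_def[symmetric] by linarith
  qed
  have pM: "pw 2 (U m) \<le> M" if "m \<le> N" for m
    using l2M[OF that] S0[of m] pos by (smt (verit) mult_nonneg_nonneg)
  have SM: "S m \<le> M / \<kappa>" if "m \<le> N" for m
  proof -
    have "\<kappa> * S m \<le> M" using l2M[OF that] pw_nonneg[of 2 "U m"] by linarith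
    then show ?thesis using pos by (simp add: field_simps)
  qed
  have grow: "1 + en (U m) \<le> (1 + en (U 0)) * exp (Q * (S m + real m * \<tau>))" if "m \<le> N" for m
    using that
  proof (induction m)
    case 0
    then show ?case by (simp add: S_def)
  next
    case (Suc m)
    then have m: "m < N" by simp
    have "1 + en (U (Suc m)) \<le> (1 + en (U m)) * exp (Q * (\<tau> * pw 4 (H m) + \<tau>))"
      using step_growth[OF eq[OF m] pos(1,2,3) pM[of m]] pM[of "Suc m"] m unfolding UH[OF m] Q_def L_def by simp
    also have "\<dots> \<le> ((1 + en (U 0)) * exp (Q * (S m + real m * \<tau>))) * exp (Q * (\<tau> * pw 4 (H m) + \<tau>))"
      using Suc by (intro mult_right_mono) auto
    also have "\<dots> = (1 + en (U 0)) * exp (Q * (S (Suc m) + real (Suc m) * \<tau>))"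
      by (simp add: S_def mult.assoc exp_add[symmetric] algebra_simps)
    finally show ?case .
  qed
  have M0: "M \<ge> 0" using pM[of 0] pw_nonneg order_trans by blast
  have Q0: "Q \<ge> 0"
    unfolding Q_def growth_rate_def Let_def using pos C1 G M0 L0 by (auto intro!: mult_nonneg_nonneg add_nonneg_nonneg divide_nonneg_pos)
  have "1 + en (U m) \<le> (1 + en (U 0)) * exp (Q * (S m + real m * \<tau>))" by (rule grow) fact
  also have "\<dots> \<le> (1 + A0) * exp (Q * (M / \<kappa> + T))"
    using init en_nonneg[OF init(1)] Q0 SM[OF \<open>m \<le> N\<close>] mT[OF \<open>m \<le> N\<close>]
    by (intro mult_mono) (auto intro!: mult_left_mono add_mono)
  finally show "en (U m) \<le> (1 + A0) * exp (Q * (M / \<kappa> + T))" by simp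
qed

text \<open>The projection is tested with itself. The Poincare constant \<open>S\<close> also serves
  as the weight in Young's inequality, so that exactly half of \<open>en r\<close> is absorbed; the
  summand 1 makes \<open>S\<close> positive.\<close>

lemma ritz_bound:
  assumes r: "is_ritz_projection k \<Omega> \<K> n lam w r"
    and w: "set_integrable lebesgue \<Omega> (\<lambda>x. (cmod (laplacian \<Omega> w x))\<^sup>2)"
  defines "S \<equiv> G / C1 * (LINT x:\<Omega>|lebesgue. (1::real)) + 1"
    and "D \<equiv> LINT x:\<Omega>|lebesgue. (cmod (laplacian \<Omega> w x))\<^sup>2"
  shows "r \<in> V" "en r \<le> S * D" "pw 2 r \<le> S * (S * D)"
proof -
  show rV: "r \<in> V" using r unfolding is_ritz_projection_def by simp
  define L where "L = (LINT x:\<Omega>|lebesgue. (1::real))"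
  have L0: "L \<ge> 0" unfolding L_def by (rule set_integral_nonneg) simp
  have GL: "G / C1 * L \<ge> 0" using G C1 L0 by simp
  have S: "S > 0" using GL unfolding S_def L_def by linarith
  have e0: "en r \<ge> 0" by (rule en_nonneg[OF rV])
  have "pw 2 r \<le> G / C1 * L * en r" using pw_estimate[OF rV, of 0] by (simp add: pw_0 L_def)
  also have "\<dots> \<le> S * en r" unfolding S_def L_def using e0 by (intro mult_right_mono) auto
  finally have p2: "pw 2 r \<le> S * en r" .
  have "en r = - Re (l2_inner \<Omega> (laplacian \<Omega> w) r)"
    using r rV unfolding is_ritz_projection_def en_def by simp
  also have "\<dots> \<le> S / 2 * D + 1 / (2 * S) * pw 2 r"
    using l2_inner_Re_bound[OF w pw_integrable[OF rV] S] unfolding D_def pw_def by linarith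
  also have "\<dots> \<le> S / 2 * D + 1 / (2 * S) * (S * en r)"
    using p2 S by (intro add_left_mono mult_left_mono) auto
  also have "\<dots> = S / 2 * D + en r / 2" using S by simp
  finally show e: "en r \<le> S * D" by simp
  show "pw 2 r \<le> S * (S * D)" using p2 e S by (meson mult_left_mono order_trans less_imp_le)
qed

end

theorem theorem3p3:
  fixes \<Omega> :: "(real^2) set" and T \<nu> \<alpha> \<kappa> \<beta> \<gamma> lam :: real and k :: nat
    and u0 :: "real^2 \<Rightarrow> complex" and u :: "real \<Rightarrow> real^2 \<Rightarrow> complex"
    and \<K> :: "nat \<Rightarrow> (real^2) set set" and n :: "nat \<Rightarrow> (real^2) set \<Rightarrow> real^2"
  assumes "convex_polygonal_domain \<Omega>" and "T > 0" and "\<nu> > 0" and "\<kappa> > 0" and "k \<ge> 1"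
    and "u0 \<in> sobolev (k + 1) \<Omega> \<inter> sobolev0 \<Omega>"
    and "smooth_GL_solution k \<Omega> T \<nu> \<alpha> \<kappa> \<beta> \<gamma> u0 u"
    and "\<And>j. conforming_mesh \<Omega> (\<K> j)"
    and "quasi_uniform \<K>"
    and "\<And>j. normal_field \<Omega> (\<K> j) (n j)"
    and "penalty_sufficient k \<Omega> \<K> n lam"
  shows "\<exists>C>0. \<forall>j N U. N \<ge> 1 \<longrightarrow>
           CN_DG_solution k \<Omega> (\<K> j) (n j) lam \<nu> \<alpha> \<kappa> \<beta> \<gamma> u0 (T / real N) N U \<longrightarrow>
           (\<forall>m\<le>N. DG_norm \<Omega> (\<K> j) (n j) (U m) \<le> C)"
proof -
  obtain C1 where C1: "C1 > 0" "\<And>j v. v \<in> DG_space k \<Omega> (\<K> j) \<Longrightarrow>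
      C1 * (DG_norm \<Omega> (\<K> j) (n j) v)\<^sup>2 \<le> Re (a_h \<Omega> (\<K> j) (n j) lam v v)"
    using assms(11) unfolding penalty_sufficient_def by blast
  obtain \<sigma> where \<sigma>: "\<sigma> > 0" "\<And>j K. K \<in> \<K> j \<Longrightarrow> \<exists>z. cball z (\<sigma> * mesh_size (\<K> j)) \<subseteq> K"
    using assms(9) unfolding quasi_uniform_def by blast
  obtain Ci where Ci: "\<And>m. Ci m > 0" "\<And>m q z h x. q \<in> Poly m \<Longrightarrow> x \<in> cball z h \<Longrightarrow> 0 < h \<Longrightarrow>
      h\<^sup>2 * (cmod (q x))\<^sup>2 \<le> Ci m * (LINT y:cball z (\<sigma> * h)|lebesgue. (cmod (q y))\<^sup>2)"
    using Poly_inverse_estimate[OF \<sigma>(1)] by metis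
  \<comment> \<open>One constant for three exponents: 9 bounds \<open>(Suc j)\<^sup>2\<close> for
    \<open>j \<le> 2\<close>, and the inverse estimate is applied to \<open>j\<close>-th powers, of
    degree at most \<open>j * k\<close>.\<close>
  define G where "G = 9 * (2 + 16 * (Ci (0 * k) + Ci (1 * k) + Ci (2 * k)))"
  have G: "G > 0" unfolding G_def using Ci(1) by (simp add: add_pos_pos)
  have stable: "dg_stable \<Omega> (\<K> j) (n j) k lam C1 G" for j
  proof -
    interpret dg_mesh \<Omega> "\<K> j" "n j" using assms by unfold_locales auto
    show ?thesis
    proof unfold_locales
      fix v i assume v: "v \<in> DG_space k \<Omega> (\<K> j)" and i: "(i::nat) \<le> 2"
      have "(LINT x:\<Omega>|lebesgue. cmod (v x) ^ (2 * Suc i))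
        \<le> ((real (Suc i))\<^sup>2 * (2 + 16 * Ci (i * k))) * (LINT x:\<Omega>|lebesgue. cmod (v x) ^ (2 * i)) * (DG_norm \<Omega> (\<K> j) (n j) v)\<^sup>2"
        by (rule DG_power_estimate[OF v \<sigma>(1) \<sigma>(2) Ci(1) Ci(2)])
      also have "\<dots> \<le> G * (LINT x:\<Omega>|lebesgue. cmod (v x) ^ (2 * i)) * (DG_norm \<Omega> (\<K> j) (n j) v)\<^sup>2"
      proof (intro mult_right_mono)
        have "i = 0 \<or> i = 1 \<or> i = 2" using i by auto
        then have "Ci (i * k) \<le> Ci (0 * k) + Ci (1 * k) + Ci (2 * k)" using less_imp_le[OF Ci(1)] by (auto simp: add_increasing add_increasing2)
        moreover have "(real (Suc i))\<^sup>2 \<le> 9" using i power_mono[of "real (Suc i)" 3 2] by simp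
        ultimately show "(real (Suc i))\<^sup>2 * (2 + 16 * Ci (i * k)) \<le> G"
          unfolding G_def using less_imp_le[OF Ci(1)] by (intro mult_mono) auto
      qed (auto intro: set_integral_nonneg)
      finally show "(LINT x:\<Omega>|lebesgue. cmod (v x) ^ (2 * Suc i))
        \<le> G * (LINT x:\<Omega>|lebesgue. cmod (v x) ^ (2 * i)) * (DG_norm \<Omega> (\<K> j) (n j) v)\<^sup>2" .
    qed (use C1 G in auto)
  qed
  have lap: "set_integrable lebesgue \<Omega> (\<lambda>x. (cmod (laplacian \<Omega> u0 x))\<^sup>2)"
  proof -
    have "sq_integrable \<Omega> (weak_deriv \<Omega> (i, l) u0)" if "i + l = 2" for i l
    proof -
      \<comment> \<open>\<open>k \<ge> 1\<close> provides the second weak derivatives, so the choice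
        in \<open>weak_deriv\<close> selects a genuine one.\<close>
      have "\<exists>g. has_weak_deriv \<Omega> (i, l) u0 g" using assms(5,6) that unfolding sobolev_def by auto
      then have "has_weak_deriv \<Omega> (i, l) u0 (weak_deriv \<Omega> (i, l) u0)" unfolding weak_deriv_def by (rule someI_ex)
      then show ?thesis unfolding has_weak_deriv_def by simp
    qed
    then show ?thesis unfolding laplacian_def by (intro sq_integrable_add) auto
  qed
  define L where "L = (LINT x:\<Omega>|lebesgue. (1::real))"
  define S where "S = G / C1 * L + 1"
  define D where "D = (LINT x:\<Omega>|lebesgue. (cmod (laplacian \<Omega> u0 x))\<^sup>2)"
  define M where "M = S * (S * D) + T * (\<gamma>\<^sup>2 / \<kappa> * L)"
  define Q where "Q = growth_rate \<nu> \<alpha> \<kappa> \<beta> \<gamma> (G / C1) L M"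
  define B where "B = (1 + S * D) * exp (Q * (M / \<kappa> + T))"
  show ?thesis
  \<comment> \<open>\<open>B\<close> and \<open>C1\<close> are fixed before the mesh and the number
    of steps. The absolute value avoids a sign argument for \<open>B\<close>, and the summand 1
    gives positivity.\<close>
  proof (intro exI[of _ "sqrt (\<bar>B\<bar> / C1) + 1"] conjI allI impI)
    show "0 < sqrt (\<bar>B\<bar> / C1) + 1" using C1(1) by (simp add: add_nonneg_pos)
    fix j N U m
    assume N: "1 \<le> (N::nat)" and sol: "CN_DG_solution k \<Omega> (\<K> j) (n j) lam \<nu> \<alpha> \<kappa> \<beta> \<gamma> u0 (T / real N) N U" and m: "m \<le> N"
    interpret dg_stable \<Omega> "\<K> j" "n j" k lam C1 G by (rule stable)
    let ?\<tau> = "T / real N"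
    have \<tau>: "?\<tau> > 0" "real N * ?\<tau> \<le> T" using N assms(2) by auto
    have ritz: "is_ritz_projection k \<Omega> (\<K> j) (n j) lam u0 (U 0)" using sol unfolding CN_DG_solution_def by simp
    note init = ritz_bound[OF ritz lap, folded L_def, folded S_def D_def]
    define H where "H i = midpoint_avg U (Suc i)" for i
    have UV: "U i \<in> V" if "i \<le> N" for i
      using sol init(1) that unfolding CN_DG_solution_def by (cases i) auto
    have eq: "step_eq ?\<tau> (Complex \<nu> \<alpha>) \<kappa> \<beta> \<gamma> (U i) (H i)" if i: "i < N" for i
    proof -
      have HV: "H i \<in> V"
      proof -
        have "(\<lambda>x. (1 / 2) * (U (Suc i) x + U i x)) \<in> V"
          by (intro DG_space_cmult DG_space_add UV) (use i in auto)
        moreover have "(\<lambda>x. (1 / 2) * (U (Suc i) x + U i x)) = H i"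
          by (simp add: H_def midpoint_avg_def fun_eq_iff)
        ultimately show ?thesis by simp
      qed
      \<comment> \<open>The increment over a full step is twice \<open>h - u\<close>, which brings
        the scheme into the form \<open>step_eq\<close>.\<close>
      have "D_tau ?\<tau> U (Suc i) = (\<lambda>x. of_real (2 / ?\<tau>) * (H i x - U i x))"
        using N assms(2) by (simp add: D_tau_def H_def midpoint_avg_def fun_eq_iff field_simps)
      moreover have "\<forall>v\<in>V. l2_inner \<Omega> (D_tau ?\<tau> U (Suc i)) v + Complex \<nu> \<alpha> * a (H i) v
          + Complex \<kappa> \<beta> * l2_inner \<Omega> (\<lambda>x. of_real ((cmod (H i x))\<^sup>2) * H i x) v - of_real \<gamma> * l2_inner \<Omega> (H i) v = 0"
      proof -
        have "Suc i \<in> {1..N}" using i by simp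
        then show ?thesis using sol unfolding CN_DG_solution_def H_def by blast
      qed
      ultimately show ?thesis
        unfolding step_eq_def using UV[of i] i HV by simp
    qed
    have UH: "U (Suc i) = (\<lambda>x. 2 * H i x - U i x)" for i
      by (simp add: H_def midpoint_avg_def fun_eq_iff add_divide_distrib)
    note bound = scheme_bound[OF \<tau>(1) assms(3,4) \<tau>(2) eq UH init m]
    have Um: "U m \<in> V" by (rule bound(1))
    have "en (U m) \<le> B"
      using bound(2) unfolding B_def Q_def M_def L_def .
    then have "(DG_norm \<Omega> (\<K> j) (n j) (U m))\<^sup>2 \<le> \<bar>B\<bar> / C1"
      using en_DG[OF Um] C1(1) by (smt (verit) divide_right_mono)
    then have "DG_norm \<Omega> (\<K> j) (n j) (U m) \<le> sqrt (\<bar>B\<bar> / C1)" by (rule real_le_rsqrt)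
    then show "DG_norm \<Omega> (\<K> j) (n j) (U m) \<le> sqrt (\<bar>B\<bar> / C1) + 1" by simp
  qed
qed

end
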